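(* There exists a morphism of $2$-colored non-symmetric operads $\theta: W(\overline{\mathsf{Act}})\to\mathcal{SC}_1$ such that $$\theta^{\mathfrak c}(n,0): W(\overline{\mathsf{Act}})(n,0;\mathfrak c)\to\mathcal{SC}_1(n,0;\mathfrak c)\quad\text{and}\quad \theta^{\mathfrak o}(n,1): W(\overline{\mathsf{Act}})(n,1;\mathfrak o)\to\mathcal{SC}_1(n,1;\mathfrak o)$$ are homotopy equivalences for every $n\ge1$.
   Context: All operads are non-symmetric topological operads. The two colors are $\mathfrak c$ (closed) and $\mathfrak o$ (open); $\mathcal P(p,q;\mathrm x)$ is the space of operations with $p$ closed inputs followed by $q$ open inputs and output color $\mathrm x$. The operad $\mathsf{Act}$ (monoid actions): $\mathsf{Act}(p,0;\mathfrak c)$ and $\mathsf{Act}(p,1;\mathfrak o)$ are one-point spaces for all $p\ge0$, and all other $\mathsf{Act}(p,q;\mathrm x)$ are empty. Its algebras are pairs $(X,P)$ with $X$ a topological monoid and $P$ a left $X$-space. $\overline{\mathsf{Act}}$ is the same except that $\overline{\mathsf{Act}}(0,0;\mathfrak c)=\emptyset$. $W(\overline{\mathsf{Act}})$ is the Boardman–Vogt $W$-construction: its elements are classes of planar rooted trees with edges colored by $\{\mathfrak c,\mathfrak o\}$, vertices labelled by elements of $\overline{\mathsf{Act}}$ of the appropriate colors, and internal edges labelled by lengths in $[0,1]$, modulo: an internal edge of length $0$ is contracted by composing the labels in $\overline{\mathsf{Act}}$; a vertex labelled by an identity is erased, the two adjacent edges being merged (the length being the maximum of the two lengths if both are internal).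 Operadic composition is grafting, with new internal edge of length $1$. (Thus elements may be viewed as planar metric trees with vertices of at least two inputs and colored edges.) The one-dimensional Swiss-cheese operad $\mathcal{SC}_1$. $\mathcal{SC}_1(n,0;\mathfrak c)$ is the space of configurations of $n$ little intervals (closed intervals of positive length with pairwise disjoint interiors, ordered from left to right) in $[0,1]$, with the usual composition of the little intervals operad. $\mathcal{SC}_1(n,i;\mathfrak o)$, $i\in\{0,1\}$, is the space of configurations of little intervals in $[-1,1]$ that are invariant under $x\mapsto-x$, consisting of $n$ pairs of conjugate (mirror) intervals, together with one little interval centered at the origin if $i=1$ and no interval centered at the origin if $i=0$. The open-input composition $\circ^{\mathfrak o}:\mathcal{SC}_1(p,1;\mathfrak o)\times\mathcal{SC}_1(q,i;\mathfrak o)\to\mathcal{SC}_1(p+q,i;\mathfrak o)$ glues the rescaled second configuration into the central interval of the first. The closed-input composition $\circ_i^{\mathfrak c}:\mathcal{SC}_1(k,i';\mathfrak o)\times\mathcal{SC}_1(n,0;\mathfrak c)\to\mathcal{SC}_1(k+n-1,i';\mathfrak o)$ symmetrizes the configuration in $[0,1]$ and glues the resulting rescaled configuration and its mirror image into the two intervals of the $i$th conjugate pair. Equivalently, $\mathcal{SC}_1(n,1;\mathfrak o)$ is the space of configurations of $n+1$ little intervals in $[0,1]$ (ordered left to right) whose last interval contains $1$, the last interval being the open input and the first $n$ the closed inputs, with the usual little-intervals composition. *)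

theory Defs
  imports "HOL-Analysis.Analysis"
begin

section \<open>Two-coloured non-symmetric topological operads\<close>

datatype color = Closed | Open

text \<open>
  \<open>ops P cs x\<close> is the space of operations with input colours \<open>cs\<close> (from left to right) and
  output colour \<open>x\<close>; so \<open>P(p,q;x)\<close> is \<open>ops P (profile p q) x\<close>.
  \<open>pcomp P cs x i ds f g\<close> is the partial composition that plugs \<open>g \<in> P(ds; cs ! i)\<close> into the
  \<open>i\<close>-th input (counted from \<open>0\<close>) of \<open>f \<in> P(cs; x)\<close>. All operations live in one type, so the
  profiles are passed along as arguments.
\<close>

record 'a operad =
  ops :: "color list \<Rightarrow> color \<Rightarrow> 'a topology"
  ident :: "color \<Rightarrow> 'a"
  pcomp :: "color list \<Rightarrow> color \<Rightarrow> nat \<Rightarrow> color list \<Rightarrow> 'a \<Rightarrow> 'a \<Rightarrow> 'a"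

definition profile :: "nat \<Rightarrow> nat \<Rightarrow> color list" where
  "profile p q = replicate p Closed @ replicate q Open"

definition plug :: "'c list \<Rightarrow> nat \<Rightarrow> 'c list \<Rightarrow> 'c list" where
  "plug cs i ds = take i cs @ ds @ drop (Suc i) cs"

definition is_operad :: "'a operad \<Rightarrow> bool" where
  "is_operad P \<longleftrightarrow>
     (\<forall>c. ident P c \<in> topspace (ops P [c] c)) \<and>
     (\<forall>cs x i ds. i < length cs \<longrightarrow>
        continuous_map (prod_topology (ops P cs x) (ops P ds (cs ! i))) (ops P (plug cs i ds) x)
          (\<lambda>(f, g). pcomp P cs x i ds f g)) \<and>
     (\<forall>cs x. \<forall>f \<in> topspace (ops P cs x). pcomp P [x] x 0 cs (ident P x) f = f) \<and>
     (\<forall>cs x i. \<forall>f \<in> topspace (ops P cs x). i < length cs \<longrightarrow>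
        pcomp P cs x i [cs ! i] f (ident P (cs ! i)) = f) \<and>
     (\<forall>cs x i ds j es.
        \<forall>f \<in> topspace (ops P cs x). \<forall>g \<in> topspace (ops P ds (cs ! i)). \<forall>h \<in> topspace (ops P es (ds ! j)).
        i < length cs \<and> j < length ds \<longrightarrow>
        pcomp P (plug cs i ds) x (i + j) es (pcomp P cs x i ds f g) h
        = pcomp P cs x i (plug ds j es) f (pcomp P ds (cs ! i) j es g h)) \<and>
     (\<forall>cs x i ds k es.
        \<forall>f \<in> topspace (ops P cs x). \<forall>g \<in> topspace (ops P ds (cs ! i)). \<forall>h \<in> topspace (ops P es (cs ! k)).
        i < k \<and> k < length cs \<longrightarrow>
        pcomp P (plug cs i ds) x (k + length ds - 1) es (pcomp P cs x i ds f g) h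
        = pcomp P (plug cs k es) x i ds (pcomp P cs x k es f h) g)"

definition operad_morphism ::
  "'a operad \<Rightarrow> 'b operad \<Rightarrow> (color list \<Rightarrow> color \<Rightarrow> 'a \<Rightarrow> 'b) \<Rightarrow> bool" where
  "operad_morphism P Q \<theta> \<longleftrightarrow>
     is_operad P \<and> is_operad Q \<and>
     (\<forall>cs x. continuous_map (ops P cs x) (ops Q cs x) (\<theta> cs x)) \<and>
     (\<forall>c. \<theta> [c] c (ident P c) = ident Q c) \<and>
     (\<forall>cs x i ds. \<forall>f \<in> topspace (ops P cs x). \<forall>g \<in> topspace (ops P ds (cs ! i)).
        i < length cs \<longrightarrow>
        \<theta> (plug cs i ds) x (pcomp P cs x i ds f g)
        = pcomp Q cs x i ds (\<theta> cs x f) (\<theta> ds (cs ! i) g))"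

text \<open>The map-level version of \<^const>\<open>homotopy_equivalent_space\<close>.\<close>

definition homotopy_equivalence_map :: "'a topology \<Rightarrow> 'b topology \<Rightarrow> ('a \<Rightarrow> 'b) \<Rightarrow> bool" where
  "homotopy_equivalence_map X Y f \<longleftrightarrow>
     continuous_map X Y f \<and>
     (\<exists>g. continuous_map Y X g \<and>
          homotopic_with (\<lambda>_. True) X X (g \<circ> f) id \<and>
          homotopic_with (\<lambda>_. True) Y Y (f \<circ> g) id)"


section \<open>The operad of monoid actions\<close>

definition Act :: "unit operad" where
  "Act = \<lparr> ops = (\<lambda>cs x.
             if (\<exists>p. cs = profile p 0 \<and> x = Closed) \<or> (\<exists>p. cs = profile p 1 \<and> x = Open)
             then discrete_topology {()} else discrete_topology {}),
           ident = (\<lambda>_. ()),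
           pcomp = (\<lambda>_ _ _ _ _ _. ()) \<rparr>"

definition Act_bar :: "unit operad" where
  "Act_bar = Act \<lparr> ops := (\<lambda>cs x. if cs = [] \<and> x = Closed then discrete_topology {} else ops Act cs x) \<rparr>"


section \<open>Planar coloured trees\<close>

text \<open>
  Vertices carry a label in \<open>'v\<close> and the colour of their output edge; internal edges carry a label
  in \<open>'e\<close>, external edges only a colour. An internal edge has the output colour of its upper vertex.
  \<open>Trivial c\<close> is the tree without vertices, consisting of a single edge of colour \<open>c\<close>.
\<close>

datatype ('v, 'e) vertex = Vertex color 'v "('v, 'e) branch list"
  and ('v, 'e) branch = Leaf color | Branch 'e "('v, 'e) vertex"

datatype ('v, 'e) tree = Trivial color | Rooted "('v, 'e) vertex"

fun vertex_color :: "('v, 'e) vertex \<Rightarrow> color" where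
  "vertex_color (Vertex c v bs) = c"

fun branch_color :: "('v, 'e) branch \<Rightarrow> color" where
  "branch_color (Leaf c) = c"
| "branch_color (Branch e w) = vertex_color w"

fun root_color :: "('v, 'e) tree \<Rightarrow> color" where
  "root_color (Trivial c) = c"
| "root_color (Rooted w) = vertex_color w"

fun leaves_vertex :: "('v, 'e) vertex \<Rightarrow> color list"
  and leaves_branch :: "('v, 'e) branch \<Rightarrow> color list" where
  "leaves_vertex (Vertex c v bs) = concat (map leaves_branch bs)"
| "leaves_branch (Leaf c) = [c]"
| "leaves_branch (Branch e w) = leaves_vertex w"

fun leaves :: "('v, 'e) tree \<Rightarrow> color list" where
  "leaves (Trivial c) = [c]"
| "leaves (Rooted w) = leaves_vertex w"

text \<open>The vertices in preorder, each with its label, its input colours and its output colour.\<close>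

fun vertices_vertex :: "('v, 'e) vertex \<Rightarrow> ('v \<times> color list \<times> color) list"
  and vertices_branch :: "('v, 'e) branch \<Rightarrow> ('v \<times> color list \<times> color) list" where
  "vertices_vertex (Vertex c v bs) = (v, map branch_color bs, c) # concat (map vertices_branch bs)"
| "vertices_branch (Leaf c) = []"
| "vertices_branch (Branch e w) = vertices_vertex w"

fun vertices :: "('v, 'e) tree \<Rightarrow> ('v \<times> color list \<times> color) list" where
  "vertices (Trivial c) = []"
| "vertices (Rooted w) = vertices_vertex w"

fun edges_vertex :: "('v, 'e) vertex \<Rightarrow> 'e list"
  and edges_branch :: "('v, 'e) branch \<Rightarrow> 'e list" where
  "edges_vertex (Vertex c v bs) = concat (map edges_branch bs)"
| "edges_branch (Leaf c) = []"
| "edges_branch (Branch e w) = e # edges_vertex w"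

fun edges :: "('v, 'e) tree \<Rightarrow> 'e list" where
  "edges (Trivial c) = []"
| "edges (Rooted w) = edges_vertex w"

text \<open>\<open>graft_vertex w i b\<close> replaces the \<open>i\<close>-th leaf of \<open>w\<close> by the branch \<open>b\<close>.\<close>

fun graft_vertex :: "('v, 'e) vertex \<Rightarrow> nat \<Rightarrow> ('v, 'e) branch \<Rightarrow> ('v, 'e) vertex"
  and graft_branches :: "('v, 'e) branch list \<Rightarrow> nat \<Rightarrow> ('v, 'e) branch \<Rightarrow> ('v, 'e) branch list" where
  "graft_vertex (Vertex c v bs) i b = Vertex c v (graft_branches bs i b)"
| "graft_branches [] i b = []"
| "graft_branches (Leaf c # bs) i b =
     (if i = 0 then b # bs else Leaf c # graft_branches bs (i - 1) b)"
| "graft_branches (Branch e w # bs) i b =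
     (if i < length (leaves_vertex w) then Branch e (graft_vertex w i b) # bs
      else Branch e w # graft_branches bs (i - length (leaves_vertex w)) b)"

text \<open>Grafting onto, or of, a trivial tree creates no new internal edge.\<close>

fun graft :: "('v, real) tree \<Rightarrow> nat \<Rightarrow> ('v, real) tree \<Rightarrow> ('v, real) tree" where
  "graft (Trivial c) i u = u"
| "graft (Rooted w) i (Trivial c) = Rooted w"
| "graft (Rooted w) i (Rooted w') = Rooted (graft_vertex w i (Branch 1 w'))"


section \<open>The Boardman-Vogt construction\<close>

definition labelled_trees :: "'a operad \<Rightarrow> color list \<Rightarrow> color \<Rightarrow> ('a, real) tree set" where
  "labelled_trees P cs x =
     {t. leaves t = cs \<and> root_color t = x \<and>
         (\<forall>(v, ds, d) \<in> set (vertices t). v \<in> topspace (ops P ds d)) \<and>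
         (\<forall>l \<in> set (edges t). 0 \<le> l \<and> l \<le> 1)}"

inductive bv_vertex :: "'a operad \<Rightarrow> ('a, real) vertex \<Rightarrow> ('a, real) vertex \<Rightarrow> bool"
  for P :: "'a operad" where
  contract:
    "bv_vertex P (Vertex c v (as @ Branch 0 (Vertex d w cs) # bs))
       (Vertex c
         (pcomp P (map branch_color as @ d # map branch_color bs) c (length as) (map branch_color cs) v w)
         (as @ cs @ bs))"
| erase_below_leaf:
    "bv_vertex P (Vertex c v (as @ Branch l (Vertex d (ident P d) [Leaf d]) # bs))
       (Vertex c v (as @ Leaf d # bs))"
| erase_between:
    "vertex_color w = d \<Longrightarrow>
     bv_vertex P (Vertex c v (as @ Branch l (Vertex d (ident P d) [Branch m w]) # bs))
       (Vertex c v (as @ Branch (max l m) w # bs))"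
| inside:
    "bv_vertex P w w' \<Longrightarrow>
     bv_vertex P (Vertex c v (as @ Branch l w # bs)) (Vertex c v (as @ Branch l w' # bs))"

inductive bv_step :: "'a operad \<Rightarrow> ('a, real) tree \<Rightarrow> ('a, real) tree \<Rightarrow> bool"
  for P :: "'a operad" where
  rooted: "bv_vertex P w w' \<Longrightarrow> bv_step P (Rooted w) (Rooted w')"
| erase_only: "bv_step P (Rooted (Vertex d (ident P d) [Leaf d])) (Trivial d)"
| erase_root:
    "vertex_color w = d \<Longrightarrow> bv_step P (Rooted (Vertex d (ident P d) [Branch m w])) (Rooted w)"

definition bv_equiv :: "'a operad \<Rightarrow> color list \<Rightarrow> color \<Rightarrow> ('a, real) tree rel" where
  "bv_equiv P cs x =
     {(s, t). s \<in> labelled_trees P cs x \<and>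
        equivclp (\<lambda>s t. s \<in> labelled_trees P cs x \<and> t \<in> labelled_trees P cs x \<and> bv_step P s t) s t}"

text \<open>
  A tree shape is a planar coloured tree whose vertices and whose internal edges are numbered in
  preorder. The labelled trees of a given shape form the product of the spaces of vertex labels and
  of a cube of edge lengths.
\<close>

definition shapes :: "color list \<Rightarrow> color \<Rightarrow> (nat, nat) tree set" where
  "shapes cs x =
     {S. leaves S = cs \<and> root_color S = x \<and>
         map fst (vertices S) = [0..<length (vertices S)] \<and>
         edges S = [0..<length (edges S)]}"

definition cell :: "'a operad \<Rightarrow> (nat, nat) tree \<Rightarrow> ((nat \<Rightarrow> 'a) \<times> (nat \<Rightarrow> real)) topology" where
  "cell P S =
     prod_topology
       (product_topology (\<lambda>k. case vertices S ! k of (_, ds, d) \<Rightarrow> ops P ds d) {..<length (vertices S)})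
       (product_topology (\<lambda>_. top_of_set {0..1}) {..<length (edges S)})"

fun realize :: "(nat, nat) tree \<times> (nat \<Rightarrow> 'a) \<times> (nat \<Rightarrow> real) \<Rightarrow> ('a, real) tree" where
  "realize (S, lab, len) = map_tree lab len S"

definition quotient_topology :: "'a topology \<Rightarrow> ('a \<Rightarrow> 'b) \<Rightarrow> 'b topology" where
  "quotient_topology X q =
     topology (\<lambda>U. U \<subseteq> q ` topspace X \<and> openin X {z \<in> topspace X. q z \<in> U})"

lemma openin_quotient_topology:
  "openin (quotient_topology X q) U \<longleftrightarrow> U \<subseteq> q ` topspace X \<and> openin X {z \<in> topspace X. q z \<in> U}"
proof -
  have "istopology (\<lambda>U. U \<subseteq> q ` topspace X \<and> openin X {z \<in> topspace X. q z \<in> U})"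
    unfolding istopology_def
  proof (intro conjI allI impI)
    fix S T
    assume S: "S \<subseteq> q ` topspace X \<and> openin X {z \<in> topspace X. q z \<in> S}"
      and T: "T \<subseteq> q ` topspace X \<and> openin X {z \<in> topspace X. q z \<in> T}"
    show "S \<inter> T \<subseteq> q ` topspace X"
      using S by blast
    have "{z \<in> topspace X. q z \<in> S \<inter> T} = {z \<in> topspace X. q z \<in> S} \<inter> {z \<in> topspace X. q z \<in> T}"
      by blast
    then show "openin X {z \<in> topspace X. q z \<in> S \<inter> T}"
      using S T by (simp add: openin_Int)
  next
    fix \<K>
    assume K: "\<forall>K\<in>\<K>. K \<subseteq> q ` topspace X \<and> openin X {z \<in> topspace X. q z \<in> K}"
    show "\<Union>\<K> \<subseteq> q ` topspace X"
      using K by blast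
    have "{z \<in> topspace X. q z \<in> \<Union>\<K>} = (\<Union>K\<in>\<K>. {z \<in> topspace X. q z \<in> K})"
      by blast
    then show "openin X {z \<in> topspace X. q z \<in> \<Union>\<K>}"
      using K by (metis (no_types, lifting) imageE openin_Union)
  qed
  then show ?thesis
    by (simp add: quotient_topology_def)
qed

lemma topspace_quotient_topology [simp]: "topspace (quotient_topology X q) = q ` topspace X"
proof (rule antisym)
  show "topspace (quotient_topology X q) \<subseteq> q ` topspace X"
    using openin_topspace[of "quotient_topology X q"] unfolding openin_quotient_topology by blast
  have "{z \<in> topspace X. q z \<in> q ` topspace X} = topspace X"
    by blast
  then have "openin (quotient_topology X q) (q ` topspace X)"
    by (simp add: openin_quotient_topology)
  then show "q ` topspace X \<subseteq> topspace (quotient_topology X q)"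
    by (rule openin_subset)
qed

lemma quotient_map_quotient_topology: "quotient_map X (quotient_topology X q) q"
  by (auto simp: quotient_map_def openin_quotient_topology)

definition W :: "'a operad \<Rightarrow> ('a, real) tree set operad" where
  "W P = \<lparr> ops = (\<lambda>cs x. quotient_topology (sum_topology (cell P) (shapes cs x))
                           (\<lambda>z. bv_equiv P cs x `` {realize z})),
           ident = (\<lambda>c. bv_equiv P [c] c `` {Trivial c}),
           pcomp = (\<lambda>cs x i ds A B. \<Union>s\<in>A. \<Union>t\<in>B. bv_equiv P (plug cs i ds) x `` {graft s i t}) \<rparr>"


section \<open>The one-dimensional Swiss-cheese operad\<close>

text \<open>
  A configuration of \<open>k\<close> little intervals in \<open>[l, 1]\<close> (with \<open>l\<close> either \<open>0\<close> or \<open>-1\<close>) is the family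
  of the pairs of endpoints of its intervals, which are numbered \<open>0, \<dots>, k - 1\<close> from left to right.
\<close>

type_synonym config = "nat \<Rightarrow> real \<times> real"

definition configs :: "real \<Rightarrow> nat \<Rightarrow> config set" where
  "configs l k =
     {I \<in> {..<k} \<rightarrow>\<^sub>E UNIV.
        (\<forall>j<k. l \<le> fst (I j) \<and> fst (I j) < snd (I j) \<and> snd (I j) \<le> 1) \<and>
        (\<forall>i j. i < j \<and> j < k \<longrightarrow> snd (I i) \<le> fst (I j))}"

definition closed_configs :: "nat \<Rightarrow> config topology" where
  "closed_configs n = subtopology (product_topology (\<lambda>_. euclidean) {..<n}) (configs 0 n)"

text \<open>
  Reflection in the origin reverses the order of the intervals. Hence for \<open>i = 1\<close> the middle
  interval is centred at the origin, and for \<open>i = 0\<close> no interval is. The \<open>j\<close>-th conjugate pair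
  (\<open>j < n\<close>) consists of the intervals number \<open>j\<close> and \<open>2 * n + i - 1 - j\<close>, the former contained
  in \<open>[-1, 0]\<close>.
\<close>

definition open_configs :: "nat \<Rightarrow> nat \<Rightarrow> config topology" where
  "open_configs n i =
     subtopology (product_topology (\<lambda>_. euclidean) {..<2 * n + i})
       {I \<in> configs (-1) (2 * n + i).
          \<forall>j < 2 * n + i. I (2 * n + i - 1 - j) = (- snd (I j), - fst (I j))}"

text \<open>The image of \<open>J\<close> under the increasing affine bijection from \<open>[l, 1]\<close> onto \<open>I\<close>.\<close>

definition rescale :: "real \<Rightarrow> real \<times> real \<Rightarrow> real \<times> real \<Rightarrow> real \<times> real" where
  "rescale l I J =
     (fst I + (snd I - fst I) * ((fst J - l) / (1 - l)),
      fst I + (snd I - fst I) * ((snd J - l) / (1 - l)))"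

text \<open>Glues the configuration \<open>J\<close> of \<open>m\<close> intervals in \<open>[l, 1]\<close> into interval \<open>i\<close> of the \<open>k\<close> intervals of \<open>I\<close>.\<close>

definition glue :: "real \<Rightarrow> nat \<Rightarrow> nat \<Rightarrow> nat \<Rightarrow> config \<Rightarrow> config \<Rightarrow> config" where
  "glue l k i m I J =
     (\<lambda>j \<in> {..<k + m - 1}.
        if j < i then I j
        else if j < i + m then rescale l (I i) (J (j - i))
        else I (j + 1 - m))"

text \<open>The mirror image in \<open>[0, 1]\<close> of a configuration of \<open>m\<close> intervals in \<open>[0, 1]\<close>.\<close>

definition mirror :: "nat \<Rightarrow> config \<Rightarrow> config" where
  "mirror m J = (\<lambda>j \<in> {..<m}. (1 - snd (J (m - 1 - j)), 1 - fst (J (m - 1 - j))))"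

text \<open>
  Closed composition in a symmetric configuration \<open>I\<close> of \<open>k\<close> intervals: a copy of \<open>J\<close> is glued into
  interval \<open>i\<close> (in \<open>[-1, 0]\<close>), and its mirror image into the conjugate interval \<open>k - 1 - i\<close>.
\<close>

definition glue_symmetric :: "nat \<Rightarrow> nat \<Rightarrow> nat \<Rightarrow> config \<Rightarrow> config \<Rightarrow> config" where
  "glue_symmetric k i m I J = glue 0 (k + m - 1) i m (glue 0 k (k - 1 - i) m I (mirror m J)) J"

text \<open>Number of intervals in \<open>[-1, 1]\<close> of an operation with open output and input colours \<open>cs\<close>.\<close>

definition open_size :: "color list \<Rightarrow> nat" where
  "open_size cs = 2 * count_list cs Closed + count_list cs Open"

definition SC1 :: "config operad" where
  "SC1 = \<lparr> ops = (\<lambda>cs x.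
             let n = count_list cs Closed; i = count_list cs Open in
             if cs = profile n i \<and> x = Closed \<and> i = 0 then closed_configs n
             else if cs = profile n i \<and> x = Open \<and> i \<le> 1 then open_configs n i
             else discrete_topology {}),
           ident = (\<lambda>c. \<lambda>j \<in> {..<1}. (case c of Closed \<Rightarrow> (0, 1) | Open \<Rightarrow> (- 1, 1))),
           pcomp = (\<lambda>cs x i ds I J.
             case x of
               Closed \<Rightarrow> glue 0 (length cs) i (length ds) I J
             | Open \<Rightarrow> (case cs ! i of
                   Closed \<Rightarrow> glue_symmetric (open_size cs) i (length ds) I J
                 | Open \<Rightarrow> glue (-1) (open_size cs) i (open_size ds) I J)) \<rparr>"

end

theory Submission
  imports Defs
begin

text \<open>
  \<open>Act_bar\<close> has at most one operation of each profile. Hence an element of \<open>W Act_bar\<close> of a given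
  profile is determined by the lengths of the edges above the proper leaf intervals with at least two
  leaves (\<open>0\<close> if there is no such edge). These coordinates embed the operation spaces of \<open>W Act_bar\<close>
  as compact subsets of a product of lines in which composition is continuous, and scaling all
  lengths to \<open>0\<close> contracts the spaces. The configuration spaces are convex. So every continuous map
  between these spaces is a homotopy equivalence, and any operad morphism does. We send a tree to
  adjacent intervals filling \<open>[0, 1]\<close>, whose widths are obtained by dividing an interval at every
  vertex in proportion to the widths of the subtrees, where a subtree of width \<open>T\<close> above an edge of
  length \<open>l\<close> counts with \<open>min T (1/l)\<close>. For the open colour, such a configuration is moved to
  \<open>[-1, 0]\<close> and united with its mirror image.
\<close>

subsection \<open>Gluing little intervals\<close>

text \<open>Since all spaces involved turn out contractible, the difficulty lies in strict
  compatibility with composition and in the topology. Composition in \<open>W Act_bar\<close> is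
  defined on a product of two quotient spaces, and a product of quotient maps need not be a quotient
  map, so its continuity cannot be tested on cells. It is tested on edge lengths instead, which
  needs compactness; this is not immediate either, because unary vertices produce infinitely many
  shapes for one profile. The rule \<open>min T (1/l)\<close> becomes transparent for reciprocals:
  an edge of length \<open>l\<close> replaces 1/T by the maximum of 1/T and \<open>l\<close>, and
  the maximum is also how lengths merge when an identity vertex is erased.\<close>

lemma rescale_rescale: "rescale l' (rescale l I J) K = rescale l I (rescale l' J K)"
  by (simp add: rescale_def divide_inverse algebra_simps)

lemma rescale_full [simp]: "l \<noteq> 1 \<Longrightarrow> rescale l (l, 1) J = J" "l \<noteq> 1 \<Longrightarrow> rescale l I (l, 1) = I"
  by (simp_all add: rescale_def prod_eq_iff)

lemma glue_before: "j < i \<Longrightarrow> i < k \<Longrightarrow> glue l k i m I J j = I j"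
  and glue_within: "i \<le> j \<Longrightarrow> j < i + m \<Longrightarrow> i < k \<Longrightarrow> glue l k i m I J j = rescale l (I i) (J (j - i))"
  and glue_after: "i + m \<le> j \<Longrightarrow> j < k + m - 1 \<Longrightarrow> glue l k i m I J j = I (j + 1 - m)"
  by (auto simp: glue_def)

lemma mirror_apply: "j < m \<Longrightarrow> mirror m J j = (1 - snd (J (m - 1 - j)), 1 - fst (J (m - 1 - j)))"
  by (simp add: mirror_def)

text \<open>The sizes \<open>k'\<close>, \<open>m'\<close> and the index \<open>a\<close> are
  variables tied by equations, so that the rule applies whatever form truncated subtraction gives
  them. The base points \<open>l\<close> and \<open>l'\<close> are independent because a centre is
  rescaled from [-1, 1] and a closed interval from [0, 1].\<close>

lemma glue_nested:
  assumes "i < k" "j < m" "k' = k + m - 1" "a = i + j" "m' = m + p - 1"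
  shows "glue l' k' a p (glue l k i m I J) K = glue l k i m' I (glue l' m j p J K)"
  unfolding assms(3-5)
proof
  fix x
  consider "x < i" | "i \<le> x" "x < i + j" | "i + j \<le> x" "x < i + j + p" | "i + j + p \<le> x" "x < i + m + p - 1"
    | "i + m + p - 1 \<le> x" "x < k + m + p - 2" | "x \<ge> k + m + p - 2"
    by linarith
  then show "glue l' (k + m - 1) (i + j) p (glue l k i m I J) K x
           = glue l k i (m + p - 1) I (glue l' m j p J K) x"
  proof cases
    case 4
    have "glue l' (k + m - 1) (i + j) p (glue l k i m I J) K x = glue l k i m I J (x + 1 - p)"
      by (rule glue_after) (use 4 assms(1,2) in linarith)+
    also have "\<dots> = rescale l (I i) (J (x + 1 - p - i))"
      by (rule glue_within) (use 4 assms(1,2) in linarith)+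
    also have "x + 1 - p - i = x - i + 1 - p" using 4 by linarith
    also have "J \<dots> = glue l' m j p J K (x - i)"
      by (rule glue_after[symmetric]) (use 4 assms(1,2) in linarith)+
    also have "rescale l (I i) \<dots> = glue l k i (m + p - 1) I (glue l' m j p J K) x"
      by (rule glue_within[symmetric]) (use 4 assms(1,2) in linarith)+
    finally show ?thesis .
  next
    case 5
    have "glue l' (k + m - 1) (i + j) p (glue l k i m I J) K x = glue l k i m I J (x + 1 - p)"
      by (rule glue_after) (use 5 assms(1,2) in linarith)+
    also have "\<dots> = I (x + 1 - p + 1 - m)"
      by (rule glue_after) (use 5 assms(1,2) in linarith)+
    also have "x + 1 - p + 1 - m = x + 1 - (m + p - 1)" using 5 assms(1,2) by linarith
    also have "I \<dots> = glue l k i (m + p - 1) I (glue l' m j p J K) x"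
      by (rule glue_after[symmetric]) (use 5 assms(1,2) in linarith)+
    finally show ?thesis .
  next
    case 3
    then have e: "x - i - j = x - (i + j)" by linarith
    show ?thesis using assms(1,2) 3 e by (simp add: glue_def rescale_rescale)
  qed (use assms(1,2) in \<open>auto simp add: glue_def\<close>)
qed

text \<open>Gluing at \<open>i\<close> moves the later interval \<open>j\<close> to
  \<open>j + m - 1\<close>; because of \<open>i < j\<close> this is not truncated even when
  \<open>m = 0\<close>.\<close>

lemma glue_parallel:
  assumes "i < j" "j < k" "k' = k + m - 1" "a = j + m - 1" "k'' = k + p - 1"
  shows "glue l' k' a p (glue l k i m I J) K = glue l k'' i m (glue l' k j p I K) J"
  unfolding assms(3-5)
proof
  fix x
  consider "x < i" | "i \<le> x" "x < i + m" | "i + m \<le> x" "x < j + m - 1" | "j + m - 1 \<le> x" "x < j + m - 1 + p"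
    | "j + m - 1 + p \<le> x" "x < k + m + p - 2" | "x \<ge> k + m + p - 2"
    by linarith
  then show "glue l' (k + m - 1) (j + m - 1) p (glue l k i m I J) K x
           = glue l (k + p - 1) i m (glue l' k j p I K) J x"
  proof cases
    case 4
    have "glue l' (k + m - 1) (j + m - 1) p (glue l k i m I J) K x
        = rescale l' (glue l k i m I J (j + m - 1)) (K (x - (j + m - 1)))"
      by (rule glue_within) (use 4 assms(1,2) in linarith)+
    also have "glue l k i m I J (j + m - 1) = I (j + m - 1 + 1 - m)"
      by (rule glue_after) (use 4 assms(1,2) in linarith)+
    also have "j + m - 1 + 1 - m = j" using assms(1,2) by linarith
    also have "x - (j + m - 1) = x + 1 - m - j" using 4 assms(1,2) by linarith
    also have "rescale l' (I j) (K (x + 1 - m - j)) = glue l' k j p I K (x + 1 - m)"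
      by (rule glue_within[symmetric]) (use 4 assms(1,2) in linarith)+
    also have "\<dots> = glue l (k + p - 1) i m (glue l' k j p I K) J x"
      by (rule glue_after[symmetric]) (use 4 assms(1,2) in linarith)+
    finally show ?thesis .
  next
    case 5
    have "glue l' (k + m - 1) (j + m - 1) p (glue l k i m I J) K x = glue l k i m I J (x + 1 - p)"
      by (rule glue_after) (use 5 assms(1,2) in linarith)+
    also have "\<dots> = I (x + 1 - p + 1 - m)"
      by (rule glue_after) (use 5 assms(1,2) in linarith)+
    also have "x + 1 - p + 1 - m = x + 1 - m + 1 - p" using 5 assms(1,2) by linarith
    also have "I \<dots> = glue l' k j p I K (x + 1 - m)"
      by (rule glue_after[symmetric]) (use 5 assms(1,2) in linarith)+
    also have "\<dots> = glue l (k + p - 1) i m (glue l' k j p I K) J x"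
      by (rule glue_after[symmetric]) (use 5 assms(1,2) in linarith)+
    finally show ?thesis .
  qed (use assms(1,2) in \<open>auto simp add: glue_def\<close>)
qed

text \<open>Reflection numbers the intervals backwards, so the \<open>i\<close>-th becomes the
  \<open>(k - 1 - i)\<close>-th, and it turns rescaling into an interval into rescaling of the
  mirror image into the mirror interval.\<close>

lemma mirror_glue:
  assumes "i < k"
  shows "mirror (k + m - 1) (glue 0 k i m I J) = glue 0 k (k - 1 - i) m (mirror k I) (mirror m J)"
proof
  fix x
  consider "x < k - 1 - i" | "k - 1 - i \<le> x" "x < k - 1 - i + m" | "k - 1 - i + m \<le> x" "x < k + m - 1"
    | "x \<ge> k + m - 1"
    by linarith
  then show "mirror (k + m - 1) (glue 0 k i m I J) x = glue 0 k (k - 1 - i) m (mirror k I) (mirror m J) x"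
  proof cases
    case 1
    have "glue 0 k i m I J (k + m - 1 - 1 - x) = I (k + m - 1 - 1 - x + 1 - m)"
      by (rule glue_after) (use 1 assms in linarith)+
    also have "k + m - 1 - 1 - x + 1 - m = k - 1 - x" using 1 assms by linarith
    finally show ?thesis using 1 assms by (simp add: mirror_apply glue_before)
  next
    case 2
    have "glue 0 k i m I J (k + m - 1 - 1 - x) = rescale 0 (I i) (J (k + m - 1 - 1 - x - i))"
      by (rule glue_within) (use 2 assms in linarith)+
    also have "k + m - 1 - 1 - x - i = m - 1 - (x - (k - 1 - i))" using 2 assms by linarith
    finally have "mirror (k + m - 1) (glue 0 k i m I J) x
       = (1 - snd (rescale 0 (I i) (J (m - 1 - (x - (k - 1 - i))))),
          1 - fst (rescale 0 (I i) (J (m - 1 - (x - (k - 1 - i))))))"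
      using 2 assms by (simp add: mirror_apply)
    moreover have "x - (k - 1 - i) < m" "k - 1 - i < k" "k - 1 - (k - 1 - i) = i" using 2 assms by linarith+
    ultimately show ?thesis using 2 by (simp add: glue_within mirror_apply rescale_def algebra_simps)
  next
    case 3
    have "glue 0 k i m I J (k + m - 1 - 1 - x) = I (k + m - 1 - 1 - x)"
      by (rule glue_before) (use 3 assms in linarith)+
    also have "k + m - 1 - 1 - x = k - 1 - (x + 1 - m)" using 3 assms by linarith
    finally have "mirror (k + m - 1) (glue 0 k i m I J) x = mirror k I (x + 1 - m)"
      using 3 by (simp add: mirror_apply)
    also have "\<dots> = glue 0 k (k - 1 - i) m (mirror k I) (mirror m J) x"
      by (rule glue_after[symmetric]) (use 3 in linarith)+
    finally show ?thesis .
  qed (auto simp: mirror_def glue_def)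
qed

lemma glue_configs:
  assumes I: "I \<in> configs l k" and J: "J \<in> configs l' m" and "i < k" "l' < 1"
  shows "glue l' k i m I J \<in> configs l (k + m - 1)"
proof -
  define G where "G = glue l' k i m I J"
  have G1: "G j = I j" if "j < i" for j using that \<open>i < k\<close> by (auto simp: G_def glue_def)
  have G2: "G j = rescale l' (I i) (J (j - i))" if "i \<le> j" "j < i + m" for j
    using that \<open>i < k\<close> by (auto simp: G_def glue_def)
  have G3: "G j = I (j + 1 - m)" if "i + m \<le> j" "j < k + m - 1" for j
    using that \<open>i < k\<close> by (auto simp: G_def glue_def)
  have I1: "l \<le> fst (I j)" "fst (I j) < snd (I j)" "snd (I j) \<le> 1" if "j < k" for j
    using I that by (auto simp: configs_def)
  have I2: "snd (I a) \<le> fst (I b)" if "a < b" "b < k" for a b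
    using I that by (auto simp: configs_def)
  have J1: "l' \<le> fst (J j)" "fst (J j) < snd (J j)" "snd (J j) \<le> 1" if "j < m" for j
    using J that by (auto simp: configs_def)
  have J2: "snd (J a) \<le> fst (J b)" if "a < b" "b < m" for a b
    using J that by (auto simp: configs_def)
  \<comment> \<open>Everything rescaled into interval \<open>i\<close> stays inside it, so its
    position relative to the other intervals of \<open>I\<close> is that of interval
    \<open>i\<close>.\<close>
  have R: "fst (I i) \<le> fst (rescale l' (I i) X)" "snd (rescale l' (I i) X) \<le> snd (I i)"
    "fst (rescale l' (I i) X) < snd (rescale l' (I i) X)"
    if "l' \<le> fst X" "fst X < snd X" "snd X \<le> 1" for X
  proof -
    have d: "snd (I i) - fst (I i) > 0" using I1[OF \<open>i < k\<close>] by simp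
    have "(fst X - l') / (1 - l') \<ge> 0" "(snd X - l') / (1 - l') \<le> 1"
      "(fst X - l') / (1 - l') < (snd X - l') / (1 - l')"
      using that \<open>l' < 1\<close> by (auto simp: divide_simps)
    then have "(snd (I i) - fst (I i)) * ((fst X - l') / (1 - l')) \<ge> 0"
      "(snd (I i) - fst (I i)) * ((snd X - l') / (1 - l')) \<le> (snd (I i) - fst (I i)) * 1"
      "(snd (I i) - fst (I i)) * ((fst X - l') / (1 - l')) < (snd (I i) - fst (I i)) * ((snd X - l') / (1 - l'))"
      using d by (auto intro!: mult_nonneg_nonneg mult_left_mono mult_strict_left_mono simp del: times_divide_eq_right)
    then show "fst (I i) \<le> fst (rescale l' (I i) X)" "snd (rescale l' (I i) X) \<le> snd (I i)"
      "fst (rescale l' (I i) X) < snd (rescale l' (I i) X)"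
      by (auto simp: rescale_def)
  qed
  have RM: "snd (rescale l' (I i) X) \<le> fst (rescale l' (I i) Y)" if "snd X \<le> fst Y" for X Y
    using that I1[OF \<open>i < k\<close>] \<open>l' < 1\<close>
    by (auto simp: rescale_def intro!: mult_left_mono divide_right_mono)
  have A: "l \<le> fst (G j) \<and> fst (G j) < snd (G j) \<and> snd (G j) \<le> 1" if "j < k + m - 1" for j
  proof -
    consider "j < i" | "i \<le> j" "j < i + m" | "i + m \<le> j" by linarith
    then show ?thesis
    proof cases
      case 1 then show ?thesis using G1 I1 \<open>i < k\<close> by auto
    next
      case 2
      then have "j - i < m" by linarith
      from R[OF J1[OF this]] I1[OF \<open>i < k\<close>] show ?thesis by (simp add: G2[OF 2])
    next
      case 3
      then have "j + 1 - m < k" using that by linarith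
      then show ?thesis using I1 by (simp add: G3 3 that)
    qed
  qed
  have B: "snd (G a) \<le> fst (G b)" if "a < b" "b < k + m - 1" for a b
  proof -
    consider "b < i" | "a < i" "i \<le> b" "b < i + m" | "a < i" "i + m \<le> b" | "i \<le> a" "b < i + m"
      | "i \<le> a" "a < i + m" "i + m \<le> b" | "i + m \<le> a" by linarith
    then show ?thesis
    proof cases
      case 1 then show ?thesis using that I2[of a b] \<open>i < k\<close> by (simp add: G1)
    next
      case 2
      then have "b - i < m" by linarith
      from R(1)[OF J1[OF this]] I2[of a i] 2 \<open>i < k\<close> show ?thesis by (simp add: G1 G2)
    next
      case 3
      then show ?thesis using I2[of a "b + 1 - m"] that by (simp add: G1 G3)
    next
      case 4
      then show ?thesis using that by (simp add: G2 RM J2)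
    next
      case 5
      then have "a - i < m" by linarith
      from R(2)[OF J1[OF this]] I2[of i "b + 1 - m"] 5 that show ?thesis by (force simp: G2 G3)
    next
      case 6
      then show ?thesis using I2[of "a + 1 - m" "b + 1 - m"] that by (simp add: G3)
    qed
  qed
  have "G \<in> extensional {..<k + m - 1}" by (simp add: G_def glue_def)
  then show ?thesis using A B unfolding G_def[symmetric] configs_def PiE_def by auto
qed

lemma mirror_configs: "J \<in> configs 0 m \<Longrightarrow> mirror m J \<in> configs 0 m"
  by (auto simp: configs_def mirror_def)

text \<open>Stated through the value \<open>J 0\<close> alone, so that it serves for the identity
  and for its mirror image.\<close>

lemma glue_ident_right:
  assumes "I \<in> extensional {..<k}" "i < k" "l \<noteq> 1" "J 0 = (l, 1)"
  shows "glue l k i 1 I J = I"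
proof
  fix x show "glue l k i 1 I J x = I x"
  proof (cases "x = i")
    case True
    then show ?thesis using assms by (simp add: glue_def)
  next
    case False
    then show ?thesis using assms by (auto simp: glue_def extensional_def)
  qed
qed

lemma glue_ident_left:
  assumes "J \<in> extensional {..<m}" "l \<noteq> 1" "I 0 = (l, 1)"
  shows "glue l 1 0 m I J = J"
  using assms by (auto simp: glue_def extensional_def fun_eq_iff)

subsection \<open>Symmetric configurations\<close>

definition symmetric_config :: "nat \<Rightarrow> config \<Rightarrow> bool" where
  "symmetric_config k I \<longleftrightarrow> (\<forall>j<k. I (k - 1 - j) = (- snd (I j), - fst (I j)))"

text \<open>The condition \<open>2 * i + 1 < k\<close> puts \<open>i\<close> strictly before its
  conjugate \<open>k - 1 - i\<close>. The result has five blocks: reflection exchanges the first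
  with the last, the copy of \<open>J\<close> with its mirrored copy, and maps the middle block to
  itself.\<close>

lemma glue_symmetric_symmetric:
  assumes I: "symmetric_config k I" and i: "2 * i + 1 < k"
  shows "symmetric_config (k + 2 * m - 2) (glue_symmetric k i m I J)"
  unfolding symmetric_config_def
proof (intro allI impI)
  fix j assume j: "j < k + 2 * m - 2"
  define G where "G = glue_symmetric k i m I J"
  have i2: "i < k - 1 - i" using i by linarith
  have S: "I (k - 1 - j) = (- snd (I j), - fst (I j))" if "j < k" for j
    using I that by (auto simp: symmetric_config_def)
  have sz: "k + m - 1 + m - 1 = k + 2 * m - 2" using i by linarith
  have G1: "G j = I j" if "j < i" for j
    using that i by (auto simp: G_def glue_symmetric_def glue_def)
  have G2: "G j = rescale 0 (I i) (J (j - i))" if "i \<le> j" "j < i + m" for j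
    using that i by (auto simp: G_def glue_symmetric_def glue_def)
  have G3: "G j = I (j + 1 - m)" if "i + m \<le> j" "j < k - 1 - i + m - 1" for j
    using that i by (auto simp: G_def glue_symmetric_def glue_def)
  have G4: "G j = rescale 0 (I (k - 1 - i)) (mirror m J (j + 1 - m - (k - 1 - i)))"
    if "k - 1 - i + m - 1 \<le> j" "j < k - 1 - i + m - 1 + m" for j
    using that i by (auto simp: G_def glue_symmetric_def glue_def)
  have G5: "G j = I (j + 2 - 2 * m)" if "k - 1 - i + m - 1 + m \<le> j" "j < k + 2 * m - 2" for j
  proof -
    have "G j = glue 0 k (k - 1 - i) m I (mirror m J) (j + 1 - m)"
      unfolding G_def glue_symmetric_def by (rule glue_after) (use that i in linarith)+
    also have "\<dots> = I (j + 1 - m + 1 - m)"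
      by (rule glue_after) (use that i in linarith)+
    also have "j + 1 - m + 1 - m = j + 2 - 2 * m" using that i by linarith
    finally show ?thesis .
  qed
  let ?r = "k + 2 * m - 2 - 1 - j"
  \<comment> \<open>The mirrored copy inside the conjugate interval is the reflection in the origin
    of the copy inside interval \<open>i\<close>.\<close>
  have M: "rescale 0 (I (k - 1 - i)) (mirror m J a) =
     (- snd (rescale 0 (I i) (J (m - 1 - a))), - fst (rescale 0 (I i) (J (m - 1 - a))))" if "a < m" for a
    using S[of i] that i by (simp add: mirror_def rescale_def algebra_simps)
  consider "j < i" | "i \<le> j" "j < i + m" | "i + m \<le> j" "j < k - 1 - i + m - 1"
    | "k - 1 - i + m - 1 \<le> j" "j < k - 1 - i + m - 1 + m" | "k - 1 - i + m - 1 + m \<le> j" by linarith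
  then show "G ?r = (- snd (G j), - fst (G j))"
  proof cases
    case 1
    have "?r + 2 - 2 * m = k - 1 - j" using 1 i by linarith
    moreover have "G ?r = I (?r + 2 - 2 * m)" by (rule G5) (use 1 i in linarith)+
    ultimately show ?thesis using S[of j] 1 i by (simp add: G1)
  next
    case 2
    \<comment> \<open>Writing the indices as sums removes the truncated subtractions, after which
      simplification identifies the positions.\<close>
    obtain c d e where "k = 2 * i + 2 + c" "j = i + d" "m = d + 1 + e"
      using 2 i le_Suc_ex[of "2 * i + 2" k] le_Suc_ex[of i j] le_Suc_ex[of "j - i + 1" m] by auto
    then have "?r + 1 - m - (k - 1 - i) = m - 1 - (j - i)" by simp
    moreover have "G ?r = rescale 0 (I (k - 1 - i)) (mirror m J (?r + 1 - m - (k - 1 - i)))"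
      by (rule G4) (use 2 i in linarith)+
    moreover have "m - 1 - (m - 1 - (j - i)) = j - i" "m - 1 - (j - i) < m" using 2 by linarith+
    ultimately show ?thesis using M[of "m - 1 - (j - i)"] 2 i by (simp add: G2)
  next
    case 3
    obtain c where c: "k = 2 * i + 2 + c"
      using i le_Suc_ex[of "2 * i + 2" k] by auto
    obtain b where b: "j = i + m + b"
      using 3 le_Suc_ex[of "i + m" j] by auto
    obtain e where e: "c = b + 1 + e"
      using 3 b c le_Suc_ex[of "b + 1" c] by auto
    have "?r + 1 - m = k - 1 - (j + 1 - m)" by (simp add: b c e)
    moreover have "G ?r = I (?r + 1 - m)" by (rule G3) (simp_all add: b c e)
    moreover have "j + 1 - m < k" using 3 by linarith
    ultimately show ?thesis using S[of "j + 1 - m"] 3 i by (simp add: G3)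
  next
    case 4
    define a where "a = j + 1 - m - (k - 1 - i)"
    obtain c where c: "k = 2 * i + 2 + c"
      using i le_Suc_ex[of "2 * i + 2" k] by auto
    obtain b where b: "j = i + c + m + b"
      using 4 c le_Suc_ex[of "i + c + m" j] by auto
    have "a = b" by (simp add: a_def b c)
    moreover have "b < m" using 4 b c by simp
    ultimately have a: "a < m" "?r - i = m - 1 - a" by (simp_all add: b c)
    moreover have "G ?r = rescale 0 (I i) (J (?r - i))" by (rule G2) (use 4 i in linarith)+
    moreover have "G j = rescale 0 (I (k - 1 - i)) (mirror m J a)" unfolding a_def by (rule G4) (use 4 in linarith)+
    ultimately show ?thesis using M[of a] by simp
  next
    case 5
    obtain c where c: "k = 2 * i + 2 + c"
      using i le_Suc_ex[of "2 * i + 2" k] by auto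
    obtain b where b: "j = i + c + 2 * m + b"
      using 5 c le_Suc_ex[of "i + c + 2 * m" j] by auto
    have "b < i" using j b c by simp
    then have "?r < i" by (simp add: b c)
    then have "G ?r = I ?r" by (rule G1)
    moreover have jk: "j + 2 - 2 * m < k" "?r = k - 1 - (j + 2 - 2 * m)" using \<open>b < i\<close> by (simp_all add: b c)
    ultimately have "G ?r = I (k - 1 - (j + 2 - 2 * m))" by (simp only:)
    with jk(1)
    show ?thesis using S[of "j + 2 - 2 * m"] 5 j by (simp only: G5)
  qed
qed

text \<open>The middle interval is its own conjugate, hence of the form (-c, c). Rescaling [-1, 1]
  into it is multiplication by c, which commutes with the reflection.\<close>

lemma glue_centre_symmetric:
  assumes I: "symmetric_config (2 * n + 1) I" and J: "symmetric_config m J"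
  shows "symmetric_config (2 * n + m) (glue (-1) (2 * n + 1) n m I J)"
  unfolding symmetric_config_def
proof (intro allI impI)
  fix j assume j: "j < 2 * n + m"
  define G where "G = glue (-1) (2 * n + 1) n m I J"
  have S: "I (2 * n - j) = (- snd (I j), - fst (I j))" if "j < 2 * n + 1" for j
    using I that by (auto simp: symmetric_config_def)
  have T: "J (m - 1 - j) = (- snd (J j), - fst (J j))" if "j < m" for j
    using J that by (auto simp: symmetric_config_def)
  have G1: "G j = I j" if "j < n" for j using that by (auto simp: G_def glue_def)
  have G2: "G j = rescale (-1) (I n) (J (j - n))" if "n \<le> j" "j < n + m" for j
    using that by (auto simp: G_def glue_def)
  have G3: "G j = I (j + 1 - m)" if "n + m \<le> j" "j < 2 * n + m" for j
    using that by (auto simp: G_def glue_def)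
  let ?r = "2 * n + m - 1 - j"
  consider "j < n" | "n \<le> j" "j < n + m" | "n + m \<le> j" by linarith
  then show "G ?r = (- snd (G j), - fst (G j))"
  proof cases
    case 1
    have "G ?r = I (?r + 1 - m)" by (rule G3) (use 1 in linarith)+
    moreover have "?r + 1 - m = 2 * n - j" using 1 by linarith
    ultimately show ?thesis using S[of j] 1 by (simp add: G1)
  next
    case 2
    have "G ?r = rescale (-1) (I n) (J (?r - n))" by (rule G2) (use 2 in linarith)+
    moreover obtain d e where "j = n + d" "m = d + 1 + e"
      using 2 le_Suc_ex[of n j] le_Suc_ex[of "j - n + 1" m] by auto
    then have "?r - n = m - 1 - (j - n)" "j - n < m" by simp_all
    moreover have "fst (I n) = - snd (I n)"
    proof -
      have "I (2 * n - n) = (- snd (I n), - fst (I n))" by (rule S) simp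
      moreover have "2 * n - n = n" by simp
      ultimately show ?thesis by (metis fst_conv)
    qed
    ultimately show ?thesis using T[of "j - n"] 2 by (simp add: G2 rescale_def field_simps)
  next
    case 3
    have "G ?r = I ?r" by (rule G1) (use 3 j in linarith)+
    moreover have "?r = 2 * n - (j + 1 - m)" "j + 1 - m < 2 * n + 1" using 3 j by linarith+
    ultimately show ?thesis using S[of "j + 1 - m"] 3 j by (simp add: G3)
  qed
qed

text \<open>A symmetric gluing is a pair of ordinary ones. The mirrored \<open>K\<close> is moved
  past \<open>J\<close> by \<open>glue_parallel\<close> and nested into the mirrored
  \<open>J\<close>; by \<open>mirror_glue\<close> this is the mirror image of the inner composite.
  Then \<open>K\<close> is nested into \<open>J\<close>.\<close>

lemma glue_symmetric_nested:
  assumes "2 * i + 1 < k" "j < m"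
  shows "glue_symmetric (k + 2 * m - 2) (i + j) p (glue_symmetric k i m I J) K
       = glue_symmetric k i (m + p - 1) I (glue 0 m j p J K)"
proof -
  obtain b c d where k: "k = 2 * i + 2 + c" and m: "m = j + 1 + d"
    using assms le_Suc_ex[of "2 * i + 2" k] le_Suc_ex[of "j + 1" m] by auto
  define J' K' where "J' = mirror m J" and "K' = mirror p K"
  define Q where "Q = glue 0 k (k - 1 - i) (m + p - 1) I (glue 0 m (m - 1 - j) p J' K')"
  have Q: "Q = glue 0 k (k - 1 - i) (m + p - 1) I (mirror (m + p - 1) (glue 0 m j p J K))"
    unfolding Q_def J'_def K'_def using assms mirror_glue[of j m p J K] by simp
  have "glue 0 (k + 2 * m - 2) (k + 2 * m - 2 - 1 - (i + j)) p
         (glue 0 (k + m - 1) i m (glue 0 k (k - 1 - i) m I J') J) K'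
     = glue 0 (k + m + p - 2) i m (glue 0 (k + m - 1) (k - 1 - i + (m - 1 - j)) p (glue 0 k (k - 1 - i) m I J') K') J"
    by (rule glue_parallel) (simp_all add: k m)
  also have "glue 0 (k + m - 1) (k - 1 - i + (m - 1 - j)) p (glue 0 k (k - 1 - i) m I J') K' = Q"
    unfolding Q_def by (rule glue_nested) (simp_all add: k m)
  finally have "glue_symmetric (k + 2 * m - 2) (i + j) p (glue_symmetric k i m I J) K
      = glue 0 (k + 2 * m - 2 + p - 1) (i + j) p (glue 0 (k + m + p - 2) i m Q J) K"
    by (simp only: glue_symmetric_def J'_def K'_def)
  also have "\<dots> = glue 0 (k + m + p - 2) i (m + p - 1) Q (glue 0 m j p J K)"
    by (rule glue_nested) (simp_all add: k m)
  also have "k + m + p - 2 = k + (m + p - 1) - 1" by (simp add: k m)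
  finally show ?thesis by (simp only: glue_symmetric_def Q)
qed

text \<open>The four gluings take place at the distinct positions \<open>i\<close>,
  \<open>j\<close>, \<open>k - 1 - j\<close>, \<open>k - 1 - i\<close>. Four applications of
  \<open>glue_parallel\<close> move the pair for \<open>J\<close> past the pair for
  \<open>K\<close>.\<close>

lemma glue_symmetric_parallel:
  assumes "i < j" "2 * j + 1 < k"
  shows "glue_symmetric (k + 2 * m - 2) (j + m - 1) p (glue_symmetric k i m I J) K
       = glue_symmetric (k + 2 * p - 2) i m (glue_symmetric k j p I K) J"
proof -
  obtain c d where k: "k = 2 * j + 2 + c" and j: "j = i + 1 + d"
    using assms le_Suc_ex[of "2 * j + 2" k] le_Suc_ex[of "i + 1" j] by auto
  define J' K' where "J' = mirror m J" and "K' = mirror p K"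
  define I1 where "I1 = glue 0 k (k - 1 - i) m I J'"
  define I2 where "I2 = glue 0 k (k - 1 - j) p I K'"
  define Y where "Y = glue 0 (k + p - 1) (k - 1 - i + p - 1) m I2 J'"
  define Z where "Z = glue 0 (k + p - 1) j p I2 K"
  have "glue 0 (k + 2 * m - 2) (k + 2 * m - 2 - 1 - (j + m - 1)) p (glue 0 (k + m - 1) i m I1 J) K'
      = glue 0 (k + m + p - 2) i m (glue 0 (k + m - 1) (k - 1 - j) p I1 K') J"
    by (rule glue_parallel) (simp_all add: k j)
  also have "glue 0 (k + m - 1) (k - 1 - j) p I1 K' = Y"
    unfolding I1_def Y_def I2_def by (rule glue_parallel[symmetric]) (simp_all add: k j)
  finally have "glue_symmetric (k + 2 * m - 2) (j + m - 1) p (glue_symmetric k i m I J) K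
      = glue 0 (k + 2 * m - 2 + p - 1) (j + m - 1) p (glue 0 (k + m + p - 2) i m Y J) K"
    by (simp only: glue_symmetric_def J'_def K'_def I1_def)
  also have "\<dots> = glue 0 (k + 2 * p - 2 + m - 1) i m (glue 0 (k + m + p - 2) j p Y K) J"
    by (rule glue_parallel) (simp_all add: k j)
  also have "glue 0 (k + m + p - 2) j p Y K = glue 0 (k + 2 * p - 2) (k + 2 * p - 2 - 1 - i) m Z J'"
    unfolding Y_def Z_def by (rule glue_parallel[symmetric]) (simp_all add: k j)
  finally show ?thesis by (simp only: glue_symmetric_def Z_def I2_def J'_def K'_def)
qed

text \<open>The centre \<open>n\<close> lies between \<open>i\<close> and its conjugate
  \<open>2 * n - i\<close>, so the gluing there passes each half of the symmetric gluing by
  \<open>glue_parallel\<close>.\<close>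

lemma glue_centre_parallel:
  assumes "i < n"
  shows "glue l (2 * n + 1 + 2 * m - 2) (n + m - 1) s (glue_symmetric (2 * n + 1) i m I J) K
       = glue_symmetric (2 * n + s) i m (glue l (2 * n + 1) n s I K) J"
proof -
  obtain d where n: "n = i + 1 + d" using assms le_Suc_ex[of "i + 1" n] by auto
  define J' I1 where "J' = mirror m J" and "I1 = glue 0 (2 * n + 1) (2 * n + 1 - 1 - i) m I J'"
  have "glue l (2 * n + 1 + 2 * m - 2) (n + m - 1) s (glue 0 (2 * n + 1 + m - 1) i m I1 J) K
      = glue 0 (2 * n + s + m - 1) i m (glue l (2 * n + 1 + m - 1) n s I1 K) J"
    by (rule glue_parallel) (simp_all add: n)
  also have "glue l (2 * n + 1 + m - 1) n s I1 K
      = glue 0 (2 * n + s) (2 * n + s - 1 - i) m (glue l (2 * n + 1) n s I K) J'"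
    unfolding I1_def by (rule glue_parallel[symmetric]) (simp_all add: n)
  finally show ?thesis by (simp only: glue_symmetric_def I1_def J'_def)
qed

lemma glue_centre_nested:
  assumes "2 * j + 1 < s"
  shows "glue_symmetric (2 * n + s) (n + j) p (glue l (2 * n + 1) n s I J) K
       = glue l (2 * n + 1) n (s + 2 * p - 2) I (glue_symmetric s j p J K)"
proof -
  obtain d where s: "s = 2 * j + 2 + d" using assms le_Suc_ex[of "2 * j + 2" s] by auto
  have "glue 0 (2 * n + s) (2 * n + s - 1 - (n + j)) p (glue l (2 * n + 1) n s I J) (mirror p K)
      = glue l (2 * n + 1) n (s + p - 1) I (glue 0 s (s - 1 - j) p J (mirror p K))"
    by (rule glue_nested) (simp_all add: s)
  moreover have "glue 0 (2 * n + s + p - 1) (n + j) p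
       (glue l (2 * n + 1) n (s + p - 1) I (glue 0 s (s - 1 - j) p J (mirror p K))) K
      = glue l (2 * n + 1) n (s + 2 * p - 2) I
         (glue 0 (s + p - 1) j p (glue 0 s (s - 1 - j) p J (mirror p K)) K)"
    by (rule glue_nested) (simp_all add: s)
  ultimately show ?thesis by (simp only: glue_symmetric_def)
qed

section \<open>Continuity of gluing\<close>

lemma continuous_map_rescale:
  assumes "continuous_map X euclidean f" "continuous_map X euclidean g"
  shows "continuous_map X euclidean (\<lambda>x. rescale l (f x) (g x))"
proof -
  have "continuous_on UNIV (\<lambda>(I, J). rescale l I J)"
    by (auto simp: rescale_def case_prod_unfold divide_inverse intro!: continuous_intros)
  then have "continuous_map euclidean euclidean (\<lambda>(I, J). rescale l I J)"
    by simp
  moreover have "continuous_map X euclidean (\<lambda>x. (f x, g x))"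
    using continuous_map_pairedI[OF assms] by simp
  ultimately show ?thesis
    using continuous_map_compose[of X euclidean "\<lambda>x. (f x, g x)" euclidean "\<lambda>(I, J). rescale l I J"]
    by (simp add: o_def)
qed

abbreviation interval_families :: "nat \<Rightarrow> config topology" where
  "interval_families k \<equiv> product_topology (\<lambda>_. euclidean) {..<k}"

lemma continuous_map_component:
  assumes "continuous_map X (interval_families k) f" "j < k"
  shows "continuous_map X euclidean (\<lambda>x. f x j)"
  using assms unfolding continuous_map_componentwise by auto

lemma continuous_map_glue:
  assumes "continuous_map X (interval_families k) f" "continuous_map X (interval_families m) g" "i < k"
  shows "continuous_map X (interval_families (k + m - 1)) (\<lambda>x. glue l k i m (f x) (g x))"
  unfolding continuous_map_componentwise
proof (intro conjI ballI)
  fix j assume "j \<in> {..<k + m - 1}"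
  then have j: "j < k + m - 1" by simp
  consider "j < i" | "i \<le> j" "j < i + m" | "i + m \<le> j" by linarith
  then show "continuous_map X euclidean (\<lambda>x. glue l k i m (f x) (g x) j)"
  proof cases
    case 1
    then show ?thesis using assms by (simp add: glue_before continuous_map_component[OF assms(1)])
  next
    case 2
    then have "j - i < m" by linarith
    from continuous_map_rescale[OF continuous_map_component[OF assms(1,3)] continuous_map_component[OF assms(2) this]]
    show ?thesis using 2 assms by (simp add: glue_within)
  next
    case 3
    then have "j + 1 - m < k" using j by linarith
    with 3 j show ?thesis using continuous_map_component[OF assms(1)] by (simp add: glue_after)
  qed
qed (auto simp: glue_def)

lemma continuous_map_mirror:
  assumes "continuous_map X (interval_families m) g"
  shows "continuous_map X (interval_families m) (\<lambda>x. mirror m (g x))"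
  unfolding continuous_map_componentwise
proof (intro conjI ballI)
  fix j assume "j \<in> {..<m}"
  then have j: "j < m" and j': "m - 1 - j < m" by auto
  have "continuous_on UNIV (\<lambda>I :: real \<times> real. (1 - snd I, 1 - fst I))"
    by (intro continuous_intros)
  then have "continuous_map euclidean euclidean (\<lambda>I :: real \<times> real. (1 - snd I, 1 - fst I))"
    by simp
  from continuous_map_compose[OF continuous_map_component[OF assms j'] this]
  show "continuous_map X euclidean (\<lambda>x. mirror m (g x) j)"
    using j by (simp add: mirror_apply o_def)
qed (auto simp: mirror_def)

lemma continuous_map_glue_symmetric:
  assumes "continuous_map X (interval_families k) f" "continuous_map X (interval_families m) g" "2 * i + 1 < k"
  shows "continuous_map X (interval_families (k + 2 * m - 2)) (\<lambda>x. glue_symmetric k i m (f x) (g x))"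
proof -
  have "k + 2 * m - 2 = k + m - 1 + m - 1" using assms by linarith
  moreover have "continuous_map X (interval_families (k + m - 1)) (\<lambda>x. glue 0 k (k - 1 - i) m (f x) (mirror m (g x)))"
    by (rule continuous_map_glue[OF assms(1) continuous_map_mirror[OF assms(2)]]) (use assms in linarith)
  from continuous_map_glue[OF this assms(2)]
  have "continuous_map X (interval_families (k + m - 1 + m - 1))
      (\<lambda>x. glue 0 (k + m - 1) i m (glue 0 k (k - 1 - i) m (f x) (mirror m (g x))) (g x))"
    using assms by simp
  ultimately show ?thesis by (simp only: glue_symmetric_def)
qed

lemma glue_symmetric_configs:
  assumes "I \<in> configs l k" "J \<in> configs 0 m" "2 * i + 1 < k"
  shows "glue_symmetric k i m I J \<in> configs l (k + 2 * m - 2)"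
proof -
  have "k + 2 * m - 2 = k + m - 1 + m - 1" using assms by linarith
  moreover have "glue 0 k (k - 1 - i) m I (mirror m J) \<in> configs l (k + m - 1)"
    by (rule glue_configs[OF assms(1) mirror_configs[OF assms(2)]]) (use assms in linarith, simp)
  from glue_configs[OF this assms(2), of i]
  have "glue 0 (k + m - 1) i m (glue 0 k (k - 1 - i) m I (mirror m J)) J \<in> configs l (k + m - 1 + m - 1)"
    using assms by simp
  ultimately show ?thesis by (simp only: glue_symmetric_def)
qed

section \<open>The operad axioms for \<open>SC1\<close>\<close>

lemma count_list_replicate: "count_list (replicate n x) y = (if x = y then n else 0)"
  by (induction n) auto

lemma profile_simps [simp]:
  "length (profile n i) = n + i" "count_list (profile n i) Closed = n" "count_list (profile n i) Open = i"
  "open_size (profile n i) = 2 * n + i"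
  by (simp_all add: profile_def open_size_def count_list_replicate)

lemma profile_inject [simp]: "profile n i = profile m j \<longleftrightarrow> n = m \<and> i = j"
  by (metis profile_simps(2,3))

lemma profile_nth: "j < n + i \<Longrightarrow> profile n i ! j = (if j < n then Closed else Open)"
  by (simp add: profile_def nth_append)

lemma plug_profile_Closed:
  assumes "i < n"
  shows "plug (profile n c) i (profile m 0) = profile (n + m - 1) c"
proof -
  obtain d where "n = i + 1 + d" using assms le_Suc_ex[of "i + 1" n] by auto
  moreover from this have "min i n = i" "n - Suc i = d" by simp_all
  then have "take i (profile n c) = replicate i Closed"
    "drop (Suc i) (profile n c) = replicate d Closed @ replicate c Open"
    using assms by (simp_all add: profile_def)
  moreover have "replicate i Closed @ replicate m Closed @ replicate d Closed = replicate (i + m + d) Closed"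
    by (simp add: replicate_add)
  ultimately show ?thesis by (simp add: plug_def profile_def algebra_simps)
qed

lemma plug_profile_Open: "plug (profile n 1) n (profile m c) = profile (n + m) c"
  by (simp add: plug_def profile_def replicate_add)

lemma ops_SC1:
  "ops SC1 (profile n 0) Closed = closed_configs n"
  "c \<le> 1 \<Longrightarrow> ops SC1 (profile n c) Open = open_configs n c"
  by (simp_all add: SC1_def)

lemma topspace_closed_configs: "f \<in> topspace (closed_configs n) \<longleftrightarrow> f \<in> configs 0 n"
  by (auto simp: closed_configs_def configs_def)

lemma topspace_open_configs:
  "f \<in> topspace (open_configs n c) \<longleftrightarrow> f \<in> configs (-1) (2 * n + c) \<and> symmetric_config (2 * n + c) f"
  by (auto simp: open_configs_def configs_def symmetric_config_def)

lemma SC1_profile: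
  assumes "topspace (ops SC1 cs x) \<noteq> {}"
  obtains n where "x = Closed" "cs = profile n 0" | n c where "x = Open" "c \<le> 1" "cs = profile n c"
  using assms by (auto simp: SC1_def Let_def split: if_splits)

lemma continuous_map_closed_configs:
  "continuous_map X (closed_configs n) f \<longleftrightarrow>
     continuous_map X (interval_families n) f \<and> (\<forall>x \<in> topspace X. f x \<in> configs 0 n)"
  by (auto simp: closed_configs_def continuous_map_in_subtopology)

lemma continuous_map_open_configs:
  "continuous_map X (open_configs n c) f \<longleftrightarrow>
     continuous_map X (interval_families (2 * n + c)) f \<and>
     (\<forall>x \<in> topspace X. f x \<in> configs (-1) (2 * n + c) \<and> symmetric_config (2 * n + c) (f x))"
  by (auto simp: open_configs_def continuous_map_in_subtopology symmetric_config_def)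

lemma continuous_map_fst_closed: "continuous_map (prod_topology (closed_configs n) Y) (interval_families n) fst"
  and continuous_map_snd_closed: "continuous_map (prod_topology Y (closed_configs n)) (interval_families n) snd"
  and continuous_map_fst_open: "continuous_map (prod_topology (open_configs n c) Y) (interval_families (2 * n + c)) fst"
  and continuous_map_snd_open: "continuous_map (prod_topology Y (open_configs n c)) (interval_families (2 * n + c)) snd"
  unfolding closed_configs_def open_configs_def
  using continuous_map_fst continuous_map_snd continuous_map_in_subtopology by blast+

lemma pcomp_SC1_Closed: "pcomp SC1 cs Closed i ds I J = glue 0 (length cs) i (length ds) I J"
  and pcomp_SC1_Open_Closed: "cs ! i = Closed \<Longrightarrow>
    pcomp SC1 cs Open i ds I J = glue_symmetric (open_size cs) i (length ds) I J"
  and pcomp_SC1_Open_Open: "cs ! i = Open \<Longrightarrow>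
    pcomp SC1 cs Open i ds I J = glue (-1) (open_size cs) i (open_size ds) I J"
  by (simp_all add: SC1_def)

lemmas pcomp_SC1 = pcomp_SC1_Closed pcomp_SC1_Open_Closed pcomp_SC1_Open_Open

text \<open>The case split behind every axiom for \<open>SC1\<close>. An operation with closed
  output has closed inputs only, and one with open output has at most one open input, the last;
  hence \<open>i = n\<close> in the third case.\<close>

lemma SC1_composable:
  assumes "f \<in> topspace (ops SC1 cs x)" "g \<in> topspace (ops SC1 ds (cs ! i))" "i < length cs"
  obtains
    (closed) n m where "x = Closed" "cs ! i = Closed" "cs = profile n 0" "ds = profile m 0" "i < n"
      "plug cs i ds = profile (n + m - 1) 0"
  | (mixed) n c m where "x = Open" "cs ! i = Closed" "c \<le> 1" "cs = profile n c" "ds = profile m 0" "i < n"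
      "plug cs i ds = profile (n + m - 1) c"
  | ("open") n m c where "x = Open" "cs ! i = Open" "c \<le> 1" "cs = profile n 1" "ds = profile m c" "i = n"
      "plug cs i ds = profile (n + m) c"
proof -
  from assms have "topspace (ops SC1 cs x) \<noteq> {}" "topspace (ops SC1 ds (cs ! i)) \<noteq> {}" by auto
  then show thesis
  proof (elim SC1_profile)
    fix n m assume *: "x = Closed" "cs = profile n 0" "cs ! i = Closed" "ds = profile m 0"
    with assms show thesis by (intro closed) (auto simp: plug_profile_Closed)
  next
    fix n m c assume *: "x = Open" "c \<le> 1" "cs = profile n c" "cs ! i = Closed" "ds = profile m 0"
    with assms have "i < n" by (auto simp: profile_nth split: if_splits)
    with * assms show thesis by (intro mixed) (auto simp: plug_profile_Closed)
  next
    fix n m c c' assume *: "x = Open" "c \<le> 1" "cs = profile n c" "cs ! i = Open" "c' \<le> 1" "ds = profile m c'"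
    with assms have "\<not> i < n" by (auto simp: profile_nth split: if_splits)
    with * assms have "i = n" "c = 1" by auto
    with * assms show thesis by (intro "open") (auto simp: plug_profile_Open simp flip: One_nat_def)
  qed (use assms in \<open>auto simp: profile_nth split: if_splits\<close>)
qed

lemma continuous_map_pcomp_SC1:
  assumes "i < length cs"
  shows "continuous_map (prod_topology (ops SC1 cs x) (ops SC1 ds (cs ! i))) (ops SC1 (plug cs i ds) x)
          (\<lambda>(f, g). pcomp SC1 cs x i ds f g)"
proof (cases "topspace (prod_topology (ops SC1 cs x) (ops SC1 ds (cs ! i))) = {}")
  case True
  then show ?thesis by (auto simp: continuous_map_def simp del: null_topspace_iff_trivial)
next
  case False
  \<comment> \<open>\<open>SC1_composable\<close> reads the profiles off from operations, so a point
    of the domain is needed; on an empty domain continuity is vacuous.\<close>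
  then obtain f g where "f \<in> topspace (ops SC1 cs x)" "g \<in> topspace (ops SC1 ds (cs ! i))"
    by (force simp del: null_topspace_iff_trivial)
  from this assms show ?thesis
  proof (cases rule: SC1_composable)
    case (closed n m)
    show ?thesis unfolding closed
      using closed
      by (auto simp: ops_SC1 continuous_map_closed_configs pcomp_SC1 case_prod_unfold topspace_closed_configs
          intro!: continuous_map_glue[unfolded One_nat_def] continuous_map_fst_closed continuous_map_snd_closed
            glue_configs[unfolded One_nat_def])
  next
    case (mixed n c m)
    have i: "2 * i + 1 < 2 * n + c" "2 * (n + m - 1) + c = 2 * n + c + 2 * m - 2"
      using mixed by linarith+
    have "cs ! i = Closed" by fact
    then have *: "profile n c ! i = Closed" using mixed by simp
    show ?thesis unfolding mixed
      using mixed i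
      by (auto simp: ops_SC1 continuous_map_open_configs pcomp_SC1 * case_prod_unfold topspace_closed_configs topspace_open_configs
          intro!: continuous_map_glue_symmetric continuous_map_fst_open continuous_map_snd_closed
            glue_symmetric_configs glue_symmetric_symmetric)
  next
    case ("open" n m c)
    have i: "2 * (n + m) + c = 2 * n + 1 + (2 * m + c) - 1" by simp
    have *: "profile n 1 ! n = Open" by (simp add: profile_nth)
    have sym: "symmetric_config (2 * n + 1 + (2 * m + c) - 1) (glue (- 1) (2 * n + 1) n (2 * m + c) I J)"
      if "symmetric_config (2 * n + 1) I" "symmetric_config (2 * m + c) J" for I J
      using glue_centre_symmetric[OF that] by simp
    have "continuous_map (prod_topology (open_configs n 1) (open_configs m c)) (open_configs (n + m) c)
        (\<lambda>p. glue (- 1) (2 * n + 1) n (2 * m + c) (fst p) (snd p))"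
      unfolding continuous_map_open_configs i
    proof (intro conjI ballI)
      show "continuous_map (prod_topology (open_configs n 1) (open_configs m c))
          (interval_families (2 * n + 1 + (2 * m + c) - 1))
          (\<lambda>p. glue (- 1) (2 * n + 1) n (2 * m + c) (fst p) (snd p))"
        by (rule continuous_map_glue[OF continuous_map_fst_open continuous_map_snd_open]) simp
    next
      fix p assume "p \<in> topspace (prod_topology (open_configs n 1) (open_configs m c))"
      then have p: "fst p \<in> configs (-1) (2 * n + 1)" "symmetric_config (2 * n + 1) (fst p)"
        "snd p \<in> configs (-1) (2 * m + c)" "symmetric_config (2 * m + c) (snd p)"
        by (auto simp: topspace_open_configs mem_Times_iff simp del: One_nat_def)
      show "glue (- 1) (2 * n + 1) n (2 * m + c) (fst p) (snd p) \<in> configs (- 1) (2 * n + 1 + (2 * m + c) - 1)"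
        by (rule glue_configs[OF p(1,3)]) auto
      show "symmetric_config (2 * n + 1 + (2 * m + c) - 1) (glue (- 1) (2 * n + 1) n (2 * m + c) (fst p) (snd p))"
        by (rule sym[OF p(2,4)])
    qed
    with "open" * show ?thesis by (simp add: ops_SC1 pcomp_SC1 case_prod_unfold)
  qed
qed

lemma SC1_extensional: "f \<in> topspace (ops SC1 (profile n 0) Closed) \<Longrightarrow> f \<in> extensional {..<n}"
  "c \<le> 1 \<Longrightarrow> f \<in> topspace (ops SC1 (profile n c) Open) \<Longrightarrow> f \<in> extensional {..<2 * n + c}"
  by (auto simp: ops_SC1 topspace_closed_configs topspace_open_configs configs_def PiE_def)

lemma ident_SC1: "ident SC1 Closed 0 = (0, 1)" "ident SC1 Open 0 = (-1, 1)"
  by (simp_all add: SC1_def)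

lemma singleton_profile: "[Closed] = profile 1 0" "[Open] = profile 0 1"
  by (simp_all add: profile_def)

lemma ident_SC1_in_topspace: "ident SC1 c \<in> topspace (ops SC1 [c] c)"
proof (cases c)
  case Closed
  have "ident SC1 Closed \<in> configs 0 1" by (auto simp: SC1_def configs_def)
  then show ?thesis unfolding Closed singleton_profile ops_SC1 topspace_closed_configs .
next
  case Open
  have "ident SC1 Open \<in> configs (-1) (2 * 0 + 1)" "symmetric_config (2 * 0 + 1) (ident SC1 Open)"
    by (auto simp: SC1_def configs_def symmetric_config_def)
  then show ?thesis unfolding Open singleton_profile ops_SC1(2)[OF order_refl] topspace_open_configs by simp
qed

lemma SC1_ident_left:
  assumes "f \<in> topspace (ops SC1 cs x)"
  shows "pcomp SC1 [x] x 0 cs (ident SC1 x) f = f"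
proof -
  from assms have "topspace (ops SC1 cs x) \<noteq> {}" by auto
  then show ?thesis
  proof (cases rule: SC1_profile)
    case (1 n)
    then show ?thesis using assms by (auto simp: pcomp_SC1 ident_SC1 intro!: glue_ident_left[unfolded One_nat_def] SC1_extensional)
  next
    case (2 n c)
    have "open_size [Open] = 1" by (simp add: open_size_def)
    moreover have "f \<in> extensional {..<2 * n + c}" using SC1_extensional(2) assms 2 by blast
    ultimately show ?thesis using 2 by (simp add: pcomp_SC1 ident_SC1 glue_ident_left[unfolded One_nat_def])
  qed
qed

lemma SC1_ident_right:
  assumes "f \<in> topspace (ops SC1 cs x)" "i < length cs"
  shows "pcomp SC1 cs x i [cs ! i] f (ident SC1 (cs ! i)) = f"
proof -
  from assms have "topspace (ops SC1 cs x) \<noteq> {}" by auto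
  then show ?thesis
  proof (cases rule: SC1_profile)
    case (1 n)
    then have "cs ! i = Closed" using assms by (simp add: profile_nth)
    then show ?thesis using assms 1 SC1_extensional(1)[of f n]
      by (simp add: pcomp_SC1 ident_SC1 glue_ident_right[unfolded One_nat_def])
  next
    case (2 n c)
    show ?thesis
    proof (cases "cs ! i")
      case Closed
      then have i: "i < n" using assms 2 by (auto simp: profile_nth split: if_splits)
      have ext: "f \<in> extensional {..<2 * n + c}" using SC1_extensional(2) assms 2 by blast
      have m: "mirror 1 (ident SC1 Closed) 0 = (0, 1)" by (simp add: mirror_def ident_SC1)
      have "glue 0 (2 * n + c) (2 * n + c - 1 - i) 1 f (mirror 1 (ident SC1 Closed)) = f"
        by (rule glue_ident_right) (use i ext m in auto)
      moreover have "glue 0 (2 * n + c) i 1 f (ident SC1 Closed) = f"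
        by (rule glue_ident_right) (use i ext in \<open>auto simp: ident_SC1\<close>)
      ultimately show ?thesis using Closed 2 by (simp add: pcomp_SC1 glue_symmetric_def)
    next
      case Open
      then have i: "i = n" "c = 1" using assms 2 by (auto simp: profile_nth split: if_splits)
      have ext: "f \<in> extensional {..<2 * n + c}" using SC1_extensional(2) assms 2 by blast
      have "open_size [Open] = 1" by (simp add: open_size_def)
      moreover have "glue (-1) (2 * n + c) i 1 f (ident SC1 Open) = f"
        by (rule glue_ident_right) (use i ext in \<open>auto simp: ident_SC1\<close>)
      ultimately show ?thesis using Open 2 by (simp add: pcomp_SC1)
    qed
  qed
qed

lemma SC1_assoc_nested:
  assumes f: "f \<in> topspace (ops SC1 cs x)" and g: "g \<in> topspace (ops SC1 ds (cs ! i))"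
    and h: "h \<in> topspace (ops SC1 es (ds ! j))" and i: "i < length cs" and j: "j < length ds"
  shows "pcomp SC1 (plug cs i ds) x (i + j) es (pcomp SC1 cs x i ds f g) h
       = pcomp SC1 cs x i (plug ds j es) f (pcomp SC1 ds (cs ! i) j es g h)"
  using f g i
proof (cases rule: SC1_composable)
  case (closed n m)
  with g h j show ?thesis
    by (cases rule: SC1_composable[OF g h j]) (auto simp: pcomp_SC1 glue_nested)
next
  case (mixed n c m)
  note m = this
  from g h j show ?thesis
  proof (cases rule: SC1_composable)
    case (closed m' p)
    \<comment> \<open>Both case splits describe the same list \<open>ds\<close>, and a profile
      determines its numbers of inputs.\<close>
    then have "m' = m" using m by (metis profile_simps(2))
    have *: "plug cs i ds ! (i + j) = Closed" unfolding m(7) using m closed \<open>m' = m\<close> by (subst profile_nth) auto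
    have sz: "2 * (n + m - 1) + c = 2 * n + c + 2 * m - 2" "2 * i + 1 < 2 * n + c" using m by linarith+
    show ?thesis
      unfolding m(1) pcomp_SC1_Open_Closed[of "plug cs i ds", OF *] pcomp_SC1_Open_Closed[of cs, OF m(2)] m(2) pcomp_SC1_Closed
      unfolding closed(6) m(7) using m closed \<open>m' = m\<close> glue_symmetric_nested[OF sz(2), of j m p f g h]
      by (simp add: sz add.assoc flip: One_nat_def)
  qed (use mixed in auto)
next
  case ("open" n m c)
  note o = this
  from g h j show ?thesis
  proof (cases rule: SC1_composable)
    case (mixed m' c' p)
    then have mm: "m' = m" "c' = c" using o by (metis profile_simps(2,3))+
    have *: "plug cs i ds ! (i + j) = Closed" unfolding o(7) using o mixed mm by (subst profile_nth) auto
    have sz: "2 * (n + m) + c = 2 * n + (2 * m + c)" "2 * j + 1 < 2 * m + c"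
      "2 * (m + p - 1) + c = 2 * m + c + 2 * p - 2" using mixed mm by (simp, linarith, linarith)
    show ?thesis
      unfolding o(1) pcomp_SC1_Open_Closed[of "plug cs i ds", OF *] pcomp_SC1_Open_Open[of cs, OF o(2)]
        o(2) pcomp_SC1_Open_Closed[of ds, OF mixed(2)]
      unfolding mixed(7) o(7) using o mixed mm glue_centre_nested[OF sz(2), of n p "-1" f g h]
      by (simp add: sz add.assoc flip: One_nat_def)
  next
    case ("open" m' p c')
    then have mm: "m' = m" "c = 1" using o by (metis profile_simps(2,3))+
    have *: "plug cs i ds ! (i + j) = Open" unfolding o(7) using o "open" mm by (subst profile_nth) auto
    have "glue (-1) (2 * (n + m) + 1) (n + m) (2 * p + c') (glue (-1) (2 * n + 1) n (2 * m + 1) f g) h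
       = glue (-1) (2 * n + 1) n (2 * (m + p) + c') f (glue (-1) (2 * m + 1) m (2 * p + c') g h)"
      by (rule glue_nested) auto
    then show ?thesis
      unfolding o(1) pcomp_SC1_Open_Open[of "plug cs i ds", OF *] pcomp_SC1_Open_Open[of cs, OF o(2)]
        o(2) pcomp_SC1_Open_Open[of ds, OF "open"(2)]
      unfolding "open"(7) o(7) using o "open" mm
      by (simp flip: One_nat_def)
  qed (use "open" in auto)
qed

lemma SC1_assoc_parallel:
  assumes f: "f \<in> topspace (ops SC1 cs x)" and g: "g \<in> topspace (ops SC1 ds (cs ! i))"
    and h: "h \<in> topspace (ops SC1 es (cs ! k))" and ik: "i < k" and k: "k < length cs"
  shows "pcomp SC1 (plug cs i ds) x (k + length ds - 1) es (pcomp SC1 cs x i ds f g) h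
       = pcomp SC1 (plug cs k es) x i ds (pcomp SC1 cs x k es f h) g"
proof -
  have i: "i < length cs" using ik k by simp
  from f g i show ?thesis
  proof (cases rule: SC1_composable)
    case (closed n m)
    from f h k closed show ?thesis
      by (cases rule: SC1_composable[OF f h k])
        (use ik in \<open>auto simp: pcomp_SC1 glue_parallel\<close>)
  next
    case (mixed n c m)
    note m = this
    from f h k show ?thesis
    proof (cases rule: SC1_composable)
      case (mixed n' c' p)
      then have mm: "n' = n" "c' = c" using m by (metis profile_simps(2,3))+
      have *: "plug cs i ds ! (k + length ds - 1) = Closed" "plug cs k es ! i = Closed"
        unfolding m(7) mixed(7) using m mixed mm ik by (subst profile_nth; auto)+
      have sz: "2 * (n + m - 1) + c = 2 * n + c + 2 * m - 2" "2 * k + 1 < 2 * n + c"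
        "2 * (n + p - 1) + c = 2 * n + c + 2 * p - 2" using mixed mm by linarith+
      show ?thesis
        unfolding m(1) pcomp_SC1_Open_Closed[of "plug cs i ds", OF *(1)] pcomp_SC1_Open_Closed[of "plug cs k es", OF *(2)]
          pcomp_SC1_Open_Closed[of cs, OF m(2)] pcomp_SC1_Open_Closed[of cs, OF mixed(2)]
        unfolding mixed(7) m(7) using m mixed mm glue_symmetric_parallel[OF ik sz(2), of m p f g h]
        by (simp add: sz add.assoc flip: One_nat_def)
    next
      case ("open" n' p c')
      then have mm: "n' = n" "c = 1" using m by (metis profile_simps(2,3))+
      have *: "plug cs i ds ! (k + length ds - 1) = Open" "plug cs k es ! i = Closed"
        unfolding m(7) "open"(7) using m "open" mm ik by (subst profile_nth; auto)+
      have sz: "2 * (n + m - 1) + 1 = 2 * n + 1 + 2 * m - 2" "2 * (n + p) + c' = 2 * n + (2 * p + c')" using m by (linarith, simp)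
      show ?thesis
        unfolding m(1) pcomp_SC1_Open_Open[of "plug cs i ds", OF *(1)] pcomp_SC1_Open_Closed[of "plug cs k es", OF *(2)]
          pcomp_SC1_Open_Closed[of cs, OF m(2)] pcomp_SC1_Open_Open[of cs, OF "open"(2)]
        unfolding "open"(7) m(7) using m "open" mm glue_centre_parallel[OF m(6), of "-1" m "2 * p + c'" f g h]
        by (simp add: sz add.assoc flip: One_nat_def)
    qed (use m in auto)
  next
    case ("open" n m c)
    \<comment> \<open>Input \<open>i\<close> is the last one here, so there is no \<open>k\<close>
      beyond it.\<close>
    with ik k show ?thesis by simp
  qed
qed

lemma is_operad_SC1: "is_operad SC1"
  unfolding is_operad_def
proof (intro conjI allI ballI impI; (elim conjE)?)
qed (blast intro: ident_SC1_in_topspace continuous_map_pcomp_SC1 SC1_ident_left SC1_ident_right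
    SC1_assoc_nested SC1_assoc_parallel)+

subsection \<open>Leaf intervals of edges\<close>

text \<open>Every internal edge is listed with its leaf interval: the first leaf above it and the number
  of leaves above it, where the leaves are counted from a given offset.\<close>

fun spans_vertex :: "nat \<Rightarrow> ('v, 'e) vertex \<Rightarrow> ((nat \<times> nat) \<times> 'e) list"
  and spans_branches :: "nat \<Rightarrow> ('v, 'e) branch list \<Rightarrow> ((nat \<times> nat) \<times> 'e) list"
  and spans_branch :: "nat \<Rightarrow> ('v, 'e) branch \<Rightarrow> ((nat \<times> nat) \<times> 'e) list" where
  "spans_vertex a (Vertex c v bs) = spans_branches a bs"
| "spans_branches a [] = []"
| "spans_branches a (b # bs) = spans_branch a b @ spans_branches (a + length (leaves_branch b)) bs"
| "spans_branch a (Leaf c) = []"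
| "spans_branch a (Branch e w) = ((a, length (leaves_vertex w)), e) # spans_vertex a w"

fun spans :: "('v, 'e) tree \<Rightarrow> ((nat \<times> nat) \<times> 'e) list" where
  "spans (Trivial c) = []"
| "spans (Rooted w) = spans_vertex 0 w"

text \<open>A name for the right-hand side of \<open>leaves_vertex.simps\<close>, which it replaces
  in simplification below: inductions over branch lists need the leaves as a function of the
  list.\<close>

definition leaves_branches :: "('v, 'e) branch list \<Rightarrow> color list" where
  "leaves_branches bs = concat (map leaves_branch bs)"

lemma leaves_branches_simps [simp]:
  "leaves_branches [] = []" "leaves_branches (b # bs) = leaves_branch b @ leaves_branches bs"
  "leaves_branches (as @ bs) = leaves_branches as @ leaves_branches bs"
  "leaves_vertex (Vertex c v bs) = leaves_branches bs"
  by (simp_all add: leaves_branches_def)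

declare leaves_vertex.simps [simp del]

lemma spans_branches_append:
  "spans_branches a (as @ bs) = spans_branches a as @ spans_branches (a + length (leaves_branches as)) bs"
  by (induction as arbitrary: a) (simp_all add: add.assoc)

lemma leaves_map:
  fixes w :: "('v, 'e) vertex" and b :: "('v, 'e) branch"
  shows "leaves_vertex (map_vertex f g w) = leaves_vertex w"
    and "leaves_branch (map_branch f g b) = leaves_branch b"
proof (induction w and b rule: leaves_vertex_leaves_branch.induct)
  case (1 c v bs)
  then show ?case by (simp add: leaves_branches_def o_def cong: map_cong)
qed simp_all

lemma spans_map:
  fixes w :: "('v, 'e) vertex" and bs :: "('v, 'e) branch list" and b :: "('v, 'e) branch"
  shows "spans_vertex a (map_vertex f g w) = map (map_prod id g) (spans_vertex a w)"
  "spans_branches a (map (map_branch f g) bs) = map (map_prod id g) (spans_branches a bs)"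
  "spans_branch a (map_branch f g b) = map (map_prod id g) (spans_branch a b)"
proof (induction a w and a bs and a b rule: spans_vertex_spans_branches_spans_branch.induct)
qed (simp_all add: leaves_map)

lemma shift_spans:
  fixes w :: "('v, 'e) vertex" and bs :: "('v, 'e) branch list" and b :: "('v, 'e) branch"
  shows "spans_vertex (a + k) w = map (map_prod (map_prod (\<lambda>s. s + k) id) id) (spans_vertex a w)"
  "spans_branches (a + k) bs = map (map_prod (map_prod (\<lambda>s. s + k) id) id) (spans_branches a bs)"
  "spans_branch (a + k) b = map (map_prod (map_prod (\<lambda>s. s + k) id) id) (spans_branch a b)"
proof (induction a w and a bs and a b rule: spans_vertex_spans_branches_spans_branch.induct)
  case (3 a b bs)
  then show ?case by (simp add: add.assoc add.commute[of k] add.left_commute[of k])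
qed simp_all

subsection \<open>Operations of the operad of monoid actions\<close>

text \<open>One formula for both colours: for \<open>Closed\<close> it yields the nonempty lists of
  closed inputs, for \<open>Open\<close> the lists with exactly one open input, at the end.\<close>

definition act_profile :: "color list \<Rightarrow> color \<Rightarrow> bool" where
  "act_profile ds d \<longleftrightarrow> (\<exists>n. ds = replicate n Closed @ [d])"

lemma topspace_Act_bar: "() \<in> topspace (ops Act_bar ds d) \<longleftrightarrow> act_profile ds d"
proof -
  have "act_profile ds Closed \<longleftrightarrow> (\<exists>p. ds = profile p 0 \<and> ds \<noteq> [])"
    unfolding act_profile_def profile_def
    by (metis append_Nil2 append_is_Nil_conv not0_implies_Suc not_Cons_self2 replicate_0 replicate_Suc replicate_append_same)
  moreover have "act_profile ds Open \<longleftrightarrow> (\<exists>p. ds = profile p 1)"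
    by (simp add: act_profile_def profile_def)
  moreover have "profile p 1 \<noteq> []" for p by (simp add: profile_def)
  ultimately show ?thesis
    by (cases d) (auto simp: Act_bar_def Act_def)
qed

lemma act_profile_singleton [simp]: "act_profile [c] d \<longleftrightarrow> c = d"
  by (auto simp: act_profile_def)

lemma act_profile_nonempty: "act_profile ds d \<Longrightarrow> ds \<noteq> []" "act_profile ds d \<Longrightarrow> last ds = d"
  by (auto simp: act_profile_def)

lemma act_profile_append: "act_profile (ds @ [c]) d \<longleftrightarrow> c = d \<and> set ds \<subseteq> {Closed}"
proof -
  have "set ds \<subseteq> {Closed} \<longleftrightarrow> (\<exists>n. ds = replicate n Closed)"
    by (auto intro!: exI[of _ "length ds"] replicate_length_same[symmetric])
  then show ?thesis by (auto simp: act_profile_def)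
qed

text \<open>\<open>cs\<close> ends in \<open>d\<close>, so plugging it in for \<open>d\<close>
  merely inserts closed inputs in front of \<open>d\<close>.\<close>

lemma act_profile_plug:
  assumes "act_profile (as @ d # bs) c" "act_profile cs d"
  shows "act_profile (as @ cs @ bs) c"
proof -
  obtain es where es: "cs = es @ [d]" "set es \<subseteq> {Closed}"
    using assms(2) by (metis act_profile_append act_profile_nonempty append_butlast_last_id)
  show ?thesis
  proof (cases bs rule: rev_cases)
    case Nil
    then show ?thesis using assms es act_profile_append[of as d c] act_profile_append[of "as @ es" d c] by auto
  next
    case (snoc bs' b)
    then show ?thesis using assms es act_profile_append[of "as @ d # bs'" b c]
      act_profile_append[of "as @ es @ d # bs'" b c] by auto
  qed
qed

abbreviation "act_trees \<equiv> labelled_trees Act_bar"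

text \<open>The label and length conditions of \<open>labelled_trees\<close> in structurally
  recursive form, suited to induction over trees.\<close>

fun good_vertex :: "(unit, real) vertex \<Rightarrow> bool" and good_branch :: "(unit, real) branch \<Rightarrow> bool" where
  "good_vertex (Vertex c v bs) \<longleftrightarrow> act_profile (map branch_color bs) c \<and> (\<forall>b \<in> set bs. good_branch b)"
| "good_branch (Leaf c) \<longleftrightarrow> True"
| "good_branch (Branch e w) \<longleftrightarrow> 0 \<le> e \<and> e \<le> 1 \<and> good_vertex w"

fun good_tree :: "(unit, real) tree \<Rightarrow> bool" where
  "good_tree (Trivial c) \<longleftrightarrow> True"
| "good_tree (Rooted w) \<longleftrightarrow> good_vertex w"

lemma good_vertices_edges:
  fixes w :: "(unit, real) vertex" and b :: "(unit, real) branch"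
  shows "good_vertex w \<longleftrightarrow>
     (\<forall>(v, ds, d) \<in> set (vertices_vertex w). v \<in> topspace (ops Act_bar ds d)) \<and>
     (\<forall>l \<in> set (edges_vertex w). 0 \<le> l \<and> l \<le> 1)"
  and "good_branch b \<longleftrightarrow>
     (\<forall>(v, ds, d) \<in> set (vertices_branch b). v \<in> topspace (ops Act_bar ds d)) \<and>
     (\<forall>l \<in> set (edges_branch b). 0 \<le> l \<and> l \<le> 1)"
proof (induction w and b rule: leaves_vertex_leaves_branch.induct)
  case (1 c v bs)
  then show ?case by (auto simp: topspace_Act_bar[of _ c, simplified] split: prod.splits)
qed auto

lemma labelled_trees_Act_bar:
  "t \<in> act_trees cs x \<longleftrightarrow> leaves t = cs \<and> root_color t = x \<and> good_tree t"
  by (cases t) (auto simp: labelled_trees_def good_vertices_edges)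

lemma good_leaves:
  "good_vertex w \<Longrightarrow> act_profile (leaves_vertex w) (vertex_color w)"
  "good_branch b \<Longrightarrow> act_profile (leaves_branch b) (branch_color b)"
proof (induction w and b rule: leaves_vertex_leaves_branch.induct)
  case (1 c v bs)
  \<comment> \<open>The branches are expanded into their leaves one after the other;
    \<open>pre\<close> collects the leaves already produced.\<close>
  have "act_profile (pre @ leaves_branches bs) c"
    if "act_profile (pre @ map branch_color bs) c" "\<forall>b\<in>set bs. act_profile (leaves_branch b) (branch_color b)" for pre
    using that
  proof (induction bs arbitrary: pre)
    case (Cons b bs)
    then have "act_profile (pre @ leaves_branch b @ map branch_color bs) c"
      using act_profile_plug[of pre "branch_color b" "map branch_color bs" c "leaves_branch b"] by simp
    then show ?case using Cons.IH[of "pre @ leaves_branch b"] Cons.prems by simp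
  qed simp
  from this[of "[]"] 1 show ?case by simp
qed (auto)

text \<open>Here it matters that \<open>Act_bar\<close> has no nullary operation: no subtree is
  without leaves, so every edge can be located by the leaves above it.\<close>

lemma good_leaves_pos:
  "good_vertex w \<Longrightarrow> 1 \<le> length (leaves_vertex w)"
  "good_branch b \<Longrightarrow> 1 \<le> length (leaves_branch b)"
  using good_leaves act_profile_nonempty by (metis Suc_leI One_nat_def length_greater_0_conv)+

lemma good_branches_length: "\<forall>b \<in> set bs. good_branch b \<Longrightarrow> length bs \<le> length (leaves_branches bs)"
  by (induction bs) (use good_leaves_pos(2) in \<open>auto, fastforce\<close>)

lemma spans_within:
  fixes w :: "(unit, real) vertex" and bs :: "(unit, real) branch list" and b :: "(unit, real) branch"
  shows "good_vertex w \<Longrightarrow> ((s, n), e) \<in> set (spans_vertex a w) \<Longrightarrow>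
     a \<le> s \<and> s + n \<le> a + length (leaves_vertex w) \<and> 1 \<le> n \<and> e \<le> 1"
  "\<forall>b \<in> set bs. good_branch b \<Longrightarrow> ((s, n), e) \<in> set (spans_branches a bs) \<Longrightarrow>
     a \<le> s \<and> s + n \<le> a + length (leaves_branches bs) \<and> 1 \<le> n \<and> e \<le> 1"
  "good_branch b \<Longrightarrow> ((s, n), e) \<in> set (spans_branch a b) \<Longrightarrow>
     a \<le> s \<and> s + n \<le> a + length (leaves_branch b) \<and> 1 \<le> n \<and> e \<le> 1"
proof (induction a w and a bs and a b rule: spans_vertex_spans_branches_spans_branch.induct)
  case (3 a b bs)
  then show ?case by fastforce
next
  case (5 a e w)
  then show ?case using good_leaves_pos(1)[of w] by auto
qed auto

subsection \<open>The length of the edge above a leaf interval\<close>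

text \<open>Edges over the same leaf interval are separated by unary vertices only, and erasing
  these merges the lengths to their maximum. The default \<open>0\<close> fits the contraction of
  edges of length zero.\<close>

fun max_label :: "((nat \<times> nat) \<times> real) list \<Rightarrow> nat \<times> nat \<Rightarrow> real" where
  "max_label [] p = 0"
| "max_label ((q, e) # xs) p = (if q = p then max e (max_label xs p) else max_label xs p)"

lemma max_label_nonneg: "0 \<le> max_label xs p"
  by (induction xs p rule: max_label.induct) auto

lemma max_label_append [simp]: "max_label (xs @ ys) p = max (max_label xs p) (max_label ys p)"
  by (induction xs p rule: max_label.induct) (auto simp: max_label_nonneg max.assoc)

text \<open>For positive \<open>r\<close> the default value cannot interfere, and only membership in
  the list counts. This makes \<open>max_label\<close> independent of order and repetition.\<close>

lemma max_label_ge_iff: "0 < r \<Longrightarrow> r \<le> max_label xs p \<longleftrightarrow> (\<exists>e. (p, e) \<in> set xs \<and> r \<le> e)"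
  by (induction xs p rule: max_label.induct) (auto simp: le_max_iff_disj)

lemma max_label_cong:
  assumes "\<And>e. (p, e) \<in> set xs \<longleftrightarrow> (q, e) \<in> set ys"
  shows "max_label xs p = max_label ys q"
proof -
  have "r \<le> max_label xs p \<longleftrightarrow> r \<le> max_label ys q" if "0 < r" for r
    using that assms by (simp add: max_label_ge_iff)
  then show ?thesis
    by (metis antisym_conv1 linorder_not_le max_label_nonneg order.strict_iff_not order_le_less_trans verit_comp_simplify1(3))
qed

lemma max_label_eq_0: "(\<And>e. (p, e) \<notin> set xs) \<Longrightarrow> max_label xs p = 0"
  using max_label_cong[of p xs p "[]"] by simp

lemma max_label_eq_1:
  assumes "(p, 1) \<in> set xs" "\<And>e. (p, e) \<in> set xs \<Longrightarrow> e \<le> 1"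
  shows "max_label xs p = 1"
proof -
  have "1 \<le> max_label xs p" using assms by (subst max_label_ge_iff) auto
  moreover have "\<not> 1 < max_label xs p"
  proof
    assume "1 < max_label xs p"
    then obtain e where "(p, e) \<in> set xs" "max_label xs p \<le> e"
      using max_label_ge_iff[of "max_label xs p" xs p] by auto
    with assms(2)[of e] \<open>1 < max_label xs p\<close> show False by simp
  qed
  ultimately show ?thesis by simp
qed

lemma max_label_scale:
  assumes "0 \<le> r"
  shows "max_label (map (map_prod id (\<lambda>e. r * e)) xs) p = r * max_label xs p"
proof (induction xs p rule: max_label.induct)
  case (2 q e xs p)
  then show ?case using assms by (auto simp: max_mult_distrib_left)
qed simp

text \<open>The full leaf interval and single leaves are discarded, because the edges above them can only
  come from unary vertices.\<close>

definition edge_length :: "(unit, real) tree \<Rightarrow> nat \<times> nat \<Rightarrow> real" where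
  "edge_length t p = (if 2 \<le> snd p \<and> snd p < length (leaves t) then max_label (spans t) p else 0)"

text \<open>Contraction drops a label \<open>0\<close>, and erasing between two edges keeps the
  maximum. Erasing below a leaf drops an edge over a single leaf, which \<open>2 \<le> snd p\<close>
  excludes.\<close>

lemma bv_vertex_invariant:
  assumes "bv_vertex P w w'"
  shows "leaves_vertex w' = leaves_vertex w \<and> vertex_color w' = vertex_color w \<and>
    (\<forall>a p. 2 \<le> snd p \<longrightarrow> max_label (spans_vertex a w') p = max_label (spans_vertex a w) p)"
  using assms
proof (induction rule: bv_vertex.induct)
  case (contract c v as d w cs bs)
  then show ?case by (auto simp: spans_branches_append add.assoc max_label_nonneg max.assoc max_absorb2 le_max_iff_disj)
next
  case (inside w w' c v as l bs)
  then show ?case by (auto simp: spans_branches_append max.assoc)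
qed (auto simp: spans_branches_append max.assoc max.left_commute)

lemma bv_step_invariant:
  assumes "bv_step P s t"
  shows "edge_length s = edge_length t"
  using assms
proof (induction rule: bv_step.induct)
  case (rooted w w')
  then show ?case using bv_vertex_invariant[OF rooted] by (auto simp: edge_length_def fun_eq_iff)
qed (auto simp: edge_length_def fun_eq_iff)

lemma bv_equiv_edge_length: "(s, t) \<in> bv_equiv P cs x \<Longrightarrow> edge_length s = edge_length t"
proof -
  assume "(s, t) \<in> bv_equiv P cs x"
  then have "equivclp (\<lambda>s t. s \<in> labelled_trees P cs x \<and> t \<in> labelled_trees P cs x \<and> bv_step P s t) s t"
    by (simp add: bv_equiv_def)
  then show ?thesis
    by (induction rule: equivclp_induct) (auto dest: bv_step_invariant)
qed

subsection \<open>Reduced trees\<close>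

text \<open>Normal forms for the relations: positive lengths prevent contraction, and at least two
  inputs prevent erasing an identity.\<close>

fun reduced_vertex :: "(unit, real) vertex \<Rightarrow> bool" and reduced_branch :: "(unit, real) branch \<Rightarrow> bool" where
  "reduced_vertex (Vertex c v bs) \<longleftrightarrow> 2 \<le> length bs \<and> (\<forall>b \<in> set bs. reduced_branch b)"
| "reduced_branch (Leaf c) \<longleftrightarrow> True"
| "reduced_branch (Branch e w) \<longleftrightarrow> 0 < e \<and> reduced_vertex w"

fun reduced_tree :: "(unit, real) tree \<Rightarrow> bool" where
  "reduced_tree (Trivial c) \<longleftrightarrow> True"
| "reduced_tree (Rooted w) \<longleftrightarrow> reduced_vertex w"

lemma good_bv_vertex:
  assumes "bv_vertex P w w'" "good_vertex w"
  shows "good_vertex w'"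
  using assms
proof (induction rule: bv_vertex.induct)
  case (contract c v as d w cs bs)
  then show ?case
    using act_profile_plug[of "map branch_color as" d "map branch_color bs" c "map branch_color cs"] by auto
next
  case (inside w w' c v as l bs)
  then show ?case using bv_vertex_invariant[OF inside(1)] by auto
qed auto

lemma good_bv_step: "bv_step P s t \<Longrightarrow> good_tree s \<Longrightarrow> good_tree t"
  by (induction rule: bv_step.induct) (auto simp: good_bv_vertex)

lemma bv_step_leaves: "bv_step P s t \<Longrightarrow> leaves t = leaves s \<and> root_color t = root_color s"
  by (induction rule: bv_step.induct) (auto simp: bv_vertex_invariant)

text \<open>A defect is always removable, at the cost of at least one vertex. Removing a branch or
  its upper vertex is a step of the vertex below, hence the quantification over that vertex in the
  second part. The root vertex of \<open>w\<close> has none below it and may stay unary;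
  \<open>tree_reduces\<close> deals with it.\<close>

lemma vertex_reduces:
  fixes w :: "(unit, real) vertex" and b :: "(unit, real) branch"
  shows "good_vertex w \<Longrightarrow> (case w of Vertex c v bs \<Rightarrow> \<forall>b \<in> set bs. reduced_branch b) \<or>
      (\<exists>w'. bv_vertex Act_bar w w' \<and> length (vertices_vertex w') < length (vertices_vertex w))"
    and "good_branch b \<Longrightarrow> reduced_branch b \<or> (\<forall>c v as bs. \<exists>w'. bv_vertex Act_bar (Vertex c v (as @ b # bs)) w' \<and>
      length (vertices_vertex w') < length (vertices_vertex (Vertex c v (as @ b # bs))))"
proof (induction w and b rule: leaves_vertex_leaves_branch.induct)
  case (1 c v bs)
  show ?case
  proof (cases "\<forall>b \<in> set bs. reduced_branch b")
    case False
    then obtain as b cs where "bs = as @ b # cs" "\<not> reduced_branch b" by (metis split_list)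
    with 1 show ?thesis by fastforce
  qed simp
next
  case (3 e w)
  obtain d v us where w: "w = Vertex d v us" by (cases w)
  from 3 consider (red) "\<forall>b \<in> set us. reduced_branch b"
    | (step) w' where "bv_vertex Act_bar w w'" "length (vertices_vertex w') < length (vertices_vertex w)"
    by (auto simp: w)
  then show ?case
  proof cases
    case step
    then show ?thesis
      using bv_vertex.inside[OF step(1)] by fastforce
  next
    case red
    have ok: "act_profile (map branch_color us) d" using 3 w by simp
    then have "us \<noteq> []" using act_profile_nonempty by fastforce
    then consider "2 \<le> length us" | u where "us = [u]" by (cases us; cases "tl us") auto
    then show ?thesis
    proof cases
      case 1
      show ?thesis
      proof (cases "e = 0")
        case True
        show ?thesis unfolding True w
          by (intro disjI2 allI exI conjI, rule bv_vertex.contract) simp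
      next
        case False
        then show ?thesis using 1 red 3 w by simp
      qed
    next
      case u: 2
      show ?thesis
      proof (cases u)
        case (Leaf c)
        \<comment> \<open>A unary vertex has equal input and output colours and its label is the
          only element of \<open>unit\<close>, so it is an identity.\<close>
        then have w': "w = Vertex d (ident Act_bar d) [Leaf d]" using u ok w by simp
        have "bv_vertex Act_bar (Vertex c v (as @ Branch e w # bs)) (Vertex c v (as @ Leaf d # bs))" for c v as bs
          unfolding w' by (rule bv_vertex.erase_below_leaf)
        moreover have "length (vertices_vertex (Vertex c v (as @ Leaf d # bs)))
            < length (vertices_vertex (Vertex c v (as @ Branch e w # bs)))" for c v as bs
          by (simp add: w)
        ultimately show ?thesis by blast
      next
        case (Branch m w')
        then have w': "w = Vertex d (ident Act_bar d) [Branch m w']" "vertex_color w' = d" using u ok w by simp_all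
        have "bv_vertex Act_bar (Vertex c v (as @ Branch e w # bs)) (Vertex c v (as @ Branch (max e m) w' # bs))"
          for c v as bs
          unfolding w'(1) by (rule bv_vertex.erase_between) fact
        moreover have "length (vertices_vertex (Vertex c v (as @ Branch (max e m) w' # bs)))
            < length (vertices_vertex (Vertex c v (as @ Branch e w # bs)))" for c v as bs
          by (simp add: w u Branch)
        ultimately show ?thesis by blast
      qed
    qed
  qed
qed simp

lemma tree_reduces:
  "good_tree t \<Longrightarrow> reduced_tree t \<or>
     (\<exists>t'. bv_step Act_bar t t' \<and> length (vertices t') < length (vertices t))"
proof (cases t)
  case (Rooted w)
  assume good: "good_tree t"
  obtain c v bs where w: "w = Vertex c v bs" by (cases w)
  from vertex_reduces(1)[of w] good Rooted w
  consider (red) "\<forall>b \<in> set bs. reduced_branch b"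
    | (step) w' where "bv_vertex Act_bar w w'" "length (vertices_vertex w') < length (vertices_vertex w)"
    by auto
  then show ?thesis
  proof cases
    case step
    then show ?thesis using bv_step.rooted[OF step(1)] Rooted by auto
  next
    case red
    have ok: "act_profile (map branch_color bs) c" using good w Rooted by simp
    then have "bs \<noteq> []" using act_profile_nonempty by fastforce
    then consider "2 \<le> length bs" | u where "bs = [u]" by (cases bs; cases "tl bs") auto
    then show ?thesis
    proof cases
      case 1
      then show ?thesis using red Rooted w by simp
    next
      case u: 2
      show ?thesis
      proof (cases u)
        case (Leaf d)
        then have "t = Rooted (Vertex c (ident Act_bar c) [Leaf c])" using u ok w Rooted by simp
        then show ?thesis using bv_step.erase_only by fastforce
      next
        case (Branch m w')
        then have "t = Rooted (Vertex c (ident Act_bar c) [Branch m w'])" "vertex_color w' = c"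
          using u ok w Rooted by simp_all
        then show ?thesis using bv_step.erase_root by fastforce
      qed
    qed
  qed
qed simp

lemma equiv_bv_equiv: "equiv (labelled_trees P cs x) (bv_equiv P cs x)"
proof (rule equivI)
  let ?R = "\<lambda>s t. s \<in> labelled_trees P cs x \<and> t \<in> labelled_trees P cs x \<and> bv_step P s t"
  have mem: "t \<in> labelled_trees P cs x" if "equivclp ?R s t" "s \<in> labelled_trees P cs x" for s t
    using that by (induction rule: equivclp_induct) auto
  then show "bv_equiv P cs x \<subseteq> labelled_trees P cs x \<times> labelled_trees P cs x"
    unfolding bv_equiv_def by blast
  show "refl_on (labelled_trees P cs x) (bv_equiv P cs x)"
    by (rule refl_onI) (simp add: bv_equiv_def)
  show "sym (bv_equiv P cs x)"
    unfolding bv_equiv_def using mem equivclp_sym[of ?R] by (blast intro: symI)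
  show "trans (bv_equiv P cs x)"
    unfolding bv_equiv_def using equivclp_trans[of ?R] by (blast intro: transI)
qed

lemma reduced_representative:
  assumes "t \<in> act_trees cs x"
  shows "\<exists>t' \<in> act_trees cs x. reduced_tree t' \<and> (t, t') \<in> bv_equiv Act_bar cs x"
  using assms
proof (induction "length (vertices t)" arbitrary: t rule: less_induct)
  case less
  show ?case
  proof (cases "reduced_tree t")
    case True
    then show ?thesis using less.prems equiv_bv_equiv[of Act_bar cs x] by (auto simp: equiv_def refl_on_def)
  next
    case False
    then obtain u where u: "bv_step Act_bar t u" "length (vertices u) < length (vertices t)"
      using less.prems tree_reduces by (auto simp: labelled_trees_Act_bar)
    then have "u \<in> act_trees cs x"
      using less.prems good_bv_step[OF u(1)] bv_step_leaves[OF u(1)] by (simp add: labelled_trees_Act_bar)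
    moreover from this u have "(t, u) \<in> bv_equiv Act_bar cs x"
      using less.prems by (auto simp: bv_equiv_def intro: r_into_equivclp)
    ultimately show ?thesis
      using less.hyps[OF u(2)] equiv_bv_equiv[of Act_bar cs x] by (meson equiv_def transE)
  qed
qed

lemma reduced_leaves:
  assumes "good_vertex w" "reduced_vertex w"
  shows "2 \<le> length (leaves_vertex w)"
  using assms good_branches_length by (cases w) fastforce

text \<open>Each of the at least two branches contains a leaf, so no edge inside them carries all
  the leaves. Consequently the edge below a reduced vertex is the only one over its leaf
  interval.\<close>

lemma reduced_kids_proper:
  assumes "good_vertex (Vertex c v bs)" "2 \<le> length bs" "((s, n), e) \<in> set (spans_branches a bs)"
  shows "n < length (leaves_branches bs)"
proof -
  obtain b r where bs: "bs = b # r" "r \<noteq> []" using assms(2) by (cases bs; cases "tl bs") auto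
  have "length r \<le> length (leaves_branches r)"
    using assms(1) bs by (intro good_branches_length) simp
  moreover have "1 \<le> length (leaves_branch b)" using assms(1) bs good_leaves_pos(2) by simp
  moreover have "((s, n), e) \<in> set (spans_branch a b) \<or> ((s, n), e) \<in> set (spans_branches (a + length (leaves_branch b)) r)"
    using assms bs by simp
  then have "n \<le> length (leaves_branch b) \<or> n \<le> length (leaves_branches r)"
    using spans_within(2,3) assms(1) bs by fastforce
  moreover have "length r \<ge> 1" using bs by (cases r) auto
  ultimately show ?thesis using bs by auto
qed

lemma max_label_pos: "((p, e) \<in> set xs) \<Longrightarrow> 0 < e \<Longrightarrow> \<exists>e'. (p, e') \<in> set ys" if "max_label xs p = max_label ys p"
  using that max_label_ge_iff[of e] by (metis order_refl)

text \<open>The labelled intervals determine the planar tree: an internal first branch is visible as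
  the longest interval starting at \<open>a\<close>, its root edge having positive length. The
  induction then descends to the remaining branches and to the branches above that edge.\<close>

lemma reduced_unique:
  assumes "\<forall>b \<in> set bs. good_branch b \<and> reduced_branch b" "\<forall>b \<in> set bs'. good_branch b \<and> reduced_branch b"
    and "leaves_branches bs = leaves_branches bs'"
    and "\<And>p. 2 \<le> snd p \<Longrightarrow> max_label (spans_branches a bs) p = max_label (spans_branches a bs') p"
  shows "bs = bs'"
  using assms
proof (induction "size_list size bs" arbitrary: a bs bs' rule: less_induct)
  case less
  have pos: "leaves_branches (b # r) \<noteq> []" if "good_branch b" for b r
    using good_leaves_pos(2)[OF that] by auto
  show ?case
  proof (cases bs)
    case Nil
    then show ?thesis using less.prems pos by (cases bs') auto
  next
    case (Cons b r)
    then obtain b' r' where bs': "bs' = b' # r'" using less.prems pos by (cases bs') auto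
    have good: "good_branch b" "good_branch b'" "\<forall>b\<in>set r. good_branch b" "\<forall>b\<in>set r'. good_branch b"
      "reduced_branch b" "reduced_branch b'"
      using less.prems Cons bs' by auto
    \<comment> \<open>The root edge of \<open>x'\<close> has positive length, so its interval also
      occurs in the other list. Later branches start further right, so it occurs inside
      \<open>x\<close>, which therefore has at least as many leaves.\<close>
    have le: "length (leaves_branch x') \<le> length (leaves_branch x)"
      if "good_branch x" "good_branch x'" "reduced_branch x'" "\<forall>b\<in>set q. good_branch b"
        and m: "\<And>p. 2 \<le> snd p \<Longrightarrow>
            max_label (spans_branches a (x # q)) p = max_label (spans_branches a (x' # q')) p"
      for x x' q q'
    proof (cases x')
      case (Leaf c)
      then show ?thesis using good_leaves_pos(2)[OF that(1)] by simp
    next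
      case (Branch l u)
      let ?n = "length (leaves_vertex u)"
      have n: "2 \<le> ?n" using that Branch reduced_leaves by simp
      then have "max_label (spans_branches a (x' # q')) (a, ?n) = max_label (spans_branches a (x # q)) (a, ?n)"
        using m[of "(a, ?n)"] by simp
      from max_label_pos[OF this, of l] that Branch obtain e where
        "((a, ?n), e) \<in> set (spans_branches a (x # q))" by auto
      moreover have "((a, ?n), e) \<notin> set (spans_branches (a + length (leaves_branch x)) q)"
        using spans_within(2)[OF that(4)] good_leaves_pos(2)[OF that(1)] by fastforce
      ultimately have "((a, ?n), e) \<in> set (spans_branch a x)" by simp
      from spans_within(3)[OF that(1) this] Branch show ?thesis by simp
    qed
    have len: "length (leaves_branch b) = length (leaves_branch b')"
      using le[of b b' r r'] le[of b' b r' r] good less.prems Cons bs' by (metis le_antisym)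
    then have lv: "leaves_branch b = leaves_branch b'" "leaves_branches r = leaves_branches r'"
      using less.prems Cons bs' by simp_all
    define n where "n = length (leaves_branch b)"
    have eq: "max_label (spans_branch a b @ spans_branches (a + n) r) p
        = max_label (spans_branch a b' @ spans_branches (a + n) r') p" if "2 \<le> snd p" for p
      using less.prems(4)[OF that] Cons bs' len by (simp add: n_def)
    have below: "(p, e) \<in> set (spans_branch a b) \<Longrightarrow> fst p < a + n"
      "(p, e) \<in> set (spans_branch a b') \<Longrightarrow> fst p < a + n"
      "(p, e) \<in> set (spans_branches (a + n) r) \<Longrightarrow> a + n \<le> fst p"
      "(p, e) \<in> set (spans_branches (a + n) r') \<Longrightarrow> a + n \<le> fst p" for p e
      using spans_within(3)[OF good(1)] spans_within(3)[OF good(2)]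
        spans_within(2)[OF good(3)] spans_within(2)[OF good(4)]
      by (cases p; fastforce simp: n_def len)+
    have z: "a + n \<le> fst p \<Longrightarrow> max_label (spans_branch a b) p = 0"
      "a + n \<le> fst p \<Longrightarrow> max_label (spans_branch a b') p = 0"
      "fst p < a + n \<Longrightarrow> max_label (spans_branches (a + n) r) p = 0"
      "fst p < a + n \<Longrightarrow> max_label (spans_branches (a + n) r') p = 0" for p
      using below[of p] by (auto intro!: max_label_eq_0)
    have "max_label (spans_branches (a + n) r) p = max_label (spans_branches (a + n) r') p" if "2 \<le> snd p" for p
      using eq[OF that] z[of p] by (cases "a + n \<le> fst p") (auto simp: max_label_nonneg)
    then have "r = r'" using less.prems Cons bs' lv by (intro less.hyps[where a = "a + n"]) auto
    have eqb: "max_label (spans_branch a b) p = max_label (spans_branch a b') p" if "2 \<le> snd p" for p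
      using eq[OF that] z[of p] by (cases "a + n \<le> fst p") (auto simp: max_label_nonneg)
    have "b = b'"
    proof (cases b)
      case (Leaf c)
      then have "length (leaves_branch b') = 1" using len by simp
      then show ?thesis using Leaf lv good reduced_leaves by (cases b') fastforce+
    next
      case (Branch l u)
      then have "2 \<le> n" using good reduced_leaves by (simp add: n_def)
      with len obtain l' u' where b': "b' = Branch l' u'" by (cases b') (auto simp: n_def)
      obtain c v k where u: "u = Vertex c v k" by (cases u)
      obtain c' v' k' where u': "u' = Vertex c' v' k'" by (cases u')
      have nk: "n = length (leaves_branches k)" "n = length (leaves_branches k')"
        using len Branch b' u u' by (simp_all add: n_def)
      \<comment> \<open>The output colour is the colour of the last leaf.\<close>
      have "c = c'" using good_leaves(1)[of u] good_leaves(1)[of u'] good lv Branch b' u u'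
        by (auto dest!: act_profile_nonempty(2))
      \<comment> \<open>No inner edge shares the interval of the root edge. So the value at
        \<open>(a, n)\<close> is the length of the root edge alone, and the other values are those
        of the inner edges.\<close>
      have "max_label (spans_branches a k) (a, n) = 0" "max_label (spans_branches a k') (a, n) = 0"
        using reduced_kids_proper[of c v k a n _ a] reduced_kids_proper[of c' v' k' a n _ a] good Branch b' u u' nk
        by (auto intro!: max_label_eq_0)
      moreover from this have "l = l'" using eqb[of "(a, n)"] \<open>2 \<le> n\<close> Branch b' u u' nk good by simp
      ultimately have "max_label (spans_branches a k) p = max_label (spans_branches a k') p" if "2 \<le> snd p" for p
        using eqb[OF that] Branch b' u u' nk by (cases "p = (a, n)") auto
      then have "k = k'" using less.prems Cons bs' Branch b' u u' lv good
        by (intro less.hyps[where a = a]) auto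
      then show ?thesis using Branch b' u u' \<open>c = c'\<close> \<open>l = l'\<close> by simp
    qed
    with \<open>r = r'\<close> show ?thesis using Cons bs' by simp
  qed
qed

lemma reduced_tree_unique:
  assumes "good_tree s" "good_tree t" "reduced_tree s" "reduced_tree t" "leaves s = leaves t"
    and "edge_length s = edge_length t"
  shows "s = t"
proof (cases s)
  case (Trivial c)
  then have "length (leaves t) = 1" using assms(5) by (metis leaves.simps(1) length_Cons list.size(3) One_nat_def)
  then show ?thesis using Trivial assms by (cases t) (auto dest: reduced_leaves)
next
  case (Rooted w)
  then have "2 \<le> length (leaves t)" using assms reduced_leaves[of w] by simp
  then obtain w' where t: "t = Rooted w'" by (cases t) auto
  obtain c v k where w: "w = Vertex c v k" by (cases w)
  obtain c' v' k' where w': "w' = Vertex c' v' k'" by (cases w')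
  have "c = c'" using good_leaves(1)[of w] good_leaves(1)[of w'] assms Rooted t w w'
    by (auto dest!: act_profile_nonempty(2))
  \<comment> \<open>\<open>edge_length\<close> is blind to intervals at least as long as all the
    leaves, but in reduced trees no edge lies over these.\<close>
  have big: "max_label (spans_branches 0 k) p = 0" "max_label (spans_branches 0 k') p = 0"
    if "length (leaves t) \<le> snd p" for p
    using reduced_kids_proper[of c v k "fst p" "snd p" _ 0] reduced_kids_proper[of c' v' k' "fst p" "snd p" _ 0]
      assms Rooted t w w' that by (fastforce intro!: max_label_eq_0)+
  have "max_label (spans_branches 0 k) p = max_label (spans_branches 0 k') p" if "2 \<le> snd p" for p
  proof (cases "snd p < length (leaves t)")
    case True
    then show ?thesis using that fun_cong[OF assms(6), of p] assms(5) Rooted t w w' by (simp add: edge_length_def)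
  qed (use big in simp)
  then have "k = k'"
    using assms Rooted t w w' by (intro reduced_unique[where a = 0]) auto
  then show ?thesis using Rooted t w w' \<open>c = c'\<close> by simp
qed

text \<open>Edge lengths are a complete invariant: both trees have reduced representatives with the
  same edge lengths and leaves, and these coincide by \<open>reduced_tree_unique\<close>.\<close>

lemma bv_equiv_iff:
  assumes "s \<in> act_trees cs x" "t \<in> act_trees cs x"
  shows "(s, t) \<in> bv_equiv Act_bar cs x \<longleftrightarrow> edge_length s = edge_length t"
proof
  assume eq: "edge_length s = edge_length t"
  obtain s' t' where s': "s' \<in> act_trees cs x" "reduced_tree s'" "(s, s') \<in> bv_equiv Act_bar cs x"
    and t': "t' \<in> act_trees cs x" "reduced_tree t'" "(t, t') \<in> bv_equiv Act_bar cs x"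
    using assms reduced_representative by metis
  then have "s' = t'"
    using eq by (intro reduced_tree_unique) (auto simp: labelled_trees_Act_bar dest!: bv_equiv_edge_length)
  then show "(s, t) \<in> bv_equiv Act_bar cs x"
    using s' t' equiv_bv_equiv[of Act_bar cs x] by (meson equiv_def symE transE)
qed (rule bv_equiv_edge_length)

subsection \<open>Grafting\<close>

lemma leaves_graft_vertex:
  fixes w :: "('v, 'e) vertex" and bs :: "('v, 'e) branch list"
  shows "i < length (leaves_vertex w) \<Longrightarrow>
      leaves_vertex (graft_vertex w i b) = plug (leaves_vertex w) i (leaves_branch b)"
    and "i < length (leaves_branches bs) \<Longrightarrow>
      leaves_branches (graft_branches bs i b) = plug (leaves_branches bs) i (leaves_branch b)"
proof (induction w i b and bs i b rule: graft_vertex_graft_branches.induct)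
  case (3 c bs i b)
  then show ?case by (cases i) (auto simp: plug_def)
next
  case (4 e w bs i b)
  show ?case
  proof (cases "i < length (leaves_vertex w)")
    case False
    then have "Suc i - length (leaves_vertex w) = Suc (i - length (leaves_vertex w))" by simp
    with False 4 show ?thesis by (auto simp: plug_def)
  qed (use 4 in \<open>auto simp: plug_def\<close>)
qed simp_all

lemma vertex_color_graft_vertex [simp]: "vertex_color (graft_vertex w i b) = vertex_color w"
  by (cases w) simp

lemma good_graft_vertex:
  fixes w :: "(unit, real) vertex" and bs :: "(unit, real) branch list"
  shows "i < length (leaves_vertex w) \<Longrightarrow> good_vertex w \<Longrightarrow> good_branch b \<Longrightarrow>
      branch_color b = leaves_vertex w ! i \<Longrightarrow> good_vertex (graft_vertex w i b)"
    and "i < length (leaves_branches bs) \<Longrightarrow> \<forall>b \<in> set bs. good_branch b \<Longrightarrow> good_branch b \<Longrightarrow>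
      branch_color b = leaves_branches bs ! i \<Longrightarrow>
      map branch_color (graft_branches bs i b) = map branch_color bs \<and>
      (\<forall>b \<in> set (graft_branches bs i b). good_branch b)"
proof (induction w i b and bs i b rule: graft_vertex_graft_branches.induct)
  case (3 c bs i b)
  then show ?case by (cases i) auto
next
  case (4 e w bs i b)
  then show ?case by (cases "i < length (leaves_vertex w)") (auto simp: nth_append)
qed simp_all

lemma graft_vertex_nested:
  fixes w :: "('v, 'e) vertex" and bs :: "('v, 'e) branch list"
  shows "i < length (leaves_vertex w) \<Longrightarrow> j < length (leaves_vertex u) \<Longrightarrow>
      graft_vertex (graft_vertex w i (Branch l u)) (i + j) b = graft_vertex w i (Branch l (graft_vertex u j b))"
    and "i < length (leaves_branches bs) \<Longrightarrow> j < length (leaves_vertex u) \<Longrightarrow>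
      graft_branches (graft_branches bs i (Branch l u)) (i + j) b
        = graft_branches bs i (Branch l (graft_vertex u j b))"
proof (induction w i b and bs i b rule: graft_vertex_graft_branches.induct)
  case (3 c bs i b)
  then show ?case by (cases i) auto
next
  case (4 e w bs i b)
  then show ?case by (cases "i < length (leaves_vertex w)") (auto simp: leaves_graft_vertex(1) plug_def)
qed simp_all

lemma graft_vertex_parallel:
  fixes w :: "('v, 'e) vertex" and bs :: "('v, 'e) branch list"
  shows "i < k \<Longrightarrow> k < length (leaves_vertex w) \<Longrightarrow> 1 \<le> length (leaves_branch b) \<Longrightarrow>
      graft_vertex (graft_vertex w i b) (k + length (leaves_branch b) - 1) b'
        = graft_vertex (graft_vertex w k b') i b"
    and "i < k \<Longrightarrow> k < length (leaves_branches bs) \<Longrightarrow> 1 \<le> length (leaves_branch b) \<Longrightarrow>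
      graft_branches (graft_branches bs i b) (k + length (leaves_branch b) - 1) b'
        = graft_branches (graft_branches bs k b') i b"
proof (induction w i b and bs i b arbitrary: k and k rule: graft_vertex_graft_branches.induct)
  case (3 c bs i b)
  have *: "graft_branches (x # bs) (k + length (leaves_branch x) - 1) b' = x # graft_branches bs (k - 1) b'"
    if "0 < k" for x
    using that by (cases x) auto
  show ?case
  proof (cases "i = 0")
    case True
    then show ?thesis using 3 * by simp
  next
    case False
    then show ?thesis using 3(1)[of "k - 1"] 3 by auto
  qed
next
  case (4 e w bs i b)
  let ?n = "length (leaves_vertex w)"
  consider "k < ?n" | "i < ?n" "?n \<le> k" | "?n \<le> i" by linarith
  then show ?case
  proof cases
    case 1
    then show ?thesis using 4 by (auto simp: leaves_graft_vertex(1) plug_def)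
  next
    case 2
    then have "k + length (leaves_branch b) - 1 - length (leaves_vertex (graft_vertex w i b)) = k - ?n"
      "\<not> k + length (leaves_branch b) - 1 < length (leaves_vertex (graft_vertex w i b))"
      using 4 by (auto simp: leaves_graft_vertex(1) plug_def)
    then show ?thesis using 2 4 by simp
  next
    case 3
    then have "k + length (leaves_branch b) - 1 - ?n = (k - ?n) + length (leaves_branch b) - 1"
      using 4 by simp
    then show ?thesis using 3 4(2)[of "k - ?n"] 4 by auto
  qed
qed simp_all

text \<open>The effect on leaf intervals of replacing leaf \<open>j\<close> by \<open>M\<close> leaves.\<close>

definition expand :: "nat \<Rightarrow> nat \<Rightarrow> nat \<times> nat \<Rightarrow> nat \<times> nat" where
  "expand j M p = (if j < fst p then (fst p + M - 1, snd p)
     else if j < fst p + snd p then (fst p, snd p + M - 1) else p)"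

text \<open>An equation of sets is enough, since \<open>max_label\<close> depends on membership only
  (\<open>max_label_cong\<close>).\<close>

lemma spans_graft_vertex:
  fixes w :: "(unit, real) vertex" and bs :: "(unit, real) branch list"
  shows "i < length (leaves_vertex w) \<Longrightarrow> good_vertex w \<Longrightarrow> good_branch b \<Longrightarrow>
      set (spans_vertex a (graft_vertex w i b))
        = map_prod (expand (a + i) (length (leaves_branch b))) id ` set (spans_vertex a w)
          \<union> set (spans_branch (a + i) b)"
    and "i < length (leaves_branches bs) \<Longrightarrow> \<forall>b \<in> set bs. good_branch b \<Longrightarrow> good_branch b \<Longrightarrow>
      set (spans_branches a (graft_branches bs i b))
        = map_prod (expand (a + i) (length (leaves_branch b))) id ` set (spans_branches a bs)
          \<union> set (spans_branch (a + i) b)"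
proof (induction w i b and bs i b arbitrary: a and a rule: graft_vertex_graft_branches.induct)
  case (3 c bs i b)
  show ?case
  proof (cases "i = 0")
    case True
    define M where "M = length (leaves_branch b)"
    have M: "1 \<le> M" using good_leaves_pos(2) 3 by (simp add: M_def)
    \<comment> \<open>All intervals of \<open>bs\<close> lie to the right of the replaced leaf,
      where \<open>expand\<close> is the shift by \<open>M - 1\<close>.\<close>
    have "spans_branches (a + M) bs = map (map_prod (map_prod (\<lambda>s. s + (M - 1)) id) id) (spans_branches (a + 1) bs)"
      using shift_spans(2)[of "a + 1" "M - 1" bs] M by simp
    moreover have "map_prod (map_prod (\<lambda>s. s + (M - 1)) id) id x = map_prod (expand a M) id x"
      if "x \<in> set (spans_branches (a + 1) bs)" for x
    proof -
      obtain s n e where x: "x = ((s, n), e)" by (metis prod.exhaust)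
      with that 3 spans_within(2)[of bs s n e "a + 1"] M show ?thesis by (simp add: expand_def)
    qed
    ultimately have "set (spans_branches (a + M) bs) = map_prod (expand a M) id ` set (spans_branches (a + 1) bs)"
      by (auto simp: image_iff intro!: bexI)
    then show ?thesis using True by (simp add: M_def Un_commute id_def)
  next
    case False
    then show ?thesis using 3(1)[of "a + 1"] 3 by simp
  qed
next
  case (4 e w bs i b)
  define M n where "M = length (leaves_branch b)" and "n = length (leaves_vertex w)"
  have M: "1 \<le> M" using good_leaves_pos(2) 4 by (simp add: M_def)
  show ?case
  proof (cases "i < n")
    case True
    have "spans_branches (a + n + M - 1) bs = map (map_prod (map_prod (\<lambda>s. s + (M - 1)) id) id) (spans_branches (a + n) bs)"
      using shift_spans(2)[of "a + n" "M - 1" bs] M by simp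
    moreover have "map_prod (map_prod (\<lambda>s. s + (M - 1)) id) id x = map_prod (expand (a + i) M) id x"
      if "x \<in> set (spans_branches (a + n) bs)" for x
    proof -
      obtain s m e where x: "x = ((s, m), e)" by (metis prod.exhaust)
      with that 4 spans_within(2)[of bs s m e "a + n"] M True show ?thesis by (simp add: expand_def n_def)
    qed
    ultimately have rest: "set (spans_branches (a + n + M - 1) bs)
        = map_prod (expand (a + i) M) id ` set (spans_branches (a + n) bs)"
      by (auto simp: image_iff intro!: bexI)
    have "length (leaves_vertex (graft_vertex w i b)) = n + M - 1"
      using True M by (simp add: leaves_graft_vertex(1) plug_def n_def M_def)
    moreover have "a + (n + M - 1) = a + n + M - 1" using M by simp
    moreover have "expand (a + i) M (a, n) = (a, n + M - 1)" using True by (simp add: expand_def)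
    ultimately show ?thesis using True 4 rest
      by (simp add: n_def[symmetric] M_def[symmetric] image_Un id_def Un_ac)
  next
    case False
    have "map_prod (expand (a + i) M) id x = x" if "x \<in> set (spans_vertex a w)" for x
    proof -
      obtain s m e where x: "x = ((s, m), e)" by (metis prod.exhaust)
      with that 4 spans_within(1)[of w s m e a] M False show ?thesis by (auto simp: expand_def n_def)
    qed
    then have "map_prod (expand (a + i) M) id ` set (spans_vertex a w) = set (spans_vertex a w)"
      by force
    moreover have "expand (a + i) M (a, n) = (a, n)" using False by (simp add: expand_def)
    moreover have "a + n + (i - n) = a + i" using False by simp
    ultimately show ?thesis using False 4(2)[of "a + n"] 4(3-)
      by (simp add: n_def[symmetric] M_def[symmetric] image_Un id_def Un_ac)
  qed
qed simp_all

lemma plug_single: "i < length cs \<Longrightarrow> plug cs i [cs ! i] = cs"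
  by (simp add: plug_def id_take_nth_drop[symmetric])

lemma graft_labelled:
  assumes s: "s \<in> act_trees cs x" and t: "t \<in> act_trees ds (cs ! i)"
    and i: "i < length cs"
  shows "graft s i t \<in> act_trees (plug cs i ds) x"
proof (cases s)
  case (Trivial c)
  then show ?thesis using assms by (auto simp: labelled_trees_Act_bar plug_def)
next
  case s': (Rooted w)
  show ?thesis
  proof (cases t)
    case (Trivial c)
    then show ?thesis using assms s' by (auto simp: labelled_trees_Act_bar plug_single)
  next
    case (Rooted w')
    then show ?thesis using assms s' good_graft_vertex(1)[of i w "Branch 1 w'"]
      by (auto simp: labelled_trees_Act_bar leaves_graft_vertex(1))
  qed
qed

lemma labelled_length: "t \<in> act_trees cs x \<Longrightarrow> length (leaves t) = length cs"
  by (auto simp: labelled_trees_Act_bar)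

lemma labelled_pos:
  assumes "t \<in> act_trees cs x"
  shows "1 \<le> length cs" and "act_profile cs x"
  using assms good_leaves_pos(1) good_leaves(1) by (cases t; auto simp: labelled_trees_Act_bar)+

lemma labelled_Trivial: "Trivial c \<in> act_trees cs x \<longleftrightarrow> cs = [c] \<and> x = c"
  by (auto simp: labelled_trees_Act_bar)

lemma graft_nested:
  assumes s: "s \<in> act_trees cs x" and t: "t \<in> act_trees ds (cs ! i)"
    and u: "u \<in> act_trees es (ds ! j)" and "i < length cs" "j < length ds"
  shows "graft (graft s i t) (i + j) u = graft s i (graft t j u)"
proof (cases s)
  case (Trivial c)
  then show ?thesis using assms by (auto simp: labelled_Trivial)
next
  case s': (Rooted w)
  show ?thesis
  proof (cases t)
    case (Trivial c)
    then show ?thesis using assms s' by (auto simp: labelled_Trivial)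
  next
    case t': (Rooted w')
    show ?thesis
    proof (cases u)
      case (Rooted w'')
      have "i < length (leaves_vertex w)" "j < length (leaves_vertex w')"
        using assms s' t' by (auto simp: labelled_trees_Act_bar)
      then show ?thesis using s' t' Rooted by (simp add: graft_vertex_nested(1))
    qed (use s' t' in simp)
  qed
qed

lemma graft_parallel:
  assumes s: "s \<in> act_trees cs x" and t: "t \<in> act_trees ds (cs ! i)"
    and u: "u \<in> act_trees es (cs ! k)" and "i < k" "k < length cs"
  shows "graft (graft s i t) (k + length ds - 1) u = graft (graft s k u) i t"
proof (cases s)
  case (Trivial c)
  then show ?thesis using assms by (auto simp: labelled_Trivial)
next
  case s': (Rooted w)
  show ?thesis
  proof (cases t)
    case (Trivial c)
    then show ?thesis using assms s' by (cases u) (auto simp: labelled_Trivial)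
  next
    case t': (Rooted w')
    show ?thesis
    proof (cases u)
      case (Rooted w'')
      have "k < length (leaves_vertex w)" "1 \<le> length (leaves_branch (Branch 1 w'))" "ds = leaves_vertex w'"
        using assms s' t' labelled_pos[OF t] by (auto simp: labelled_trees_Act_bar)
      then show ?thesis using s' t' Rooted \<open>i < k\<close>
          graft_vertex_parallel(1)[of i k w "Branch 1 w'" "Branch 1 w''"] by simp
    qed (use s' t' in simp)
  qed
qed

text \<open>The leaf interval \<open>(i, M)\<close> belongs to the new edge. The intervals that overlap it without
  inclusion belong to no edge.\<close>

definition compose_lengths ::
  "nat \<Rightarrow> nat \<Rightarrow> nat \<Rightarrow> (nat \<times> nat \<Rightarrow> real) \<Rightarrow> (nat \<times> nat \<Rightarrow> real) \<Rightarrow> nat \<times> nat \<Rightarrow> real" where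
  "compose_lengths N i M f g p = (case p of (s, n) \<Rightarrow>
     if n < 2 \<or> N + M - 1 \<le> n then 0
     else if (s, n) = (i, M) then 1
     else if i \<le> s \<and> s + n \<le> i + M then g (s - i, n)
     else if s \<le> i \<and> i + M \<le> s + n then f (s, n + 1 - M)
     else if i + M \<le> s then f (s + 1 - M, n)
     else if s + n \<le> i then f (s, n)
     else 0)"

lemma spans_tree_within:
  assumes "good_tree t" "((s, n), e) \<in> set (spans t)"
  shows "s + n \<le> length (leaves t) \<and> 1 \<le> n \<and> e \<le> 1"
  using assms spans_within(1)[of _ s n e 0] by (cases t) auto

lemma spans_graft:
  assumes "good_vertex w" "good_vertex w'" "i < length (leaves_vertex w)"
  shows "(p, e) \<in> set (spans (graft (Rooted w) i (Rooted w'))) \<longleftrightarrow>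
     (\<exists>q. p = expand i (length (leaves_vertex w')) q \<and> (q, e) \<in> set (spans (Rooted w))) \<or>
     (p, e) = ((i, length (leaves_vertex w')), 1) \<or>
     (i \<le> fst p \<and> ((fst p - i, snd p), e) \<in> set (spans (Rooted w')))"
proof -
  have "set (spans (graft (Rooted w) i (Rooted w'))) =
      map_prod (expand i (length (leaves_vertex w'))) id ` set (spans (Rooted w))
      \<union> insert ((i, length (leaves_vertex w')), 1) (set (spans_vertex i w'))"
    using assms by (simp add: spans_graft_vertex(1))
  moreover have "(p, e) \<in> set (spans_vertex i w') \<longleftrightarrow>
      i \<le> fst p \<and> ((fst p - i, snd p), e) \<in> set (spans (Rooted w'))"
    using shift_spans(1)[of 0 i w'] by (cases p) (force simp: image_iff)
  moreover have "(p, e) \<in> map_prod f id ` S \<longleftrightarrow> (\<exists>q. p = f q \<and> (q, e) \<in> S)"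
    for f :: "nat \<times> nat \<Rightarrow> nat \<times> nat" and S :: "((nat \<times> nat) \<times> real) set" by force
  ultimately show ?thesis by auto
qed

text \<open>Every edge of the grafted tree is an old edge of \<open>s\<close> with its interval
  expanded, an edge of \<open>t\<close> with its interval shifted, or the new edge. Which of these
  can lie over a given interval depends on its position relative to the block \<open>(i, M)\<close>
  of the leaves of \<open>t\<close>.\<close>

lemma edge_length_graft:
  assumes s: "s \<in> act_trees cs x" and t: "t \<in> act_trees ds (cs ! i)"
    and i: "i < length cs"
  shows "edge_length (graft s i t) = compose_lengths (length cs) i (length ds) (edge_length s) (edge_length t)"
proof
  fix p :: "nat \<times> nat"
  define N M where "N = length cs" and "M = length ds"
  obtain a n where p: "p = (a, n)" by (cases p)
  have N: "length (leaves s) = N" and M: "length (leaves t) = M" "1 \<le> M"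
    and NM: "length (leaves (graft s i t)) = N + M - 1"
    using labelled_length[OF s] labelled_length[OF t] labelled_pos(1)[OF t] labelled_length[OF graft_labelled[OF assms]] i
    by (auto simp: N_def M_def plug_def)
  have gs: "good_tree s" "good_tree t" using s t by (auto simp: labelled_trees_Act_bar)
  show "edge_length (graft s i t) p = compose_lengths (length cs) i (length ds) (edge_length s) (edge_length t) p"
  proof (cases "n < 2 \<or> N + M - 1 \<le> n")
    case True
    then show ?thesis using NM by (auto simp: p edge_length_def compose_lengths_def N_def M_def)
  next
    case False
    \<comment> \<open>\<open>compose_lengths\<close> also inspects intervals of \<open>s\<close>
      that run past the last leaf; no edge lies over these.\<close>
    have out_s: "max_label (spans s) (b, m) = 0" if "N < b + m \<or> m = 0" for b m
      using spans_tree_within[OF gs(1)] N that by (fastforce intro!: max_label_eq_0)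
    have lhs: "edge_length (graft s i t) p = max_label (spans (graft s i t)) (a, n)"
      using False NM by (simp add: p edge_length_def)
    show ?thesis
    proof (cases s)
      case (Trivial c)
      then have "i = 0" "N = 1" using s i by (auto simp: labelled_Trivial N_def)
      moreover have "max_label (spans t) (a, n) = 0" if "M < a + n"
        using spans_tree_within[OF gs(2)] M that by (fastforce intro!: max_label_eq_0)
      ultimately show ?thesis unfolding lhs using False Trivial M
        by (auto simp: compose_lengths_def edge_length_def p N_def[symmetric] M_def[symmetric])
    next
      case s': (Rooted w)
      show ?thesis
      proof (cases t)
        case (Trivial c)
        then have "M = 1" using t by (auto simp: labelled_Trivial M_def)
        then show ?thesis unfolding lhs using False s' Trivial N M i
          by (auto simp: compose_lengths_def edge_length_def p N_def[symmetric] M_def[symmetric])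
      next
        case t': (Rooted w')
        have lw: "length (leaves_vertex w) = N" "length (leaves_vertex w') = M" "i < N"
          using N M s' t' i by (simp_all add: N_def)
        have mem: "((a, n), e) \<in> set (spans (graft s i t)) \<longleftrightarrow>
          (\<exists>b m. (a, n) = expand i M (b, m) \<and> ((b, m), e) \<in> set (spans s)) \<or>
          ((a, n), e) = ((i, M), 1) \<or> (i \<le> a \<and> ((a - i, n), e) \<in> set (spans t))" for e
          using spans_graft[of w w' i "(a, n)" e] gs lw s' t' by simp
        consider (top) "(a, n) = (i, M)" | (inner) "i \<le> a" "a + n \<le> i + M" "n < M"
          | (outer) "a \<le> i" "i + M \<le> a + n" "M < n" | (right) "i + M \<le> a" | (left) "a + n \<le> i"
          | (cross) "a < i \<and> i < a + n \<and> a + n < i + M \<or> i < a \<and> a < i + M \<and> i + M < a + n"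
          by fastforce
        then show ?thesis
        proof cases
          case top
          \<comment> \<open>Unary vertices next to the new edge may give further edges over the same
            interval, but none longer than \<open>1\<close>.\<close>
          have "max_label (spans (graft s i t)) (a, n) = 1"
          proof (rule max_label_eq_1)
            show "((a, n), 1) \<in> set (spans (graft s i t))" using mem[of 1] top by simp
          next
            fix e assume "((a, n), e) \<in> set (spans (graft s i t))"
            then show "e \<le> 1" using mem[of e] spans_tree_within gs by blast
          qed
          then show ?thesis unfolding lhs using top False
            by (simp add: compose_lengths_def p N_def M_def)
        next
          case inner
          have "max_label (spans (graft s i t)) (a, n) = max_label (spans t) (a - i, n)"
          proof (rule max_label_cong)
            fix e
            have "(a, n) \<noteq> expand i M (b, m)" if "((b, m), e) \<in> set (spans s)" for b m
              using inner spans_tree_within[OF gs(1) that] by (auto simp: expand_def)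
            then show "((a, n), e) \<in> set (spans (graft s i t)) \<longleftrightarrow> ((a - i, n), e) \<in> set (spans t)"
              using mem[of e] inner by auto
          qed
          then show ?thesis unfolding lhs using inner False M
            by (simp add: compose_lengths_def edge_length_def p N_def M_def)
        next
          case outer
          have "max_label (spans (graft s i t)) (a, n) = max_label (spans s) (a, n + 1 - M)"
          proof (rule max_label_cong)
            fix e
            have "((a - i, n), e) \<notin> set (spans t)"
              using outer spans_tree_within[OF gs(2), of "a - i" n e] M by auto
            moreover have "(a, n) = expand i M (b, m) \<longleftrightarrow> (b, m) = (a, n + 1 - M)"
              if "((b, m), e) \<in> set (spans s)" for b m
              using outer M spans_tree_within[OF gs(1) that] by (auto simp: expand_def)
            ultimately show "((a, n), e) \<in> set (spans (graft s i t)) \<longleftrightarrow> ((a, n + 1 - M), e) \<in> set (spans s)"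
              using mem[of e] outer by auto
          qed
          then show ?thesis unfolding lhs using outer False N
            by (auto simp: compose_lengths_def edge_length_def p N_def[symmetric] M_def[symmetric])
        next
          case right
          have "max_label (spans (graft s i t)) (a, n) = max_label (spans s) (a + 1 - M, n)"
          proof (rule max_label_cong)
            fix e
            have "((a - i, n), e) \<notin> set (spans t)"
              using right spans_tree_within[OF gs(2), of "a - i" n e] M False by auto
            moreover have "(a, n) = expand i M (b, m) \<longleftrightarrow> (b, m) = (a + 1 - M, n)"
              if "((b, m), e) \<in> set (spans s)" for b m
              using right M False spans_tree_within[OF gs(1) that] by (auto simp: expand_def)
            ultimately show "((a, n), e) \<in> set (spans (graft s i t)) \<longleftrightarrow> ((a + 1 - M, n), e) \<in> set (spans s)"
              using mem[of e] right False by auto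
          qed
          then show ?thesis unfolding lhs using right False N M out_s[of "a + 1 - M" n]
            by (auto simp: compose_lengths_def edge_length_def p N_def[symmetric] M_def[symmetric])
        next
          case left
          have "max_label (spans (graft s i t)) (a, n) = max_label (spans s) (a, n)"
          proof (rule max_label_cong)
            fix e
            have "(a, n) = expand i M (b, m) \<longleftrightarrow> (b, m) = (a, n)"
              if "((b, m), e) \<in> set (spans s)" for b m
              using left M False spans_tree_within[OF gs(1) that] by (auto simp: expand_def)
            then show "((a, n), e) \<in> set (spans (graft s i t)) \<longleftrightarrow> ((a, n), e) \<in> set (spans s)"
              using mem[of e] left False by auto
          qed
          then show ?thesis unfolding lhs using left False N M lw
            by (auto simp: compose_lengths_def edge_length_def p N_def[symmetric] M_def[symmetric])
        next
          case cross
          \<comment> \<open>An expanded interval contains the whole block or avoids it, and an edge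
            of \<open>t\<close> lies inside it; nothing crosses its boundary.\<close>
          have "((a, n), e) \<notin> set (spans (graft s i t))" for e
          proof -
            have "(a, n) \<noteq> expand i M (b, m)" if "((b, m), e) \<in> set (spans s)" for b m
              using cross M False spans_tree_within[OF gs(1) that] by (auto simp: expand_def)
            moreover have "i \<le> a \<Longrightarrow> ((a - i, n), e) \<notin> set (spans t)"
              using cross spans_tree_within[OF gs(2), of "a - i" n e] M by auto
            ultimately show ?thesis using mem[of e] cross by auto
          qed
          moreover have "(a, n) \<noteq> (i, M)" "\<not> (i \<le> a \<and> a + n \<le> i + M)" "\<not> (a \<le> i \<and> i + M \<le> a + n)"
            "\<not> i + M \<le> a" "\<not> a + n \<le> i" using cross by auto
          ultimately show ?thesis unfolding lhs unfolding compose_lengths_def p N_def[symmetric] M_def[symmetric] prod.case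
            by (simp only: max_label_eq_0 if_False if_cancel not_False_eq_True simp_thms)
        qed
      qed
    qed
  qed
qed

subsection \<open>Numbering vertices and edges\<close>

text \<open>Produces the shape of a tree, which exhibits the tree as a point of a cell. The
  arguments \<open>a\<close> and \<open>b\<close> are the next free vertex and edge numbers.\<close>

fun number_vertex :: "nat \<Rightarrow> nat \<Rightarrow> ('v, 'e) vertex \<Rightarrow> (nat, nat) vertex"
  and number_branches :: "nat \<Rightarrow> nat \<Rightarrow> ('v, 'e) branch list \<Rightarrow> (nat, nat) branch list"
  and number_branch :: "nat \<Rightarrow> nat \<Rightarrow> ('v, 'e) branch \<Rightarrow> (nat, nat) branch" where
  "number_vertex a b (Vertex c v bs) = Vertex c a (number_branches (Suc a) b bs)"
| "number_branches a b [] = []"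
| "number_branches a b (x # xs) =
     number_branch a b x # number_branches (a + length (vertices_branch x)) (b + length (edges_branch x)) xs"
| "number_branch a b (Leaf c) = Leaf c"
| "number_branch a b (Branch e w) = Branch b (number_vertex a (Suc b) w)"

fun number :: "('v, 'e) tree \<Rightarrow> (nat, nat) tree" where
  "number (Trivial c) = Trivial c"
| "number (Rooted w) = Rooted (number_vertex 0 0 w)"

lemma number_profile:
  fixes w :: "('v, 'e) vertex" and bs :: "('v, 'e) branch list" and x :: "('v, 'e) branch"
  shows "leaves_vertex (number_vertex a b w) = leaves_vertex w \<and>
      vertex_color (number_vertex a b w) = vertex_color w \<and>
      map snd (vertices_vertex (number_vertex a b w)) = map snd (vertices_vertex w)"
    and "leaves_branches (number_branches a b bs) = leaves_branches bs \<and>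
      map branch_color (number_branches a b bs) = map branch_color bs \<and>
      map snd (concat (map vertices_branch (number_branches a b bs))) = map snd (concat (map vertices_branch bs))"
    and "leaves_branch (number_branch a b x) = leaves_branch x \<and>
      branch_color (number_branch a b x) = branch_color x \<and>
      map snd (vertices_branch (number_branch a b x)) = map snd (vertices_branch x)"
  by (induction a b w and a b bs and a b x rule: number_vertex_number_branches_number_branch.induct) auto

lemma number_indices:
  fixes w :: "('v, 'e) vertex" and bs :: "('v, 'e) branch list" and x :: "('v, 'e) branch"
  shows "map fst (vertices_vertex (number_vertex a b w)) = [a..<a + length (vertices_vertex w)] \<and>
      edges_vertex (number_vertex a b w) = [b..<b + length (edges_vertex w)]"
    and "map fst (concat (map vertices_branch (number_branches a b bs)))
        = [a..<a + length (concat (map vertices_branch bs))] \<and>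
      concat (map edges_branch (number_branches a b bs)) = [b..<b + length (concat (map edges_branch bs))]"
    and "map fst (vertices_branch (number_branch a b x)) = [a..<a + length (vertices_branch x)] \<and>
      edges_branch (number_branch a b x) = [b..<b + length (edges_branch x)]"
proof (induction a b w and a b bs and a b x rule: number_vertex_number_branches_number_branch.induct)
  case (1 a b c v bs)
  then show ?case by (simp add: upt_conv_Cons del: upt_Suc)
next
  case (3 a b x xs)
  then show ?case
    using upt_add_eq_append[of a "a + length (vertices_branch x)"]
      upt_add_eq_append[of b "b + length (edges_branch x)"] by (simp add: add.assoc)
next
  case (5 a b e w)
  then show ?case by (simp add: upt_conv_Cons del: upt_Suc)
qed auto

text \<open>Vertex labels are of type \<open>unit\<close>, so any \<open>f\<close> restores them;
  only the edge labels have to be looked up.\<close>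

lemma map_number:
  fixes w :: "(unit, 'e) vertex" and bs :: "(unit, 'e) branch list" and x :: "(unit, 'e) branch"
  shows "(\<And>k. k < length (edges_vertex w) \<Longrightarrow> l (b + k) = edges_vertex w ! k) \<Longrightarrow>
      map_vertex f l (number_vertex a b w) = w"
    and "(\<And>k. k < length (concat (map edges_branch bs)) \<Longrightarrow> l (b + k) = concat (map edges_branch bs) ! k) \<Longrightarrow>
      map (map_branch f l) (number_branches a b bs) = bs"
    and "(\<And>k. k < length (edges_branch x) \<Longrightarrow> l (b + k) = edges_branch x ! k) \<Longrightarrow>
      map_branch f l (number_branch a b x) = x"
proof (induction a b w and a b bs and a b x rule: number_vertex_number_branches_number_branch.induct)
  case (3 a b x xs)
  have "map_branch f l (number_branch a b x) = x"
  proof (rule 3(1))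
    fix k assume "k < length (edges_branch x)"
    then show "l (b + k) = edges_branch x ! k" using 3(3)[of k] by (simp add: nth_append)
  qed
  moreover have "map (map_branch f l) (number_branches (a + length (vertices_branch x)) (b + length (edges_branch x)) xs) = xs"
  proof (rule 3(2))
    fix k assume "k < length (concat (map edges_branch xs))"
    then show "l (b + length (edges_branch x) + k) = concat (map edges_branch xs) ! k"
      using 3(3)[of "length (edges_branch x) + k"] by (simp add: nth_append add.assoc)
  qed
  ultimately show ?case by (simp only: number_branches.simps list.map)
next
  case (5 a b e w)
  have "l b = e" using 5(2)[of 0] by simp
  moreover have "map_vertex f l (number_vertex a (Suc b) w) = w"
  proof (rule 5(1))
    fix k assume "k < length (edges_vertex w)"
    then show "l (Suc b + k) = edges_vertex w ! k" using 5(2)[of "Suc k"] by simp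
  qed
  ultimately show ?case by (simp only: number_branch.simps branch.map)
qed auto

lemma number_shape: "number t \<in> shapes (leaves t) (root_color t)"
proof (cases t)
  case (Rooted w)
  have "map fst (vertices_vertex (number_vertex 0 0 w)) = [0..<length (vertices_vertex (number_vertex 0 0 w))]"
    using number_indices(1)[of 0 0 w] by (metis add_0 length_map length_upt minus_nat.diff_0)
  moreover have "edges_vertex (number_vertex 0 0 w) = [0..<length (edges_vertex (number_vertex 0 0 w))]"
    using number_indices(1)[of 0 0 w] by (metis add_0 length_upt minus_nat.diff_0)
  ultimately show ?thesis using Rooted number_profile(1)[of 0 0 w] by (simp add: shapes_def)
qed (simp add: shapes_def)

lemma map_tree_number:
  fixes t :: "(unit, 'e) tree"
  assumes "\<And>k. k < length (edges t) \<Longrightarrow> l k = edges t ! k"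
  shows "map_tree f l (number t) = t"
  using assms by (cases t) (auto intro!: map_number(1))

lemma length_edges_number: "length (edges (number t)) = length (edges t)"
proof (cases t)
  case (Rooted w)
  then show ?thesis using number_indices(1)[of 0 0 w] by simp
qed simp

lemma vertices_edges_map:
  fixes w :: "('v, 'e) vertex" and b :: "('v, 'e) branch"
  shows "vertices_vertex (map_vertex f g w) = map (map_prod f id) (vertices_vertex w) \<and>
      edges_vertex (map_vertex f g w) = map g (edges_vertex w) \<and> vertex_color (map_vertex f g w) = vertex_color w"
    and "vertices_branch (map_branch f g b) = map (map_prod f id) (vertices_branch b) \<and>
      edges_branch (map_branch f g b) = map g (edges_branch b) \<and> branch_color (map_branch f g b) = branch_color b"
proof (induction w and b rule: leaves_vertex_leaves_branch.induct)
  case (1 c v bs)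
  then show ?case by (simp add: o_def map_concat cong: map_cong)
qed simp_all

lemma map_tree_simps:
  "vertices (map_tree f g t) = map (map_prod f id) (vertices t)"
  "edges (map_tree f g t) = map g (edges t)"
  "root_color (map_tree f g t) = root_color t"
  "leaves (map_tree f g t) = leaves t"
  "spans (map_tree f g t) = map (map_prod id g) (spans t)"
  by (cases t; simp add: vertices_edges_map leaves_map spans_map)+

lemma map_snd_spans:
  fixes w :: "('v, 'e) vertex" and bs :: "('v, 'e) branch list" and b :: "('v, 'e) branch"
  shows "map snd (spans_vertex a w) = edges_vertex w"
    and "map snd (spans_branches a bs) = concat (map edges_branch bs)"
    and "map snd (spans_branch a b) = edges_branch b"
  by (induction a w and a bs and a b rule: spans_vertex_spans_branches_spans_branch.induct) simp_all

lemma map_snd_spans_tree: "map snd (spans t) = edges t"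
  by (cases t) (simp_all add: map_snd_spans)

lemma realize_labelled:
  assumes "S \<in> shapes cs x" "z \<in> topspace (cell P S)"
  shows "realize (S, z) \<in> labelled_trees P cs x"
proof -
  obtain lab len where z: "z = (lab, len)" by (cases z)
  have "lab v \<in> topspace (ops P ds d)" if "(v, ds, d) \<in> set (vertices S)" for v ds d
  proof -
    from that obtain k where k: "k < length (vertices S)" "vertices S ! k = (v, ds, d)"
      by (metis in_set_conv_nth)
    then have "v = k" using assms(1)
      by (metis (mono_tags, lifting) add_0 fst_conv mem_Collect_eq nth_map nth_upt shapes_def)
    have "lab k \<in> topspace (case vertices S ! k of (_, ds, d) \<Rightarrow> ops P ds d)"
      using assms(2) k(1) by (auto simp: cell_def z PiE_iff)
    with \<open>v = k\<close> k show ?thesis by simp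
  qed
  moreover have "0 \<le> len e \<and> len e \<le> 1" if "e \<in> set (edges S)" for e
  proof -
    have "e < length (edges S)" using that assms(1) by (metis (mono_tags, lifting) atLeastLessThan_iff mem_Collect_eq set_upt shapes_def)
    then show ?thesis using assms(2) by (auto simp: cell_def z PiE_iff)
  qed
  ultimately show ?thesis using assms(1) by (auto simp: labelled_trees_def map_tree_simps z shapes_def)
qed

lemma cell_intro:
  assumes "S \<in> shapes cs x" "\<And>v ds d. (v, ds, d) \<in> set (vertices S) \<Longrightarrow> act_profile ds d"
    and "\<And>k. k < length (edges S) \<Longrightarrow> 0 \<le> l k \<and> l k \<le> 1"
  shows "(\<lambda>k \<in> {..<length (vertices S)}. (), \<lambda>k \<in> {..<length (edges S)}. l k) \<in> topspace (cell Act_bar S)"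
proof -
  have "() \<in> topspace (case vertices S ! k of (_, ds, d) \<Rightarrow> ops Act_bar ds d)" if "k < length (vertices S)" for k
    using assms(2)[of "fst (vertices S ! k)" "fst (snd (vertices S ! k))" "snd (snd (vertices S ! k))"] that
    by (simp add: case_prod_unfold topspace_Act_bar[simplified])
  then show ?thesis using assms(3) by (auto simp: cell_def)
qed

lemma number_vertices:
  assumes "t \<in> act_trees cs x" "(v, ds, d) \<in> set (vertices (number t))"
  shows "act_profile ds d"
proof -
  have "map snd (vertices (number t)) = map snd (vertices t)"
  proof (cases t)
    case (Rooted w)
    then show ?thesis using number_profile(1)[of 0 0 w] by simp
  qed simp
  then have "(ds, d) \<in> snd ` set (vertices t)" using assms(2) by (metis image_eqI list.set_map snd_conv)
  then show ?thesis using assms(1) by (auto simp: labelled_trees_def topspace_Act_bar[simplified])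
qed

lemma labelled_realize:
  assumes "t \<in> act_trees cs x"
  obtains z where "z \<in> topspace (cell Act_bar (number t))" "realize (number t, z) = t" "number t \<in> shapes cs x"
proof -
  have S: "number t \<in> shapes cs x" using assms number_shape[of t] by (auto simp: labelled_trees_Act_bar)
  let ?z = "(\<lambda>k \<in> {..<length (vertices (number t))}. (), \<lambda>k \<in> {..<length (edges (number t))}. edges t ! k)"
  have "?z \<in> topspace (cell Act_bar (number t))"
    using S number_vertices[OF assms] assms
    by (intro cell_intro) (auto simp: length_edges_number labelled_trees_def)
  moreover have "realize (number t, ?z) = t"
    by (auto intro!: map_tree_number simp: length_edges_number)
  ultimately show thesis using S that by blast
qed

subsection \<open>The topology of the Boardman-Vogt construction\<close>

definition tree_class :: "color list \<Rightarrow> color \<Rightarrow> (unit, real) tree \<Rightarrow> (unit, real) tree set" where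
  "tree_class cs x t = bv_equiv Act_bar cs x `` {t}"

abbreviation tree_sum :: "color list \<Rightarrow> color \<Rightarrow> ((nat, nat) tree \<times> (nat \<Rightarrow> unit) \<times> (nat \<Rightarrow> real)) topology" where
  "tree_sum cs x \<equiv> sum_topology (cell Act_bar) (shapes cs x)"

abbreviation "W_ops \<equiv> ops (W Act_bar)"

lemma mem_tree_class: "s \<in> tree_class cs x t \<longleftrightarrow> (t, s) \<in> bv_equiv Act_bar cs x"
  by (simp add: tree_class_def)

lemma realize_eq: "realize (S, z) = map_tree (fst z) (snd z) S"
  by (cases z) simp

lemma ops_W: "W_ops cs x = quotient_topology (tree_sum cs x) (\<lambda>z. tree_class cs x (realize z))"
  by (simp add: W_def tree_class_def)

lemma topspace_W: "topspace (W_ops cs x) = tree_class cs x ` act_trees cs x"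
proof -
  have "realize ` topspace (tree_sum cs x) = act_trees cs x"
  proof
    show "realize ` topspace (tree_sum cs x) \<subseteq> act_trees cs x"
      using realize_labelled by auto
    show "act_trees cs x \<subseteq> realize ` topspace (tree_sum cs x)"
    proof
      fix t assume "t \<in> act_trees cs x"
      from labelled_realize[OF this] obtain z where
        "z \<in> topspace (cell Act_bar (number t))" "realize (number t, z) = t" "number t \<in> shapes cs x" .
      then show "t \<in> realize ` topspace (tree_sum cs x)"
        by (intro image_eqI[of _ _ "(number t, z)"]) auto
    qed
  qed
  then show ?thesis
    unfolding ops_W topspace_quotient_topology image_image[of "tree_class cs x" realize, symmetric] by simp
qed

definition class_lengths :: "(unit, real) tree set \<Rightarrow> nat \<times> nat \<Rightarrow> real" where
  "class_lengths F = edge_length (SOME t. t \<in> F)"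

lemma tree_class_self: "t \<in> act_trees cs x \<Longrightarrow> t \<in> tree_class cs x t"
  using equiv_class_self[OF equiv_bv_equiv] by (simp add: tree_class_def)

lemma tree_class_eq_iff:
  assumes "s \<in> act_trees cs x" "t \<in> act_trees cs x"
  shows "tree_class cs x s = tree_class cs x t \<longleftrightarrow> edge_length s = edge_length t"
  using bv_equiv_iff[OF assms] eq_equiv_class_iff[OF equiv_bv_equiv assms] by (simp only: tree_class_def)

lemma class_lengths_tree_class:
  assumes "t \<in> act_trees cs x"
  shows "class_lengths (tree_class cs x t) = edge_length t"
proof -
  have "(SOME s. s \<in> tree_class cs x t) \<in> tree_class cs x t"
    using tree_class_self[OF assms] by (rule someI)
  then show ?thesis by (simp add: class_lengths_def mem_tree_class bv_equiv_edge_length)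
qed

lemma continuous_map_sum_topology:
  assumes "\<And>i. i \<in> I \<Longrightarrow> continuous_map (X i) Y (\<lambda>x. f (i, x))"
  shows "continuous_map (sum_topology X I) Y f"
  unfolding continuous_map
proof (intro conjI allI impI)
  show "f ` topspace (sum_topology X I) \<subseteq> topspace Y"
    using assms by (fastforce simp: continuous_map)
next
  fix U assume U: "openin Y U"
  have "{x. (i, x) \<in> {z \<in> topspace (sum_topology X I). f z \<in> U}} = {x \<in> topspace (X i). f (i, x) \<in> U}" if "i \<in> I" for i
    using that by auto
  then show "openin (sum_topology X I) {z \<in> topspace (sum_topology X I). f z \<in> U}"
    unfolding openin_sum_topology using assms U by (auto simp: continuous_map)
qed

text \<open>The universal properties of quotients and disjoint sums: continuity out of an operation
  space is tested on each cell. The counterpart for maps into such a space is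
  \<open>continuous_map_into_W\<close>.\<close>

lemma continuous_map_W:
  assumes "\<And>S. S \<in> shapes cs x \<Longrightarrow>
      continuous_map (cell Act_bar S) Y (\<lambda>z. f (tree_class cs x (realize (S, z))))"
  shows "continuous_map (W_ops cs x) Y f"
  unfolding ops_W
  by (rule continuous_compose_quotient_map[OF quotient_map_quotient_topology])
    (use assms in \<open>auto intro!: continuous_map_sum_topology simp: o_def\<close>)

lemma continuous_map_cell_length:
  assumes "k < length (edges S)"
  shows "continuous_map (cell P S) euclideanreal (\<lambda>z. snd z k)"
proof -
  have "continuous_map (cell P S) (product_topology (\<lambda>_. top_of_set {0..1}) {..<length (edges S)}) snd"
    unfolding cell_def by (rule continuous_map_snd)
  moreover have "continuous_map (product_topology (\<lambda>_. top_of_set {0..1::real}) {..<length (edges S)}) (top_of_set {0..1}) (\<lambda>l. l k)"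
    using assms by (intro continuous_map_product_projection) simp
  ultimately have "continuous_map (cell P S) (top_of_set {0..1::real}) ((\<lambda>l. l k) \<circ> snd)"
    by (rule continuous_map_compose)
  then show ?thesis by (auto simp: o_def continuous_map_in_subtopology)
qed

lemma shape_edges: "S \<in> shapes cs x \<Longrightarrow> e \<in> set (edges S) \<longleftrightarrow> e < length (edges S)"
  by (metis (mono_tags, lifting) atLeastLessThan_iff le0 mem_Collect_eq set_upt shapes_def)

lemma continuous_map_max_label:
  assumes "\<And>q e. (q, e) \<in> set xs \<Longrightarrow> continuous_map X euclideanreal (\<lambda>z. g z e)"
  shows "continuous_map X euclideanreal (\<lambda>z. max_label (map (map_prod id (g z)) xs) p)"
  using assms
proof (induction xs)
  case (Cons y xs)
  then show ?case by (cases y) (auto intro!: continuous_map_real_max)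
qed simp

abbreviation length_space :: "(nat \<times> nat \<Rightarrow> real) topology" where
  "length_space \<equiv> product_topology (\<lambda>_. euclideanreal) UNIV"

lemma continuous_map_class_lengths: "continuous_map (W_ops cs x) length_space class_lengths"
proof (rule continuous_map_W)
  fix S assume S: "S \<in> shapes cs x"
  have "continuous_map (cell Act_bar S) euclideanreal (\<lambda>z. edge_length (realize (S, z)) p)" for p
  proof -
    have "continuous_map (cell Act_bar S) euclideanreal (\<lambda>z. max_label (map (map_prod id (snd z)) (spans S)) p)"
    proof (rule continuous_map_max_label)
      fix q e assume "(q, e) \<in> set (spans S)"
      then have "e \<in> set (edges S)" by (metis map_snd_spans_tree image_eqI list.set_map snd_conv)
      then show "continuous_map (cell Act_bar S) euclideanreal (\<lambda>z. snd z e)"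
        using S by (simp add: continuous_map_cell_length shape_edges)
    qed
    then show ?thesis
      by (cases "2 \<le> snd p \<and> snd p < length (leaves S)")
        (auto simp: edge_length_def map_tree_simps realize_eq)
  qed
  then have "continuous_map (cell Act_bar S) length_space (\<lambda>z. edge_length (realize (S, z)))"
    by (simp add: continuous_map_componentwise_UNIV)
  then show "continuous_map (cell Act_bar S) length_space (\<lambda>z. class_lengths (tree_class cs x (realize (S, z))))"
    by (rule continuous_map_eq) (simp add: class_lengths_tree_class[OF realize_labelled[OF S]] del: realize.simps)
qed

lemma inj_on_class_lengths: "inj_on class_lengths (topspace (W_ops cs x))"
proof (rule inj_onI)
  fix F G assume "F \<in> topspace (W_ops cs x)" "G \<in> topspace (W_ops cs x)"
    and "class_lengths F = class_lengths G"
  moreover obtain s t where "s \<in> act_trees cs x" "F = tree_class cs x s"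
    "t \<in> act_trees cs x" "G = tree_class cs x t"
    using calculation(1,2) by (auto simp: topspace_W)
  ultimately show "F = G" using tree_class_eq_iff by (simp add: class_lengths_tree_class)
qed

lemma max_label_le_1: "(\<And>q e. (q, e) \<in> set xs \<Longrightarrow> e \<le> 1) \<Longrightarrow> max_label xs p \<le> 1"
proof (rule ccontr)
  assume le: "\<And>q e. (q, e) \<in> set xs \<Longrightarrow> e \<le> 1" and "\<not> max_label xs p \<le> 1"
  then have gt: "1 < max_label xs p" by simp
  then obtain e where e: "(p, e) \<in> set xs" "max_label xs p \<le> e"
    using max_label_ge_iff[of "max_label xs p" xs p] by auto
  show False using le[OF e(1)] e(2) gt by simp
qed

lemma edge_length_bounds: "0 \<le> edge_length t p \<and> (good_tree t \<longrightarrow> edge_length t p \<le> 1)"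
proof (intro conjI impI)
  assume t: "good_tree t"
  have "e \<le> 1" if "(q, e) \<in> set (spans t)" for q e
    using spans_tree_within[OF t, of "fst q" "snd q" e] that by simp
  then have "max_label (spans t) p \<le> 1" by (rule max_label_le_1)
  then show "edge_length t p \<le> 1" by (simp add: edge_length_def)
qed (simp add: edge_length_def max_label_nonneg)

lemma compact_space_cell: "compact_space (cell Act_bar S)"
proof -
  have "compact_space (X :: unit topology)" for X
    by (metis compact_space_def finite finite_imp_compactin order_refl)
  then show ?thesis unfolding cell_def
    by (auto simp: compact_space_prod_topology compact_space_product_topology compact_space_subtopology)
qed

definition edge_support :: "(unit, real) tree \<Rightarrow> (nat \<times> nat) set" where
  "edge_support t = {p. edge_length t p \<noteq> 0}"

lemma finite_edge_supports: "finite (edge_support ` act_trees cs x)"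
proof (rule finite_subset)
  show "edge_support ` act_trees cs x \<subseteq> Pow ({..length cs} \<times> {..length cs})"
  proof (intro subsetI PowI; elim imageE)
    fix A t p assume t: "t \<in> act_trees cs x" and "A = edge_support t" "p \<in> A"
    then have p: "max_label (spans t) p \<noteq> 0"
      by (auto simp: edge_support_def edge_length_def split: if_splits)
    then obtain e where "(p, e) \<in> set (spans t)"
      using max_label_eq_0 by metis
    moreover have "good_tree t" "length (leaves t) = length cs" using t by (auto simp: labelled_trees_Act_bar)
    ultimately show "p \<in> {..length cs} \<times> {..length cs}"
      using spans_tree_within[of t "fst p" "snd p" e] by (cases p) auto
  qed
qed simp

text \<open>Finitely many cells suffice: a tree is equivalent to one in the cell of any tree with the same
  edge support, whatever the unary vertices and zero edges of the latter.\<close>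

lemma labelled_in_cell:
  assumes s: "s \<in> act_trees cs x" and t: "t \<in> act_trees cs x"
    and supp: "edge_support s = edge_support t"
  shows "\<exists>z \<in> topspace (cell Act_bar (number s)). tree_class cs x (realize (number s, z)) = tree_class cs x t"
proof -
  define S where "S = number s"
  have S: "S \<in> shapes cs x" using s number_shape[of s] by (auto simp: labelled_trees_Act_bar S_def)
  \<comment> \<open>Each edge of the shape gets the length that \<open>t\<close> has over its leaf
    interval. Edges over the same interval then agree, so that taking the maximum is
    harmless.\<close>
  define l where "l k = edge_length t (fst (spans S ! k))" for k
  define z where "z = (\<lambda>k \<in> {..<length (vertices S)}. (), \<lambda>k \<in> {..<length (edges S)}. l k)"
  have z: "z \<in> topspace (cell Act_bar S)"
    unfolding z_def using S number_vertices[OF s] edge_length_bounds t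
    by (intro cell_intro) (auto simp: S_def l_def labelled_trees_Act_bar)
  have edge: "snd z e = edge_length t q" if "(q, e) \<in> set (spans S)" for q e
  proof -
    from that obtain k where k: "k < length (spans S)" "spans S ! k = (q, e)"
      unfolding in_set_conv_nth by blast
    have len: "length (spans S) = length (edges S)"
      using arg_cong[OF map_snd_spans_tree[of S], of length] by simp
    \<comment> \<open>\<open>spans\<close> lists the edges in preorder, the order in which shapes
      number them; so the \<open>k\<close>-th span belongs to edge \<open>k\<close>.\<close>
    have "edges S ! k = map snd (spans S) ! k" by (simp only: map_snd_spans_tree)
    also have "\<dots> = snd (spans S ! k)" using k(1) by (rule nth_map)
    finally have "edges S ! k = e" using k(2) by simp
    moreover have "edges S = [0..<length (edges S)]" using S by (simp add: shapes_def)
    then have "edges S ! k = k" using k len nth_upt[of 0 k "length (edges S)"] by (metis add_0)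
    ultimately show ?thesis using k len by (simp add: z_def l_def)
  qed
  have "edge_length (realize (S, z)) p = edge_length t p" for p
  proof (cases "2 \<le> snd p \<and> snd p < length cs")
    case True
    have LS: "leaves S = cs" using S by (simp add: shapes_def)
    have eq: "edge_length (realize (S, z)) p = max_label (map (map_prod id (snd z)) (spans S)) p"
      using True LS by (simp add: edge_length_def map_tree_simps realize_eq)
    show ?thesis
    proof (cases "\<exists>e. (p, e) \<in> set (spans S)")
      case True
      then obtain e where "(p, e) \<in> set (spans S)" by blast
      then have "(p, snd z e) \<in> set (map (map_prod id (snd z)) (spans S))" by force
      moreover have "\<And>e'. (p, e') \<in> set (map (map_prod id (snd z)) (spans S)) \<Longrightarrow> e' = edge_length t p"
        using edge by auto
      ultimately have mem: "(p, e') \<in> set (map (map_prod id (snd z)) (spans S)) \<longleftrightarrow> e' = edge_length t p" for e'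
        using edge \<open>(p, e) \<in> set (spans S)\<close> by metis
      have "max_label (map (map_prod id (snd z)) (spans S)) p = max_label [(p, edge_length t p)] p"
        by (rule max_label_cong) (use mem in simp)
      then show ?thesis using eq edge_length_bounds[of t p] t by (simp add: labelled_trees_Act_bar)
    next
      case False
      \<comment> \<open>An interval without an edge in the shape has none in \<open>s\<close>
        either. It lies outside the common support, so its length in \<open>t\<close> is
        \<open>0\<close>.\<close>
      obtain z' where "realize (S, z') = s" using labelled_realize[OF s] S_def by blast
      then have "spans s = map (map_prod id (snd z')) (spans S)" by (cases z') (auto simp: map_tree_simps)
      with False have "max_label (spans s) p = 0" by (auto intro!: max_label_eq_0)
      then have "p \<notin> edge_support s" by (simp add: edge_support_def edge_length_def)
      then have "edge_length t p = 0" unfolding supp by (simp add: edge_support_def)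
      moreover have "max_label (map (map_prod id (snd z)) (spans S)) p = 0"
        using False by (auto intro!: max_label_eq_0)
      ultimately show ?thesis using eq by simp
    qed
  next
    case False
    then show ?thesis using labelled_length[OF t] S by (auto simp: edge_length_def map_tree_simps realize_eq shapes_def)
  qed
  then have "tree_class cs x (realize (S, z)) = tree_class cs x t"
    using tree_class_eq_iff[OF realize_labelled[OF S z] t] by auto
  then show ?thesis using z S_def by blast
qed

lemma compact_space_W: "compact_space (W_ops cs x)"
proof -
  define D where "D = edge_support ` act_trees cs x"
  define rep where "rep d = (SOME t. t \<in> act_trees cs x \<and> edge_support t = d)" for d
  have rep: "rep d \<in> act_trees cs x" "edge_support (rep d) = d" if "d \<in> D" for d
    using that someI_ex[of "\<lambda>t. t \<in> act_trees cs x \<and> edge_support t = d"]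
    by (auto simp: D_def rep_def)
  define K where "K d = (\<lambda>z. tree_class cs x (realize (number (rep d), z))) ` topspace (cell Act_bar (number (rep d)))" for d
  have "compactin (W_ops cs x) (K d)" if "d \<in> D" for d
  proof -
    have "number (rep d) \<in> shapes cs x" using rep(1)[OF that] number_shape by (force simp: labelled_trees_Act_bar)
    from continuous_map_component_injection[OF this, of "cell Act_bar"]
    have "continuous_map (cell Act_bar (number (rep d))) (W_ops cs x)
        ((\<lambda>z. tree_class cs x (realize z)) \<circ> (\<lambda>z. (number (rep d), z)))"
      unfolding ops_W
      using continuous_map_compose quotient_imp_continuous_map[OF quotient_map_quotient_topology] by blast
    then show ?thesis unfolding K_def
      using image_compactin compact_space_cell by (fastforce simp: compact_space_def o_def)
  qed
  then have "compactin (W_ops cs x) (\<Union>d\<in>D. K d)"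
    using finite_edge_supports[of cs x] by (intro compactin_Union) (auto simp: D_def)
  moreover have "(\<Union>d\<in>D. K d) = topspace (W_ops cs x)"
  proof
    show "(\<Union>d\<in>D. K d) \<subseteq> topspace (W_ops cs x)"
      using \<open>compactin _ (\<Union>d\<in>D. K d)\<close> by (rule compactin_subset_topspace)
    show "topspace (W_ops cs x) \<subseteq> (\<Union>d\<in>D. K d)"
    proof
      fix F assume "F \<in> topspace (W_ops cs x)"
      then obtain t where t: "t \<in> act_trees cs x" "F = tree_class cs x t" by (auto simp: topspace_W)
      then have "edge_support t \<in> D" by (simp add: D_def)
      with labelled_in_cell[OF rep(1)[OF this] t(1) rep(2)[OF this]] t show "F \<in> (\<Union>d\<in>D. K d)"
        by (force simp: K_def)
    qed
  qed
  ultimately show ?thesis by (simp add: compact_space_def)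
qed

text \<open>A continuous injection of a compact space into a Hausdorff space is a closed map, so
  preimages of closed sets can be computed in \<open>length_space\<close>. This replaces the missing
  quotient property for products.\<close>

lemma continuous_map_into_W:
  assumes "continuous_map Z length_space (\<lambda>z. class_lengths (f z))"
    and f: "\<And>z. z \<in> topspace Z \<Longrightarrow> f z \<in> topspace (W_ops cs x)"
  shows "continuous_map Z (W_ops cs x) f"
  unfolding continuous_map_closedin
proof (intro conjI allI impI)
  fix C assume C: "closedin (W_ops cs x) C"
  have "closed_map (W_ops cs x) length_space class_lengths"
    by (rule continuous_imp_closed_map[OF continuous_map_class_lengths compact_space_W])
      (simp add: Hausdorff_space_product_topology)
  then have "closedin length_space (class_lengths ` C)" using C by (simp add: closed_map_def)
  then have "closedin Z {z \<in> topspace Z. class_lengths (f z) \<in> class_lengths ` C}"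
    using assms(1) by (simp add: continuous_map_closedin)
  moreover have "class_lengths (f z) \<in> class_lengths ` C \<longleftrightarrow> f z \<in> C" if "z \<in> topspace Z" for z
    using inj_on_class_lengths[of cs x] f[OF that] closedin_subset[OF C] by (auto dest: inj_onD)
  ultimately show "closedin Z {z \<in> topspace Z. f z \<in> C}"
    by (metis (mono_tags, lifting) Collect_cong)
qed (use f in auto)

subsection \<open>The operad structure\<close>

text \<open>By \<open>edge_length_graft\<close> the class of a graft depends only on the edge
  lengths of its two parts, so the union over representatives in \<open>W\<close> is a union of
  equal sets.\<close>

lemma pcomp_W:
  assumes s: "s \<in> act_trees cs x" and t: "t \<in> act_trees ds (cs ! i)" and i: "i < length cs"
  shows "pcomp (W Act_bar) cs x i ds (tree_class cs x s) (tree_class ds (cs ! i) t)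
       = tree_class (plug cs i ds) x (graft s i t)"
proof -
  have "tree_class (plug cs i ds) x (graft s' i t') = tree_class (plug cs i ds) x (graft s i t)"
    if st: "s' \<in> tree_class cs x s" "t' \<in> tree_class ds (cs ! i) t" for s' t'
  proof -
    have l: "s' \<in> act_trees cs x" "t' \<in> act_trees ds (cs ! i)"
      using st equiv_bv_equiv by (auto dest!: equiv_type simp: mem_tree_class)
    moreover have "edge_length s' = edge_length s" "edge_length t' = edge_length t"
      using st by (auto dest: bv_equiv_edge_length simp: mem_tree_class)
    ultimately show ?thesis
      using assms by (simp add: tree_class_eq_iff graft_labelled edge_length_graft)
  qed
  then have "(\<Union>s'\<in>tree_class cs x s. \<Union>t'\<in>tree_class ds (cs ! i) t. tree_class (plug cs i ds) x (graft s' i t'))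
      = tree_class (plug cs i ds) x (graft s i t)"
    using tree_class_self[OF s] tree_class_self[OF t] by blast
  then show ?thesis by (simp add: W_def tree_class_def)
qed

lemma pcomp_W_in_topspace:
  assumes "F \<in> topspace (W_ops cs x)" "G \<in> topspace (W_ops ds (cs ! i))" "i < length cs"
  shows "pcomp (W Act_bar) cs x i ds F G \<in> topspace (W_ops (plug cs i ds) x)"
    and "class_lengths (pcomp (W Act_bar) cs x i ds F G)
       = compose_lengths (length cs) i (length ds) (class_lengths F) (class_lengths G)"
proof -
  obtain s t where st: "s \<in> act_trees cs x" "F = tree_class cs x s"
    "t \<in> act_trees ds (cs ! i)" "G = tree_class ds (cs ! i) t"
    using assms by (auto simp: topspace_W)
  then show "pcomp (W Act_bar) cs x i ds F G \<in> topspace (W_ops (plug cs i ds) x)"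
    using assms(3) by (auto simp: pcomp_W topspace_W graft_labelled)
  show "class_lengths (pcomp (W Act_bar) cs x i ds F G)
       = compose_lengths (length cs) i (length ds) (class_lengths F) (class_lengths G)"
    using st assms(3) graft_labelled[OF st(1,3) assms(3)]
    by (simp add: pcomp_W class_lengths_tree_class edge_length_graft)
qed

lemma continuous_map_compose_lengths:
  assumes "continuous_map Z length_space f" "continuous_map Z length_space g"
  shows "continuous_map Z length_space (\<lambda>z. compose_lengths N i M (f z) (g z))"
proof -
  have "continuous_map Z euclideanreal (\<lambda>z. f z q)" "continuous_map Z euclideanreal (\<lambda>z. g z q)" for q
    using assms unfolding continuous_map_componentwise_UNIV by blast+
  then show ?thesis by (simp add: continuous_map_componentwise_UNIV compose_lengths_def)
qed

lemma plug_parallel: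
  assumes "i < k" "k < length cs" "1 \<le> length ds"
  shows "plug (plug cs i ds) (k + length ds - 1) es = plug (plug cs k es) i ds"
proof -
  define A B C where "A = take i cs" and "B = drop (Suc i) (take k cs)" and "C = drop (Suc k) cs"
  have "take k cs = A @ cs ! i # B"
    using id_take_nth_drop[of i "take k cs"] assms by (simp add: A_def B_def min_def)
  then have cs: "cs = A @ cs ! i # B @ cs ! k # C"
    using id_take_nth_drop[of k cs] assms by (simp add: C_def)
  have "i = length A" "k = Suc (length A + length B)" using assms by (simp_all add: A_def B_def)
  then have "plug (A @ a # B @ b # C) i ds = A @ ds @ B @ b # C"
    "plug (A @ a # B @ b # C) k es = A @ a # B @ es @ C"
    "plug (A @ a # B @ es @ C) i ds = A @ ds @ B @ es @ C"
    "plug (A @ ds @ B @ b # C) (k + length ds - 1) es = A @ ds @ B @ es @ C" for a b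
    using assms by (auto simp: plug_def)
  then show ?thesis by (metis cs)
qed

text \<open>The algebraic axioms already hold for grafting of representatives; continuity of
  composition is that of \<open>compose_lengths\<close>.\<close>

lemma is_operad_W: "is_operad (W Act_bar)"
  unfolding is_operad_def
proof (intro conjI allI ballI impI; (elim conjE)?)
  fix c
  show "ident (W Act_bar) c \<in> topspace (W_ops [c] c)"
    unfolding topspace_W by (intro image_eqI[of _ _ "Trivial c"]) (simp_all add: W_def labelled_Trivial tree_class_def)
next
  fix cs ds :: "color list" and x i assume i: "i < length cs"
  have "continuous_map (prod_topology (W_ops cs x) (W_ops ds (cs ! i))) length_space
     (\<lambda>z. compose_lengths (length cs) i (length ds) (class_lengths (fst z)) (class_lengths (snd z)))"
    using continuous_map_compose[OF continuous_map_fst continuous_map_class_lengths]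
      continuous_map_compose[OF continuous_map_snd continuous_map_class_lengths]
    by (intro continuous_map_compose_lengths) (auto simp: o_def)
  then have "continuous_map (prod_topology (W_ops cs x) (W_ops ds (cs ! i))) length_space
     (\<lambda>z. class_lengths ((\<lambda>(f, g). pcomp (W Act_bar) cs x i ds f g) z))"
    by (rule continuous_map_eq) (use i pcomp_W_in_topspace(2) in auto)
  then show "continuous_map (prod_topology (W_ops cs x) (W_ops ds (cs ! i)))
          (W_ops (plug cs i ds) x) (\<lambda>(f, g). pcomp (W Act_bar) cs x i ds f g)"
    by (rule continuous_map_into_W) (use i pcomp_W_in_topspace(1) in auto)
next
  fix cs x F assume "F \<in> topspace (W_ops cs x)"
  then obtain t where t: "t \<in> act_trees cs x" "F = tree_class cs x t" by (auto simp: topspace_W)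
  have "ident (W Act_bar) x = tree_class [x] x (Trivial x)" by (simp add: W_def tree_class_def)
  moreover have "plug [x] 0 cs = cs" by (simp add: plug_def)
  ultimately show "pcomp (W Act_bar) [x] x 0 cs (ident (W Act_bar) x) F = F"
    using pcomp_W[of "Trivial x" "[x]" x t cs 0] t by (simp add: labelled_Trivial)
next
  fix cs x i F assume "F \<in> topspace (W_ops cs x)" and i: "i < length cs"
  then obtain t where t: "t \<in> act_trees cs x" "F = tree_class cs x t" by (auto simp: topspace_W)
  have "ident (W Act_bar) (cs ! i) = tree_class [cs ! i] (cs ! i) (Trivial (cs ! i))" by (simp add: W_def tree_class_def)
  moreover have "graft t i (Trivial (cs ! i)) = t" using t i by (cases t) (auto simp: labelled_Trivial)
  ultimately show "pcomp (W Act_bar) cs x i [cs ! i] F (ident (W Act_bar) (cs ! i)) = F"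
    using pcomp_W[of t cs x "Trivial (cs ! i)" "[cs ! i]" i] t i by (simp add: labelled_Trivial plug_single)
next
  fix cs x i ds j es F G H
  assume F: "F \<in> topspace (W_ops cs x)" and G: "G \<in> topspace (W_ops ds (cs ! i))"
    and H: "H \<in> topspace (W_ops es (ds ! j))" and i: "i < length cs" and j: "j < length ds"
  from F G H obtain s t u where st: "s \<in> act_trees cs x" "F = tree_class cs x s"
    "t \<in> act_trees ds (cs ! i)" "G = tree_class ds (cs ! i) t"
    "u \<in> act_trees es (ds ! j)" "H = tree_class es (ds ! j) u"
    by (auto simp: topspace_W)
  have n: "plug cs i ds ! (i + j) = ds ! j" "i + j < length (plug cs i ds)"
    using i j by (auto simp: plug_def nth_append)
  have p: "plug (plug cs i ds) (i + j) es = plug cs i (plug ds j es)"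
    using i j by (simp add: plug_def)
  show "pcomp (W Act_bar) (plug cs i ds) x (i + j) es (pcomp (W Act_bar) cs x i ds F G) H
        = pcomp (W Act_bar) cs x i (plug ds j es) F (pcomp (W Act_bar) ds (cs ! i) j es G H)"
    using pcomp_W[of "graft s i t" "plug cs i ds" x u es "i + j"] pcomp_W[of s cs x "graft t j u" "plug ds j es" i] st i j n p
    by (simp add: pcomp_W graft_labelled graft_nested)
next
  fix cs x i ds k es F G H
  assume F: "F \<in> topspace (W_ops cs x)" and G: "G \<in> topspace (W_ops ds (cs ! i))"
    and H: "H \<in> topspace (W_ops es (cs ! k))" and i: "i < k" and k: "k < length cs"
  from F G H obtain s t u where st: "s \<in> act_trees cs x" "F = tree_class cs x s"
    "t \<in> act_trees ds (cs ! i)" "G = tree_class ds (cs ! i) t"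
    "u \<in> act_trees es (cs ! k)" "H = tree_class es (cs ! k) u"
    by (auto simp: topspace_W)
  define m where "m = k + length ds - 1"
  have n: "plug cs i ds ! m = cs ! k" "m < length (plug cs i ds)"
    "plug cs k es ! i = cs ! i" "i < length (plug cs k es)"
    using i k labelled_pos[OF st(3)] by (auto simp: plug_def nth_append m_def)
  have p: "plug (plug cs i ds) m es = plug (plug cs k es) i ds"
    using plug_parallel[OF i k, of ds es] labelled_pos(1)[OF st(3)] by (simp add: m_def)
  show "pcomp (W Act_bar) (plug cs i ds) x (k + length ds - 1) es (pcomp (W Act_bar) cs x i ds F G) H
        = pcomp (W Act_bar) (plug cs k es) x i ds (pcomp (W Act_bar) cs x k es F H) G"
    unfolding m_def[symmetric] using pcomp_W[of "graft s i t" "plug cs i ds" x u es m] pcomp_W[of "graft s k u" "plug cs k es" x t ds i] st i k n p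
      graft_parallel[OF st(1,3,5) i k, folded m_def]
    by (simp add: pcomp_W graft_labelled)
qed

subsection \<open>Contractibility\<close>

lemma contractible_space_W: "contractible_space (W_ops cs x)"
proof (cases "act_trees cs x = {}")
  case True
  then have "topspace (W_ops cs x) = {}" by (simp add: topspace_W)
  then show ?thesis by simp
next
  case False
  then obtain t0 where t0: "t0 \<in> act_trees cs x" by blast
  define scale where "scale r t = map_tree (id :: unit \<Rightarrow> unit) (\<lambda>e. r * e) t" for r :: real and t :: "(unit, real) tree"
  have scale: "scale r t \<in> act_trees cs x" "edge_length (scale r t) = (\<lambda>p. r * edge_length t p)"
    if "t \<in> act_trees cs x" "0 \<le> r" "r \<le> 1" for r t
    using that by (auto simp: scale_def labelled_trees_def map_tree_simps edge_length_def max_label_scale fun_eq_iff mult_le_one)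
  \<comment> \<open>The choice of representative is harmless: the resulting class has the edge
    lengths of \<open>F\<close> times \<open>1 - r\<close>.\<close>
  define h where "h z = tree_class cs x (scale (1 - fst z) (SOME t. t \<in> snd z))" for z
  let ?Z = "prod_topology (top_of_set {0..1::real}) (W_ops cs x)"
  have h: "h (r, F) \<in> topspace (W_ops cs x)" "class_lengths (h (r, F)) = (\<lambda>p. (1 - r) * class_lengths F p)"
    if F: "F \<in> topspace (W_ops cs x)" and "0 \<le> r" "r \<le> 1" for r F
  proof -
    obtain t where t: "t \<in> act_trees cs x" "F = tree_class cs x t" using F by (auto simp: topspace_W)
    then have "(SOME t. t \<in> F) \<in> tree_class cs x t" by (metis someI tree_class_self)
    then have "(SOME t. t \<in> F) \<in> act_trees cs x"
      using equiv_bv_equiv by (auto dest!: equiv_type simp: mem_tree_class)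
    from scale[OF this, of "1 - r"] that
    have sc: "scale (1 - r) (SOME t. t \<in> F) \<in> act_trees cs x"
      "edge_length (scale (1 - r) (SOME t. t \<in> F)) = (\<lambda>p. (1 - r) * class_lengths F p)"
      by (simp_all add: class_lengths_def)
    then show "h (r, F) \<in> topspace (W_ops cs x)"
      by (simp add: h_def topspace_W)
    show "class_lengths (h (r, F)) = (\<lambda>p. (1 - r) * class_lengths F p)"
      using class_lengths_tree_class[OF sc(1)] sc(2) by (simp add: h_def)
  qed
  have "continuous_map ?Z euclideanreal (\<lambda>z. (1 - fst z) * class_lengths (snd z) p)" for p
  proof -
    have "continuous_map ?Z (top_of_set {0..1}) fst" by (rule continuous_map_fst)
    then have "continuous_map ?Z euclideanreal fst" by (simp add: continuous_map_in_subtopology)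
    moreover have "continuous_map ?Z euclideanreal (\<lambda>z. class_lengths (snd z) p)"
      using continuous_map_compose[OF continuous_map_snd continuous_map_class_lengths]
      unfolding o_def continuous_map_componentwise_UNIV by blast
    ultimately show ?thesis by (intro continuous_intros) auto
  qed
  then have "continuous_map ?Z length_space (\<lambda>z p. (1 - fst z) * class_lengths (snd z) p)"
    by (simp add: continuous_map_componentwise_UNIV)
  then have "continuous_map ?Z length_space (\<lambda>z. class_lengths (h z))"
    by (rule continuous_map_eq) (use h in auto)
  then have "continuous_map ?Z (W_ops cs x) h"
    by (rule continuous_map_into_W) (use h in auto)
  moreover have "h (0, F) = F" "h (1, F) = h (1, tree_class cs x t0)" if F: "F \<in> topspace (W_ops cs x)" for F
  proof -
    have "tree_class cs x t0 \<in> topspace (W_ops cs x)" using t0 by (simp add: topspace_W)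
    note h0 = h[OF F, of 0] and h1 = h[OF F, of 1] h[OF this, of 1]
    show "h (0, F) = F"
      by (rule inj_onD[OF inj_on_class_lengths[of cs x]]) (use h0 F in simp_all)
    \<comment> \<open>At time \<open>1\<close> all edge lengths vanish, and a class is determined by
      its edge lengths.\<close>
    show "h (1, F) = h (1, tree_class cs x t0)"
      by (rule inj_onD[OF inj_on_class_lengths[of cs x]]) (use h1 in simp_all)
  qed
  ultimately have "homotopic_with (\<lambda>_. True) (W_ops cs x) (W_ops cs x) id (\<lambda>_. h (1, tree_class cs x t0))"
    by (subst homotopic_with) auto
  then show ?thesis unfolding contractible_space_def by blast
qed

subsection \<open>From metric trees to interval widths\<close>

text \<open>A subtree of total width \<open>T\<close> above an edge of length \<open>l\<close> is shrunk to width \<open>min T (1/l)\<close>,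
  written \<open>T / max 1 (l * T)\<close> because of \<open>l = 0\<close>. For \<open>l = 0\<close> this is \<open>T\<close>, as for a contracted edge;
  for \<open>l = 1\<close> it is \<open>1\<close>, the width of a leaf, as for a grafted tree; and shrinking along two
  edges amounts to shrinking along one edge of the maximal length.\<close>

fun widths_vertex :: "('v, real) vertex \<Rightarrow> real list"
  and widths_branch :: "('v, real) branch \<Rightarrow> real list" where
  "widths_vertex (Vertex c v bs) = concat (map widths_branch bs)"
| "widths_branch (Leaf c) = [1]"
| "widths_branch (Branch l w) = map (\<lambda>x. x / max 1 (l * sum_list (widths_vertex w))) (widths_vertex w)"

definition widths_branches :: "('v, real) branch list \<Rightarrow> real list" where
  "widths_branches bs = concat (map widths_branch bs)"

lemma widths_branches_simps [simp]:
  "widths_branches [] = []" "widths_branches (b # bs) = widths_branch b @ widths_branches bs"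
  "widths_branches (as @ bs) = widths_branches as @ widths_branches bs"
  "widths_vertex (Vertex c v bs) = widths_branches bs"
  by (simp_all add: widths_branches_def)

declare widths_vertex.simps [simp del]

text \<open>For a total of at least \<open>1\<close> this equals shrinking along an edge of length
  \<open>1\<close>, which is why grafting will match composition of configurations.\<close>

definition normalize_widths :: "real list \<Rightarrow> real list" where
  "normalize_widths xs = map (\<lambda>x. x / sum_list xs) xs"

fun tree_widths :: "('v, real) tree \<Rightarrow> real list" where
  "tree_widths (Trivial c) = [1]"
| "tree_widths (Rooted w) = normalize_widths (widths_vertex w)"

lemma sum_list_divide: "sum_list (map (\<lambda>x. x / c) xs) = sum_list xs / (c :: real)"
  by (induction xs) (simp_all add: add_divide_distrib)

lemma max_1_nonzero: "max 1 y \<noteq> (0 :: real)"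
proof -
  have "1 \<le> max 1 y" by simp
  then show ?thesis by linarith
qed

text \<open>Keeps the total of every subtree at least \<open>1\<close>, so that an edge of length
  \<open>1\<close> shrinks the total to exactly \<open>1\<close>.\<close>

lemma shrink_ge_1: "1 \<le> T / max 1 (l * T)" if "1 \<le> T" "l \<le> 1" for l T :: real
proof -
  have "max 1 (l * T) \<le> T" using that mult_right_mono[of l 1 T] by simp
  then show ?thesis by simp
qed

text \<open>\<open>T\<close> is the total above the upper edge \<open>m\<close>, and
  \<open>T / max 1 (m * T)\<close> the total that reaches the lower edge \<open>l\<close>. The
  product of both divisors is that of the merged edge.\<close>

lemma shrink_shrink:
  assumes "0 \<le> T"
  shows "max 1 (m * T) * max 1 (l * (T / max 1 (m * T))) = max 1 (max l m * (T :: real))"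
proof -
  define M where "M = max 1 (m * T)"
  have M: "1 \<le> M" by (simp add: M_def)
  then have "M * max 1 (l * (T / M)) = max M (l * T)"
    by (simp add: max_mult_distrib_left)
  also have "\<dots> = max 1 (max l m * T)"
    using assms by (simp add: M_def max_mult_distrib_right max.assoc max.commute)
  finally show ?thesis by (simp add: M_def)
qed

lemma widths_length:
  fixes w :: "('v, real) vertex" and b :: "('v, real) branch"
  shows "length (widths_vertex w) = length (leaves_vertex w)"
    and "length (widths_branch b) = length (leaves_branch b)"
proof (induction w and b rule: leaves_vertex_leaves_branch.induct)
  case (1 c v bs)
  then show ?case by (induction bs) simp_all
qed simp_all

lemma widths_positive:
  shows "good_vertex w \<Longrightarrow> (\<forall>x \<in> set (widths_vertex w). 0 < x) \<and> 1 \<le> sum_list (widths_vertex w)"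
    and "good_branch b \<Longrightarrow> (\<forall>x \<in> set (widths_branch b). 0 < x) \<and> 1 \<le> sum_list (widths_branch b)"
proof (induction w and b rule: leaves_vertex_leaves_branch.induct)
  case (1 c v bs)
  then obtain b r where bs: "bs = b # r" using act_profile_nonempty(1) by (cases bs) fastforce+
  have "(\<forall>x \<in> set (widths_branches r). 0 < x) \<and> 0 \<le> sum_list (widths_branches r)"
  proof -
    have "\<forall>x \<in> set (widths_branches r). 0 < x" using 1 bs by (auto simp: widths_branches_def)
    then show ?thesis by (auto intro!: sum_list_nonneg simp: less_imp_le)
  qed
  moreover have "(\<forall>x \<in> set (widths_branch b). 0 < x) \<and> 1 \<le> sum_list (widths_branch b)"
    using 1(1)[of b] 1(2) bs by simp
  ultimately show ?case using bs by auto
next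
  case (3 l w)
  have "0 < max 1 (l * sum_list (widths_vertex w))" by simp
  with 3 show ?case by (auto simp: sum_list_divide shrink_ge_1 simp del: less_max_iff_disj)
qed simp_all

text \<open>For a contracted edge the divisor is \<open>1\<close> since its length is
  \<open>0\<close>, below a leaf since the total is \<open>1\<close> and \<open>l \<le> 1\<close>.
  The case of two merged edges is \<open>shrink_shrink\<close>.\<close>

lemma bv_vertex_widths:
  assumes "bv_vertex P w w'" "good_vertex w"
  shows "widths_vertex w' = widths_vertex w"
  using assms
proof (induction rule: bv_vertex.induct)
  case (erase_between w d c v as l m bs)
  then have "1 \<le> sum_list (widths_vertex w)" by (auto dest: widths_positive)
  then show ?case using shrink_shrink[of "sum_list (widths_vertex w)" m l]
    by (simp add: sum_list_divide o_def)
next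
  case (erase_below_leaf c v as l d bs)
  then show ?case by (simp add: max_absorb1)
qed auto

lemma normalize_widths_divide: "c \<noteq> 0 \<Longrightarrow> normalize_widths (map (\<lambda>x. x / c) xs) = normalize_widths xs"
  by (simp add: normalize_widths_def sum_list_divide)

text \<open>Erasing a unary root drops the common divisor of its upper edge, which normalization
  does not see.\<close>

lemma bv_step_widths:
  assumes "bv_step P s t" "good_tree s"
  shows "tree_widths t = tree_widths s"
  using assms
proof (induction rule: bv_step.induct)
  case (rooted w w')
  then show ?case by (simp add: bv_vertex_widths)
next
  case (erase_root w d m)
  from normalize_widths_divide[OF max_1_nonzero[of "m * sum_list (widths_vertex w)"], of "widths_vertex w"] show ?case
    by (simp only: tree_widths.simps widths_branches_simps widths_branch.simps append_Nil2)
qed (simp add: normalize_widths_def)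

lemma tree_class_widths:
  assumes "s \<in> tree_class cs x t"
  shows "tree_widths s = tree_widths t"
proof -
  have "equivclp (\<lambda>s t. s \<in> act_trees cs x \<and> t \<in> act_trees cs x \<and> bv_step Act_bar s t) t s"
    using assms by (simp add: mem_tree_class bv_equiv_def)
  then show ?thesis
    by (induction rule: equivclp_induct) (auto simp: labelled_trees_Act_bar dest: bv_step_widths)
qed

lemma tree_widths_positive:
  assumes "good_tree t"
  shows "\<forall>x \<in> set (tree_widths t). 0 < x" "sum_list (tree_widths t) = 1" "length (tree_widths t) = length (leaves t)"
proof -
  show "length (tree_widths t) = length (leaves t)" by (cases t) (simp_all add: normalize_widths_def widths_length)
  show "\<forall>x \<in> set (tree_widths t). 0 < x" "sum_list (tree_widths t) = 1"
    using assms widths_positive(1) by (cases t; fastforce simp: normalize_widths_def sum_list_divide)+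
qed

text \<open>Composition of little intervals in terms of widths: \<open>ys\<close> gives the
  proportions in which interval \<open>i\<close> is divided.\<close>

definition substitute_widths :: "real list \<Rightarrow> nat \<Rightarrow> real list \<Rightarrow> real list" where
  "substitute_widths xs i ys = take i xs @ map (\<lambda>y. xs ! i * y) ys @ drop (Suc i) xs"

lemma sum_substitute_widths:
  assumes "i < length xs" "sum_list ys = 1"
  shows "sum_list (substitute_widths xs i ys) = sum_list xs"
proof -
  have "sum_list xs = sum_list (take i xs) + (xs ! i + sum_list (drop (Suc i) xs))"
    using id_take_nth_drop[OF assms(1)] by (metis sum_list.Cons sum_list_append)
  then show ?thesis using assms(2) by (simp add: substitute_widths_def sum_list_const_mult)
qed

lemma substitute_widths_divide:
  "i < length xs \<Longrightarrow> map (\<lambda>x. x / c) (substitute_widths xs i ys) = substitute_widths (map (\<lambda>x. x / c) xs) i ys"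
  by (simp add: substitute_widths_def take_map drop_map)

lemma substitute_widths_append:
  "i < length xs \<Longrightarrow> substitute_widths (xs @ zs) i ys = substitute_widths xs i ys @ zs"
  "length xs \<le> i \<Longrightarrow> substitute_widths (xs @ zs) i ys = xs @ substitute_widths zs (i - length xs) ys"
  by (simp_all add: substitute_widths_def nth_append Suc_diff_le)

text \<open>The branch replaces a leaf of width \<open>1\<close> and has total \<open>1\<close>
  itself. So the totals of all subtrees containing it, and with them all divisors, are
  unchanged.\<close>

lemma widths_graft_vertex:
  fixes w :: "('v, real) vertex" and bs :: "('v, real) branch list"
  shows "i < length (leaves_vertex w) \<Longrightarrow> sum_list (widths_branch b) = 1 \<Longrightarrow>
      widths_vertex (graft_vertex w i b) = substitute_widths (widths_vertex w) i (widths_branch b)"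
    and "i < length (leaves_branches bs) \<Longrightarrow> sum_list (widths_branch b) = 1 \<Longrightarrow>
      widths_branches (graft_branches bs i b) = substitute_widths (widths_branches bs) i (widths_branch b)"
proof (induction w i b and bs i b rule: graft_vertex_graft_branches.induct)
  case (3 c bs i b)
  then show ?case
    using substitute_widths_append(2)[of "[1]" i "widths_branches bs"]
    by (cases i) (simp_all add: substitute_widths_def)
next
  case (4 e w bs i b)
  show ?case
  proof (cases "i < length (leaves_vertex w)")
    case True
    then have i: "i < length (widths_vertex w)" by (simp add: widths_length)
    have "widths_branch (Branch e (graft_vertex w i b)) = substitute_widths (widths_branch (Branch e w)) i (widths_branch b)"
      using True 4 i by (simp add: sum_substitute_widths substitute_widths_divide)
    then show ?thesis using True i
      by (simp add: substitute_widths_append(1) del: widths_branch.simps) (simp add: substitute_widths_append(1))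
  next
    case False
    then show ?thesis using 4 by (simp add: substitute_widths_append(2) widths_length)
  qed
qed simp_all

lemma tree_widths_graft:
  assumes s: "s \<in> act_trees cs x" and t: "t \<in> act_trees ds (cs ! i)"
    and i: "i < length cs"
  shows "tree_widths (graft s i t) = substitute_widths (tree_widths s) i (tree_widths t)"
proof (cases s)
  case (Trivial c)
  then show ?thesis using assms by (simp add: labelled_Trivial substitute_widths_def)
next
  case s': (Rooted w)
  then have len: "i < length (leaves_vertex w)" using s i by (auto simp: labelled_trees_Act_bar)
  show ?thesis
  proof (cases t)
    case (Trivial c)
    have "i < length (tree_widths s)" using len s' by (simp add: normalize_widths_def widths_length)
    then show ?thesis using s' Trivial by (simp add: substitute_widths_def id_take_nth_drop[symmetric])
  next
    case (Rooted w')
    have T: "1 \<le> sum_list (widths_vertex w')"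
      using t Rooted widths_positive(1) by (auto simp: labelled_trees_Act_bar)
    \<comment> \<open>Since the total is at least \<open>1\<close>, the divisor for the new edge of
      length \<open>1\<close> is the total itself.\<close>
    then have b: "widths_branch (Branch 1 w') = tree_widths t"
      using Rooted by (simp add: normalize_widths_def max_absorb2)
    moreover have "sum_list (tree_widths t) = 1"
      using t tree_widths_positive(2) by (auto simp: labelled_trees_Act_bar)
    ultimately show ?thesis using s' Rooted len widths_graft_vertex(1)[OF len, of "Branch 1 w'"]
      by (simp add: normalize_widths_def widths_length sum_substitute_widths substitute_widths_divide
          del: widths_branch.simps)
  qed
qed

subsection \<open>From interval widths to configurations\<close>

definition tiling :: "real \<Rightarrow> real list \<Rightarrow> config" where
  "tiling l xs =
     (\<lambda>j \<in> {..<length xs}. (l + sum_list (take j xs), l + sum_list (take (Suc j) xs)))"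

lemma sum_list_take_mono:
  assumes "\<forall>x \<in> set xs. 0 \<le> (x :: real)" "i \<le> j"
  shows "sum_list (take i xs) \<le> sum_list (take j xs)"
proof -
  have "take j xs = take i xs @ take (j - i) (drop i xs)" using assms(2) by (metis le_add_diff_inverse take_add)
  moreover have "0 \<le> sum_list (take (j - i) (drop i xs))"
    using assms(1) by (intro sum_list_nonneg) (meson in_set_dropD in_set_takeD)
  ultimately show ?thesis by simp
qed

lemma tiling_configs:
  assumes "\<forall>x \<in> set xs. 0 < x" "l + sum_list xs = 1"
  shows "tiling l xs \<in> configs l (length xs)"
proof -
  have nn: "\<forall>x \<in> set xs. 0 \<le> x" using assms(1) by (auto simp: less_imp_le)
  have "sum_list (take j xs) < sum_list (take (Suc j) xs)" if "j < length xs" for j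
    using that assms(1) by (simp add: take_Suc_conv_app_nth)
  moreover have "sum_list (take (Suc j) xs) \<le> sum_list xs" if "j < length xs" for j
    using sum_list_take_mono[OF nn, of "Suc j" "length xs"] that by simp
  moreover have "0 \<le> sum_list (take j xs)" for j
    using sum_list_take_mono[OF nn, of 0 j] by simp
  moreover have "sum_list (take (Suc i) xs) \<le> sum_list (take j xs)" if "i < j" for i j
    using sum_list_take_mono[OF nn, of "Suc i" j] that by simp
  ultimately show ?thesis using assms(2) by (auto simp: configs_def tiling_def) (smt (verit))+
qed

text \<open>The widths \<open>ys\<close> fill [l', 1], so dividing by its length
  \<open>1 - l'\<close> turns them into proportions. Endpoints are partial sums, compared before,
  within and after the glued block.\<close>

lemma glue_tiling:
  assumes i: "i < length xs" and sum: "sum_list ys = 1 - l'" and l': "l' < 1"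
  shows "glue l' (length xs) i (length ys) (tiling l xs) (tiling l' ys)
       = tiling l (substitute_widths xs i (map (\<lambda>y. y / (1 - l')) ys))"
proof
  fix j
  define n m zs where "n = length xs" and "m = length ys"
    and "zs = substitute_widths xs i (map (\<lambda>y. y / (1 - l')) ys)"
  have len: "length zs = n + m - 1" using i by (simp add: zs_def substitute_widths_def n_def m_def)
  have sum_block: "sum_list (map (\<lambda>y. xs ! i * y / (1 - l')) vs) = xs ! i * sum_list vs / (1 - l')" for vs
    by (induction vs) (simp_all add: algebra_simps add_divide_distrib)
  have before: "sum_list (take k zs) = sum_list (take k xs)" if "k \<le> i" for k
    using that i by (simp add: zs_def substitute_widths_def)
  have within: "sum_list (take k zs) = sum_list (take i xs) + xs ! i * (sum_list (take (k - i) ys) / (1 - l'))"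
    if "i \<le> k" "k \<le> i + m" for k
    using that i by (simp add: zs_def substitute_widths_def take_map sum_block m_def o_def)
  have after: "sum_list (take k zs) = sum_list (take (k + 1 - m) xs)" if "i + m \<le> k" for k
  proof -
    have "take (k + 1 - m) xs = take i xs @ take (k + 1 - m - i) (drop i xs)"
      using that by (metis add_leD1 le_add_diff_inverse nat_le_iff_add take_add Nat.le_diff_conv2 add.commute le_add1 trans_le_add1)
    also have "drop i xs = xs ! i # drop (Suc i) xs" using i by (rule Cons_nth_drop_Suc[symmetric])
    also have "k + 1 - m - i = Suc (k - m - i)" using that by simp
    finally show ?thesis using that i l' sum
      by (simp add: zs_def substitute_widths_def take_map sum_block m_def o_def) (simp add: add.commute)
  qed
  consider "j < i" | "i \<le> j" "j < i + m" | "i + m \<le> j" "j < n + m - 1" | "n + m - 1 \<le> j" by linarith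
  then have "glue l' n i m (tiling l xs) (tiling l' ys) j = tiling l zs j"
  proof cases
    case 1
    then have "j < n + m - 1" using i by (simp add: n_def)
    then show ?thesis using 1 i before[of j] before[of "Suc j"] len
      by (simp add: glue_before tiling_def n_def)
  next
    case 2
    have "sum_list (take (Suc i) xs) = sum_list (take i xs) + xs ! i" using i by (simp add: take_Suc_conv_app_nth)
    moreover have "Suc j - i = Suc (j - i)" "j - i < m" "j < n + m - 1" using 2 i by (auto simp: n_def)
    ultimately show ?thesis using 2 i within[of j] within[of "Suc j"] len
      by (simp add: glue_within tiling_def n_def m_def rescale_def)
  next
    case 3
    have "j + 1 - m < n" "Suc j + 1 - m = Suc (j + 1 - m)" using 3 by auto
    then show ?thesis using 3 after[of j] after[of "Suc j"] len
      by (simp add: glue_after tiling_def n_def)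
  next
    case 4
    then show ?thesis using len by (simp add: glue_def tiling_def)
  qed
  then show "glue l' (length xs) i (length ys) (tiling l xs) (tiling l' ys) j
       = tiling l (substitute_widths xs i (map (\<lambda>y. y / (1 - l')) ys)) j"
    by (simp only: n_def m_def zs_def)
qed

lemma sum_list_take_rev:
  "sum_list (take j (rev xs)) = sum_list xs - sum_list (take (length xs - j) (xs :: real list))"
proof -
  have "sum_list xs = sum_list (take (length xs - j) xs) + sum_list (drop (length xs - j) xs)"
    by (metis append_take_drop_id sum_list_append)
  then show ?thesis by (simp add: take_rev)
qed

lemma mirror_tiling:
  assumes "sum_list ys = 1"
  shows "mirror (length ys) (tiling 0 ys) = tiling 0 (rev ys)"
proof
  fix j
  show "mirror (length ys) (tiling 0 ys) j = tiling 0 (rev ys) j"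
  proof (cases "j < length ys")
    case True
    then have "Suc (length ys - 1 - j) = length ys - j" "length ys - 1 - j = length ys - Suc j" by auto
    then show ?thesis using True assms by (simp add: mirror_def tiling_def sum_list_take_rev)
  qed (simp add: mirror_def tiling_def)
qed

text \<open>Reflection in the origin merges the last of the adjacent intervals of \<open>[-1, 0]\<close> with its
  mirror image.\<close>

definition double_widths :: "real list \<Rightarrow> real list" where
  "double_widths xs = butlast xs @ [2 * last xs] @ rev (butlast xs)"

lemma double_widths_snoc: "double_widths (A @ [z]) = A @ [2 * z] @ rev A"
  by (simp add: double_widths_def)

lemma double_widths_facts:
  assumes "xs \<noteq> []"
  shows "length (double_widths xs) = 2 * length xs - 1" "sum_list (double_widths xs) = 2 * sum_list xs"
    "\<forall>x \<in> set xs. 0 < x \<Longrightarrow> \<forall>x \<in> set (double_widths xs). 0 < x" "rev (double_widths xs) = double_widths xs"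
proof -
  obtain A z where "xs = A @ [z]" using assms by (metis rev_exhaust)
  then show "length (double_widths xs) = 2 * length xs - 1" "sum_list (double_widths xs) = 2 * sum_list xs"
    "\<forall>x \<in> set xs. 0 < x \<Longrightarrow> \<forall>x \<in> set (double_widths xs). 0 < x" "rev (double_widths xs) = double_widths xs"
    by (auto simp: double_widths_snoc)
qed

lemma symmetric_tiling:
  assumes "rev xs = xs" "sum_list xs = 2"
  shows "symmetric_config (length xs) (tiling (-1) xs)"
  unfolding symmetric_config_def
proof (intro allI impI)
  fix j assume j: "j < length xs"
  have S: "sum_list (take k xs) = 2 - sum_list (take (length xs - k) xs)" for k
    using sum_list_take_rev[of k xs] assms by simp
  have "length xs - Suc j < length xs" using j by linarith
  then show "tiling (-1) xs (length xs - 1 - j)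
      = (- snd (tiling (-1) xs j), - fst (tiling (-1) xs j))"
    using j S[of j] S[of "Suc j"] by (simp add: tiling_def Suc_diff_Suc)
qed

text \<open>\<open>Suc i < length xs\<close> excludes the last width, the one doubled at the centre.
  The width \<open>xs ! i\<close> occurs twice in the palindrome; its right copy is divided by the
  reversed \<open>ys\<close>, its left copy by \<open>ys\<close>.\<close>

lemma glue_symmetric_tiling:
  assumes i: "Suc i < length xs" and sum: "sum_list ys = 1"
  shows "glue_symmetric (2 * length xs - 1) i (length ys)
      (tiling (-1) (double_widths xs)) (tiling 0 ys)
    = tiling (-1) (double_widths (substitute_widths xs i ys))"
proof -
  obtain V z where V: "xs = V @ [z]" using i by (metis list.size(3) not_less_zero rev_exhaust)
  define A a B where "A = take i V" and "a = V ! i" and "B = drop (Suc i) V"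
  have "V = A @ a # B" using i V id_take_nth_drop[of i V] by (simp add: A_def a_def B_def)
  then have xs: "xs = A @ a # B @ [z]" using V by simp
  have lA: "i = length A" using i V by (simp add: A_def)
  define n where "n = length xs"
  define d where "d = double_widths xs"
  have d: "d = A @ a # B @ [2 * z] @ rev B @ a # rev A"
    using double_widths_snoc[of "A @ a # B" z] by (simp add: d_def xs)
  have ld: "length d = 2 * n - 1" by (simp add: d n_def xs)
  have pos: "2 * n - 1 - 1 - i = length (A @ a # B @ [2 * z] @ rev B)" by (simp add: n_def xs lA)
  \<comment> \<open>The widths after the first of the two gluings, the one into the conjugate
    interval.\<close>
  define e where "e = A @ a # B @ [2 * z] @ rev B @ map (\<lambda>y. a * y) (rev ys) @ rev A"
  have "substitute_widths (L @ a # rev A) (length L) (rev ys) = L @ map (\<lambda>y. a * y) (rev ys) @ rev A" for L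
    by (simp add: substitute_widths_def nth_append)
  from this[of "A @ a # B @ [2 * z] @ rev B"] have e: "substitute_widths d (2 * n - 1 - 1 - i) (rev ys) = e"
    unfolding pos d e_def by simp
  have le: "length e = 2 * n - 1 + length ys - 1" by (simp add: e_def n_def xs)
  have "glue 0 (2 * n - 1) (2 * n - 1 - 1 - i) (length ys) (tiling (-1) d) (tiling 0 (rev ys))
      = tiling (-1) e"
    using glue_tiling[of "2 * n - 1 - 1 - i" d "rev ys" 0 "-1"] sum ld e i by (simp add: n_def)
  moreover have "glue 0 (2 * n - 1 + length ys - 1) i (length ys) (tiling (-1) e) (tiling 0 ys)
      = tiling (-1) (substitute_widths e i ys)"
    using glue_tiling[of i e ys 0 "-1", unfolded le] sum i by (simp add: n_def)
  moreover have "substitute_widths e i ys = double_widths (substitute_widths xs i ys)"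
    using double_widths_snoc[of "A @ map (\<lambda>y. a * y) ys @ B" z]
    by (simp add: e_def substitute_widths_def xs lA rev_map)
  ultimately show ?thesis
    using sum by (simp add: glue_symmetric_def mirror_tiling n_def[symmetric] d_def[symmetric])
qed

text \<open>The doubled widths of \<open>ys\<close> have total \<open>2\<close>, so their
  proportions are half of them. The factor cancels against the doubled centre of \<open>xs\<close>,
  which leaves \<open>z * y\<close> at the sides and twice \<open>z * w\<close> in the
  middle.\<close>

lemma glue_centre_tiling:
  assumes "length xs = Suc n" "ys \<noteq> []" and sum: "sum_list ys = 1"
  shows "glue (-1) (2 * n + 1) n (2 * length ys - 1)
      (tiling (-1) (double_widths xs)) (tiling (-1) (double_widths ys))
    = tiling (-1) (double_widths (substitute_widths xs n ys))"
proof -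
  obtain A z where xs: "xs = A @ [z]" "length A = n" using assms(1) by (metis length_Suc_conv_rev)
  obtain B w where ys: "ys = B @ [w]" using assms(2) by (metis rev_exhaust)
  have "substitute_widths (double_widths xs) n (map (\<lambda>y. y / (1 - (-1))) (double_widths ys))
      = double_widths (substitute_widths xs n ys)"
    using xs(2) double_widths_snoc[of "A @ map (\<lambda>y. z * y) B" "z * w"]
    by (simp add: xs(1) ys double_widths_snoc) (simp add: substitute_widths_def nth_append rev_map)
  moreover have l: "length (double_widths xs) = 2 * n + 1" "length (double_widths ys) = 2 * length ys - 1"
    using double_widths_facts(1)[of xs] double_widths_facts(1)[OF assms(2)] assms(1) xs(1) by auto
  moreover have "sum_list (double_widths ys) = 1 - (-1)"
    using double_widths_facts(2)[OF assms(2)] sum by simp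
  ultimately show ?thesis
    using glue_tiling[of n "double_widths xs" "double_widths ys" "-1" "-1", unfolded l]
    by (simp del: One_nat_def)
qed

subsection \<open>The morphism\<close>

definition class_widths :: "(unit, real) tree set \<Rightarrow> real list" where
  "class_widths F = tree_widths (SOME t. t \<in> F)"

lemma class_widths_tree_class:
  assumes "t \<in> act_trees cs x"
  shows "class_widths (tree_class cs x t) = tree_widths t"
proof -
  have "(SOME s. s \<in> tree_class cs x t) \<in> tree_class cs x t"
    using tree_class_self[OF assms] by (rule someI)
  then show ?thesis unfolding class_widths_def by (rule tree_class_widths)
qed

text \<open>The morphism of the theorem.\<close>

definition class_config :: "color list \<Rightarrow> color \<Rightarrow> (unit, real) tree set \<Rightarrow> config" where
  "class_config cs x F = (case x of
     Closed \<Rightarrow> tiling 0 (class_widths F)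
   | Open \<Rightarrow> tiling (-1) (double_widths (class_widths F)))"

lemma act_profile_Closed: "act_profile cs Closed \<Longrightarrow> \<exists>n \<ge> 1. cs = profile n 0"
proof -
  assume "act_profile cs Closed"
  then obtain n where "cs = profile (Suc n) 0"
    by (auto simp: act_profile_def profile_def replicate_append_same)
  then show ?thesis by (intro exI[of _ "Suc n"]) simp
qed

lemma act_profile_Open: "act_profile cs Open \<longleftrightarrow> (\<exists>n. cs = profile n 1)"
  by (simp add: act_profile_def profile_def)

lemma class_config_in_topspace:
  assumes "F \<in> topspace (W_ops cs x)"
  shows "class_config cs x F \<in> topspace (ops SC1 cs x)"
proof -
  obtain t where t: "t \<in> act_trees cs x" "F = tree_class cs x t" using assms by (auto simp: topspace_W)
  note prof = labelled_pos[OF t(1)]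
  have w: "class_widths F = tree_widths t" using t class_widths_tree_class by simp
  have good: "good_tree t" and len: "length (tree_widths t) = length cs"
    using t tree_widths_positive(3) by (auto simp: labelled_trees_Act_bar)
  note facts = tree_widths_positive(1,2)[OF good]
  show ?thesis
  proof (cases x)
    case Closed
    then obtain n where "cs = profile n 0" using act_profile_Closed prof by blast
    then show ?thesis using tiling_configs[of "tree_widths t" 0] facts len Closed
      by (simp add: class_config_def w ops_SC1 topspace_closed_configs)
  next
    case Open
    then obtain n where n: "cs = profile n 1" using act_profile_Open prof by blast
    have ne: "tree_widths t \<noteq> []" using len n by auto
    have "length (double_widths (tree_widths t)) = 2 * n + 1" using double_widths_facts(1)[OF ne] len n by simp
    then show ?thesis
      using tiling_configs[of "double_widths (tree_widths t)" "-1"]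
        symmetric_tiling[of "double_widths (tree_widths t)"] double_widths_facts[OF ne] facts Open n
      by (simp add: class_config_def w ops_SC1 topspace_open_configs)
  qed
qed

text \<open>On widths, composition in \<open>W Act_bar\<close> is \<open>substitute_widths\<close>;
  the three gluing formulas for tilings match it, one for each combination of colours.\<close>

lemma class_config_pcomp:
  assumes "F \<in> topspace (W_ops cs x)" "G \<in> topspace (W_ops ds (cs ! i))" and i: "i < length cs"
  shows "class_config (plug cs i ds) x (pcomp (W Act_bar) cs x i ds F G)
       = pcomp SC1 cs x i ds (class_config cs x F) (class_config ds (cs ! i) G)"
proof -
  obtain s t where s: "s \<in> act_trees cs x" "F = tree_class cs x s"
    and t: "t \<in> act_trees ds (cs ! i)" "G = tree_class ds (cs ! i) t"
    using assms by (auto simp: topspace_W)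
  define xs ys where "xs = tree_widths s" and "ys = tree_widths t"
  have w: "class_widths F = xs" "class_widths G = ys"
    "class_widths (pcomp (W Act_bar) cs x i ds F G) = substitute_widths xs i ys"
    using s t i by (simp_all add: pcomp_W class_widths_tree_class graft_labelled tree_widths_graft xs_def ys_def)
  have len: "length xs = length cs" "length ys = length ds" and sum: "sum_list ys = 1"
    using s t tree_widths_positive(2,3) by (auto simp: labelled_trees_Act_bar xs_def ys_def)
  note prof = labelled_pos[OF s(1)] labelled_pos[OF t(1)]
  show ?thesis
  proof (cases x)
    case Closed
    then obtain n where "cs = profile n 0" using act_profile_Closed prof by blast
    then have "cs ! i = Closed" using i by (simp add: profile_nth)
    then show ?thesis using Closed len sum i glue_tiling[of i xs ys 0 0]
      unfolding class_config_def w by (simp add: pcomp_SC1)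
  next
    case Open
    then obtain n where n: "cs = profile n 1" using act_profile_Open prof by blast
    show ?thesis
    proof (cases "cs ! i")
      case Closed
      then have "i < n" using i n by (auto simp: profile_nth split: if_splits)
      then show ?thesis using Open Closed len sum n glue_symmetric_tiling[of i xs ys]
        unfolding class_config_def w by (simp add: pcomp_SC1)
    next
      case cs_i: Open
      then have "i = n" using i n by (auto simp: profile_nth split: if_splits)
      moreover obtain m where "ds = profile m 1" using act_profile_Open prof cs_i by auto
      moreover have "ys \<noteq> []" using len prof by auto
      ultimately show ?thesis using Open cs_i len sum n glue_centre_tiling[of xs n ys]
        unfolding class_config_def w by (simp add: pcomp_SC1)
    qed
  qed
qed

lemma class_config_ident: "class_config [c] c (ident (W Act_bar) c) = ident SC1 c"
proof -
  have "ident (W Act_bar) c = tree_class [c] c (Trivial c)" by (simp add: W_def tree_class_def)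
  then have "class_widths (ident (W Act_bar) c) = [1]"
    using class_widths_tree_class[of "Trivial c" "[c]" c] by (simp add: labelled_Trivial)
  then show ?thesis
    by (cases c) (auto simp: class_config_def tiling_def SC1_def double_widths_def fun_eq_iff)
qed

section \<open>Continuity of the morphism\<close>

definition continuous_list :: "'z topology \<Rightarrow> nat \<Rightarrow> ('z \<Rightarrow> real list) \<Rightarrow> bool" where
  "continuous_list X n xs \<longleftrightarrow> (\<forall>z. length (xs z) = n) \<and> (\<forall>k<n. continuous_map X euclideanreal (\<lambda>z. xs z ! k))"

lemma continuous_list_append:
  assumes "continuous_list X n xs" "continuous_list X m ys"
  shows "continuous_list X (n + m) (\<lambda>z. xs z @ ys z)"
proof -
  have "continuous_map X euclideanreal (\<lambda>z. (xs z @ ys z) ! k)" if "k < n + m" for k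
    using assms that by (cases "k < n") (simp_all add: continuous_list_def nth_append)
  then show ?thesis using assms by (simp add: continuous_list_def)
qed

lemma continuous_list_sum:
  assumes "continuous_list X n xs" "j \<le> n"
  shows "continuous_map X euclideanreal (\<lambda>z. sum_list (take j (xs z)))"
proof -
  have "sum_list (take j (xs z)) = (\<Sum>k<j. xs z ! k)" for z
    using assms by (simp add: sum_list_sum_nth continuous_list_def atLeast0LessThan)
  then show ?thesis using assms by (auto simp: continuous_list_def intro!: continuous_map_sum)
qed

lemma continuous_list_sum_list:
  "continuous_list X n xs \<Longrightarrow> continuous_map X euclideanreal (\<lambda>z. sum_list (xs z))"
  using continuous_list_sum[of X n xs n] by (simp add: continuous_list_def)

lemma continuous_list_divide:
  assumes "continuous_list X n xs" "continuous_map X euclideanreal c" "\<And>z. z \<in> topspace X \<Longrightarrow> c z \<noteq> 0"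
  shows "continuous_list X n (\<lambda>z. map (\<lambda>x. x / c z) (xs z))"
  using assms by (auto simp: continuous_list_def intro!: continuous_map_real_divide)

text \<open>On a fixed shape the widths arise from the edge lengths by sums, products, maxima and
  quotients whose divisors are at least \<open>1\<close>.\<close>

lemma continuous_list_widths:
  fixes w :: "('v, nat) vertex" and b :: "('v, nat) branch"
  shows "(\<And>e. e \<in> set (edges_vertex w) \<Longrightarrow> continuous_map X euclideanreal (\<lambda>z. g z e)) \<Longrightarrow>
      continuous_list X (length (leaves_vertex w)) (\<lambda>z. widths_vertex (map_vertex (f z) (g z) w))"
    and "(\<And>e. e \<in> set (edges_branch b) \<Longrightarrow> continuous_map X euclideanreal (\<lambda>z. g z e)) \<Longrightarrow>
      continuous_list X (length (leaves_branch b)) (\<lambda>z. widths_branch (map_branch (f z) (g z) b))"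
proof (induction w and b rule: leaves_vertex_leaves_branch.induct)
  case (1 c v bs)
  then show ?case
  proof (induction bs)
    case Nil
    then show ?case by (simp add: continuous_list_def)
  next
    case (Cons b bs)
    then show ?case by (simp add: continuous_list_append)
  qed
next
  case (2 c)
  then show ?case by (simp add: continuous_list_def)
next
  case (3 e w)
  have "continuous_list X (length (leaves_vertex w)) (\<lambda>z. widths_vertex (map_vertex (f z) (g z) w))"
    by (rule 3(1)) (use 3(2) in simp)
  moreover from continuous_list_sum_list[OF this] have
    "continuous_map X euclideanreal (\<lambda>z. max 1 (g z e * sum_list (widths_vertex (map_vertex (f z) (g z) w))))"
    using 3(2)[of e] by (intro continuous_map_real_max continuous_map_real_mult) auto
  ultimately show ?case by (simp add: continuous_list_divide max_1_nonzero)
qed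

lemma continuous_list_tree_widths:
  assumes S: "S \<in> shapes cs x"
  shows "continuous_list (cell Act_bar S) (length cs) (\<lambda>z. tree_widths (realize (S, z)))"
proof (cases S)
  case (Trivial c)
  then have "length cs = 1" using S by (auto simp: shapes_def)
  then show ?thesis using Trivial by (simp add: continuous_list_def realize_eq)
next
  case (Rooted w)
  have n: "length (leaves_vertex w) = length cs" using S Rooted by (auto simp: shapes_def)
  have xs: "continuous_list (cell Act_bar S) (length cs) (\<lambda>z. widths_vertex (map_vertex (fst z) (snd z) w))"
    unfolding n[symmetric]
  proof (rule continuous_list_widths(1))
    fix e assume "e \<in> set (edges_vertex w)"
    then have "e < length (edges S)" using shape_edges[OF S, of e] Rooted by simp
    then show "continuous_map (cell Act_bar S) euclideanreal (\<lambda>z. snd z e)" by (rule continuous_map_cell_length)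
  qed
  \<comment> \<open>The total that normalization divides by is nonzero at points of the cell, where
    the realized tree is a labelled tree and the total is at least \<open>1\<close>.\<close>
  have "sum_list (widths_vertex (map_vertex (fst z) (snd z) w)) \<noteq> 0" if "z \<in> topspace (cell Act_bar S)" for z
  proof -
    have "good_vertex (map_vertex (fst z) (snd z) w)"
      using realize_labelled[OF S that] Rooted by (simp add: labelled_trees_Act_bar realize_eq)
    then show ?thesis using widths_positive(1) by fastforce
  qed
  with xs show ?thesis using Rooted
    by (auto simp: realize_eq normalize_widths_def intro!: continuous_list_divide continuous_list_sum_list)
qed

lemma continuous_map_tiling:
  assumes "continuous_list X n xs"
  shows "continuous_map X (interval_families n) (\<lambda>z. tiling l (xs z))"
  unfolding continuous_map_componentwise
proof (intro conjI ballI)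
  have len: "length (xs z) = n" for z using assms by (simp add: continuous_list_def)
  show "(\<lambda>z. tiling l (xs z)) ` topspace X \<subseteq> extensional {..<n}"
    by (auto simp: tiling_def len)
  fix j assume "j \<in> {..<n}"
  then have j: "j < n" by simp
  have "continuous_map X (prod_topology euclideanreal euclideanreal)
      (\<lambda>z. (l + sum_list (take j (xs z)), l + sum_list (take (Suc j) (xs z))))"
    using j assms by (intro continuous_map_pairedI continuous_map_add continuous_list_sum) auto
  then show "continuous_map X euclidean (\<lambda>z. tiling l (xs z) j)"
    using j len by (simp add: tiling_def)
qed

lemma continuous_list_double:
  assumes "continuous_list X (Suc n) xs"
  shows "continuous_list X (2 * n + 1) (\<lambda>z. double_widths (xs z))"
proof -
  have len: "length (xs z) = Suc n" for z using assms by (simp add: continuous_list_def)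
  then have ne: "xs z \<noteq> []" for z by (metis length_0_conv nat.distinct(1))
  have nth: "continuous_map X euclideanreal (\<lambda>z. xs z ! k)" if "k < Suc n" for k
    using assms that by (simp add: continuous_list_def)
  have "continuous_list X n (\<lambda>z. butlast (xs z))" "continuous_list X n (\<lambda>z. rev (butlast (xs z)))"
    using nth by (auto simp: continuous_list_def len nth_butlast rev_nth)
  moreover have "continuous_list X 1 (\<lambda>z. [2 * last (xs z)])"
    using nth[of n] by (simp add: continuous_list_def last_conv_nth[OF ne] len continuous_map_real_mult)
  ultimately have "continuous_list X (n + (1 + n)) (\<lambda>z. butlast (xs z) @ [2 * last (xs z)] @ rev (butlast (xs z)))"
    by (intro continuous_list_append)
  moreover have "n + (1 + n) = 2 * n + 1" by simp
  ultimately show ?thesis by (simp only: double_widths_def)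
qed

lemma continuous_map_class_config:
  "continuous_map (W_ops cs x) (ops SC1 cs x) (class_config cs x)"
proof (cases "act_trees cs x = {}")
  case True
  then have "topspace (W_ops cs x) = {}" by (simp add: topspace_W)
  then show ?thesis by simp
next
  case False
  then obtain t where "t \<in> act_trees cs x" by blast
  note prof = labelled_pos[OF this]
  have dom: "class_config cs x F \<in> topspace (ops SC1 cs x)" if "F \<in> topspace (W_ops cs x)" for F
    using that by (rule class_config_in_topspace)
  \<comment> \<open>Continuity is tested on cells by \<open>continuous_map_W\<close>, so
    \<open>f\<close> has to respect continuous lists over spaces of the type of the cells
    only.\<close>
  have cont: "continuous_map (W_ops cs x) Y (\<lambda>F. f (class_widths F))"
    if "\<And>(X :: ((nat \<Rightarrow> unit) \<times> (nat \<Rightarrow> real)) topology) xs.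
        continuous_list X (length cs) xs \<Longrightarrow> continuous_map X Y (\<lambda>z. f (xs z))"
    for Y and f :: "real list \<Rightarrow> config"
  proof (rule continuous_map_W)
    fix S assume S: "S \<in> shapes cs x"
    from that[OF continuous_list_tree_widths[OF this]]
    show "continuous_map (cell Act_bar S) Y (\<lambda>z. f (class_widths (tree_class cs x (realize (S, z)))))"
      by (rule continuous_map_eq) (simp add: class_widths_tree_class[OF realize_labelled[OF S]] del: realize.simps)
  qed
  show ?thesis
  proof (cases x)
    case Closed
    then obtain n where n: "cs = profile n 0" using act_profile_Closed prof by blast
    have "continuous_map (W_ops cs x) (interval_families n) (\<lambda>F. tiling 0 (class_widths F))"
      by (rule cont) (simp add: n continuous_map_tiling)
    then show ?thesis using dom Closed n
      by (simp add: ops_SC1 continuous_map_closed_configs topspace_closed_configs class_config_def[abs_def])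
  next
    case Open
    then obtain n where n: "cs = profile n 1" using act_profile_Open prof by blast
    have "continuous_map (W_ops cs x) (interval_families (2 * n + 1))
        (\<lambda>F. tiling (-1) (double_widths (class_widths F)))"
    proof (rule cont)
      fix X :: "((nat \<Rightarrow> unit) \<times> (nat \<Rightarrow> real)) topology" and xs
      assume "continuous_list X (length cs) xs"
      then have "continuous_list X (Suc n) xs" by (simp add: n)
      from continuous_map_tiling[OF continuous_list_double[OF this]]
      show "continuous_map X (interval_families (2 * n + 1)) (\<lambda>z. tiling (-1) (double_widths (xs z)))" .
    qed
    then show ?thesis using dom Open n
      by (simp add: ops_SC1 continuous_map_open_configs topspace_open_configs class_config_def[abs_def])
  qed
qed

lemma operad_morphism_class_config: "operad_morphism (W Act_bar) SC1 class_config"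
  unfolding operad_morphism_def
  using is_operad_W is_operad_SC1 continuous_map_class_config class_config_ident class_config_pcomp by blast

subsection \<open>Contractibility of the configuration spaces\<close>

definition config_segment :: "nat \<Rightarrow> real \<Rightarrow> config \<Rightarrow> config \<Rightarrow> config" where
  "config_segment k t I J = (\<lambda>j \<in> {..<k}. (1 - t) *\<^sub>R I j + t *\<^sub>R J j)"

lemma convex_less:
  fixes a b c d t :: real
  assumes "0 \<le> t" "t \<le> 1" "a < b" "c < d"
  shows "(1 - t) * a + t * c < (1 - t) * b + t * d"
proof (cases "t = 0")
  case False
  then have "t * c < t * d" using assms by simp
  moreover have "(1 - t) * a \<le> (1 - t) * b" using assms by (intro mult_left_mono) auto
  ultimately show ?thesis by simp
qed (use assms in simp)

lemma convex_le:
  fixes a b c d t :: real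
  assumes "0 \<le> t" "t \<le> 1" "a \<le> b" "c \<le> d"
  shows "(1 - t) * a + t * c \<le> (1 - t) * b + t * d"
  using assms by (intro add_mono mult_left_mono) auto

text \<open>The conditions on configurations are inequalities between affine functions of the
  endpoints, hence they persist along segments.\<close>

lemma config_segment_configs:
  assumes "I \<in> configs l k" "J \<in> configs l k" "0 \<le> t" "t \<le> 1"
  shows "config_segment k t I J \<in> configs l k"
proof -
  have "l \<le> (1 - t) * fst (I j) + t * fst (J j)" if "j < k" for j
    using convex_le[OF assms(3,4), of l "fst (I j)" l "fst (J j)"] assms that
    by (simp add: configs_def algebra_simps)
  moreover have "(1 - t) * snd (I j) + t * snd (J j) \<le> 1" if "j < k" for j
    using convex_le[OF assms(3,4), of "snd (I j)" 1 "snd (J j)" 1] assms that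
    by (simp add: configs_def algebra_simps)
  moreover have "(1 - t) * fst (I j) + t * fst (J j) < (1 - t) * snd (I j) + t * snd (J j)" if "j < k" for j
    using assms that by (intro convex_less) (auto simp: configs_def)
  moreover have "(1 - t) * snd (I i) + t * snd (J i) \<le> (1 - t) * fst (I j) + t * fst (J j)" if "i < j" "j < k" for i j
    using assms that by (intro convex_le) (auto simp: configs_def)
  ultimately show ?thesis by (auto simp: configs_def config_segment_def)
qed

lemma config_segment_symmetric:
  assumes "symmetric_config k I" "symmetric_config k J"
  shows "symmetric_config k (config_segment k t I J)"
  using assms by (auto simp: symmetric_config_def config_segment_def)

lemma contractible_space_configs:
  assumes "C \<subseteq> configs l k"
    and seg: "\<And>I J t. I \<in> C \<Longrightarrow> J \<in> C \<Longrightarrow> 0 \<le> t \<Longrightarrow> t \<le> 1 \<Longrightarrow> config_segment k t I J \<in> C"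
  shows "contractible_space (subtopology (interval_families k) C)"
proof (cases "C = {}")
  case False
  then obtain J where J: "J \<in> C" by blast
  let ?X = "subtopology (interval_families k) C"
  let ?Z = "prod_topology (top_of_set {0..1::real}) ?X"
  have "configs l k \<subseteq> extensional {..<k}" by (auto simp: configs_def PiE_def)
  then have ext: "C \<subseteq> extensional {..<k}" using assms(1) by blast
  then have top: "topspace ?X = C" by (auto simp: PiE_def)
  define h where "h z = config_segment k (fst z) (snd z) J" for z
  have "continuous_map ?Z (interval_families k) h"
    unfolding continuous_map_componentwise
  proof (intro conjI ballI)
    fix j assume "j \<in> {..<k}"
    then have j: "j < k" by simp
    have "continuous_map ?Z euclideanreal fst"
      using continuous_map_fst[of "top_of_set {0..1::real}" ?X] by (simp add: continuous_map_in_subtopology)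
    moreover have "continuous_map ?Z (interval_families k) snd"
      using continuous_map_snd[of "top_of_set {0..1::real}" ?X] by (simp add: continuous_map_in_subtopology)
    then have "continuous_map ?Z euclidean (\<lambda>z. snd z j)" using j by (rule continuous_map_component)
    ultimately have "continuous_map ?Z euclidean (\<lambda>z. (fst z, snd z j))"
      using continuous_map_pairedI[of ?Z euclideanreal fst euclidean "\<lambda>z. snd z j"] by simp
    moreover have "continuous_map euclidean euclidean (\<lambda>(t, I). (1 - t) *\<^sub>R I + t *\<^sub>R J j)"
      by (auto simp: case_prod_unfold intro!: continuous_intros)
    ultimately have "continuous_map ?Z euclidean ((\<lambda>(t, I). (1 - t) *\<^sub>R I + t *\<^sub>R J j) \<circ> (\<lambda>z. (fst z, snd z j)))"
      by (rule continuous_map_compose)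
    then show "continuous_map ?Z euclidean (\<lambda>z. h z j)"
      using j by (simp add: h_def config_segment_def o_def)
  qed (auto simp: h_def config_segment_def)
  moreover have "h z \<in> C" if "z \<in> topspace ?Z" for z
  proof -
    have "0 \<le> fst z" "fst z \<le> 1" "snd z \<in> C" using that top by (auto simp: mem_Times_iff)
    then show ?thesis unfolding h_def using seg J by blast
  qed
  ultimately have "continuous_map ?Z ?X h" unfolding continuous_map_in_subtopology Pi_iff by blast
  \<comment> \<open>Equality as functions needs extensionality: the segment takes the default value
    outside \<open>{..<k}\<close>, as \<open>I\<close> and \<open>J\<close> do.\<close>
  moreover have "h (0, I) = I" "h (1, I) = J" if "I \<in> C" for I
    using subsetD[OF ext that] subsetD[OF ext J] by (auto simp: h_def config_segment_def extensional_def)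
  ultimately have "homotopic_with (\<lambda>_. True) ?X ?X id (\<lambda>_. J)"
    by (subst homotopic_with) (simp, use top in \<open>intro exI[of _ h], simp\<close>)
  then show ?thesis unfolding contractible_space_def by blast
qed simp

lemma contractible_space_closed_configs: "contractible_space (closed_configs n)"
  unfolding closed_configs_def
  by (rule contractible_space_configs[OF order_refl]) (rule config_segment_configs)

lemma contractible_space_open_configs: "contractible_space (open_configs n c)"
proof -
  have "{I \<in> configs (-1) (2 * n + c). \<forall>j < 2 * n + c. I (2 * n + c - 1 - j) = (- snd (I j), - fst (I j))}
      = {I \<in> configs (-1) (2 * n + c). symmetric_config (2 * n + c) I}"
    by (simp add: symmetric_config_def)
  moreover have "contractible_space (subtopology (interval_families (2 * n + c))
      {I \<in> configs (-1) (2 * n + c). symmetric_config (2 * n + c) I})"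
    by (rule contractible_space_configs[of _ "-1"])
      (blast, simp add: config_segment_configs config_segment_symmetric)
  ultimately show ?thesis by (simp only: open_configs_def)
qed

text \<open>Any two continuous maps into a contractible space are homotopic, so a constant map
  serves as homotopy inverse; a point of \<open>X\<close> supplies its value.\<close>

lemma homotopy_equivalence_map_contractible:
  assumes "continuous_map X Y f" "contractible_space X" "contractible_space Y" "topspace X \<noteq> {}"
  shows "homotopy_equivalence_map X Y f"
proof -
  obtain a where a: "a \<in> topspace X" using assms(4) by blast
  then have g: "continuous_map Y X (\<lambda>_. a)" by simp
  have "homotopic_with (\<lambda>_. True) X X ((\<lambda>_. a) \<circ> f) id"
    using continuous_map_compose[OF assms(1) g] assms(2) by (intro homotopic_into_contractible_space) auto
  moreover have "homotopic_with (\<lambda>_. True) Y Y (f \<circ> (\<lambda>_. a)) id"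
    using continuous_map_compose[OF g assms(1)] assms(3) by (intro homotopic_into_contractible_space) auto
  ultimately show ?thesis using assms(1) g unfolding homotopy_equivalence_map_def by blast
qed

text \<open>The witness is the corolla, a single vertex carrying all the leaves.\<close>

lemma labelled_trees_nonempty:
  assumes "act_profile cs x"
  shows "act_trees cs x \<noteq> {}"
proof -
  have "leaves_branches (map Leaf cs) = cs" by (induction cs) auto
  then have "Rooted (Vertex x () (map Leaf cs)) \<in> act_trees cs x"
    using assms by (auto simp: labelled_trees_Act_bar o_def)
  then show ?thesis by blast
qed

theorem mainTheorem2:
  shows "\<exists>\<theta>. operad_morphism (W Act_bar) SC1 \<theta> \<and>
    (\<forall>n\<ge>1.
       homotopy_equivalence_map
         (ops (W Act_bar) (profile n 0) Closed) (ops SC1 (profile n 0) Closed) (\<theta> (profile n 0) Closed) \<and>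
       homotopy_equivalence_map
         (ops (W Act_bar) (profile n 1) Open) (ops SC1 (profile n 1) Open) (\<theta> (profile n 1) Open))"
proof (intro exI[of _ class_config] conjI allI impI operad_morphism_class_config)
  fix n :: nat assume "n \<ge> 1"
  \<comment> \<open>For \<open>n = 0\<close> the source would be empty, whereas \<open>SC1\<close>
    has the empty configuration.\<close>
  then obtain k where "n = Suc k" by (cases n) auto
  then have "act_profile (profile n 0) Closed"
    by (auto simp: act_profile_def profile_def replicate_append_same intro!: exI[of _ k])
  then show "homotopy_equivalence_map (W_ops (profile n 0) Closed) (ops SC1 (profile n 0) Closed)
      (class_config (profile n 0) Closed)"
    using contractible_space_closed_configs labelled_trees_nonempty
    by (intro homotopy_equivalence_map_contractible continuous_map_class_config contractible_space_W)
      (auto simp: ops_SC1 topspace_W)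
next
  fix n :: nat
  have "act_profile (profile n 1) Open" using act_profile_Open by blast
  then show "homotopy_equivalence_map (W_ops (profile n 1) Open) (ops SC1 (profile n 1) Open)
      (class_config (profile n 1) Open)"
    using contractible_space_open_configs labelled_trees_nonempty
    by (intro homotopy_equivalence_map_contractible continuous_map_class_config contractible_space_W)
      (auto simp: ops_SC1(2)[OF order_refl] topspace_W simp del: One_nat_def)
qed

end
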